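(* Let $\alpha\in(\frac13,\frac12)$, let $p\ge3$ be an integer, let $k>\frac d2+p+1$, and let $\mathbf{x}=(x,x^{(2)})\in\mathscr{C}^\alpha_{wg}([0,T],H^k(\mathbb{R}^d,\mathbb{R}^d))$ be a weakly geometric $\alpha$-rough path with values in the Sobolev space $H^k(\mathbb{R}^d,\mathbb{R}^d)$. Suppose $y$ solves $dy_t=\mathbf{X}_{dt}(y_t)$, where $\mathbf{X}=(X,\mathbb{X})$ is the rough driver built from $\mathbf{x}$. Then there exists a sequence of functions $x^n:[0,T]\times\mathbb{R}^d\to\mathbb{R}^d$ of bounded variation in $t$ such that the solution $y^n$ of $$\dot y^n_t=x^n_t(y^n_t)$$ converges to $y$ in $C^\beta([0,T],C(\mathbb{R}^d,\mathbb{R}^d))$ for any $\beta\in(\frac13,\alpha)$.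
   Context: Weakly geometric rough path: for the Hilbert space $E=H^k(\mathbb{R}^d,\mathbb{R}^d)$ let $E\otimes E$ be the completion of the algebraic tensor product with respect to a Schatten $q$-norm, $1\le q\le\infty$ (algebraic tensors being identified with finite rank operators, with norm the $\ell^q$-norm of the singular values). An $\alpha$-rough path is a pair $x:[0,T]\to E$, $x^{(2)}:[0,T]^2\to E\otimes E$ with $\|x_t-x_s\|\lesssim|t-s|^\alpha$, $\|x^{(2)}_{st}\|\lesssim|t-s|^{2\alpha}$ and $x^{(2)}_{st}-x^{(2)}_{su}-x^{(2)}_{ut}=(x_u-x_s)\otimes(x_t-x_u)$. It is weakly geometric if the symmetric part of $x^{(2)}_{st}$ is $\frac12(x_t-x_s)\otimes(x_t-x_s)$. Identification with functions: by Sobolev embedding $H^k(\mathbb{R}^d,\mathbb{R}^d)\subset C^p_b(\mathbb{R}^d,\mathbb{R}^d)$, and tensors are regarded as matrix-valued functions on $\mathbb{R}^d\times\mathbb{R}^d$ through $(f\otimes g)(\xi,\zeta)=f(\xi)g(\zeta)^T$. With $x_{st}=x_t-x_s$, weak geometricity reads $x^{(2),\mu,\nu}_{st}(\xi,\zeta)+x^{(2),\nu,\mu}_{st}(\zeta,\xi)=x^\mu_{st}(\xi)x^\nu_{st}(\zeta)$. Rough driver built from $\mathbf{x}$: the first and second order differential operators $$X_{st}(\xi)=x_{st}(\xi)\cdot\nabla,\qquad \mathbb{X}_{st}(\xi)=\nabla_2^\otimes x^{(2)}_{st}(\xi,\xi)+x^{(2)}_{st}(\xi,\xi)\nabla^2,$$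 where $a\nabla^2=\sum_{\mu,\nu}a^{\mu,\nu}\frac{\partial}{\partial\xi^\mu}\frac{\partial}{\partial\xi^\nu}$ for a matrix $a$, and $\nabla_2^\otimes$ extends $f\otimes g\mapsto\sum_{\mu,\nu}f^\mu\frac{\partial g^\nu}{\partial\xi^\mu}\frac{\partial}{\partial\xi^\nu}$, i.e. $\nabla_2^\otimes a(\xi,\xi)=\sum_{\mu,\nu}\big(\partial_{\zeta^\mu}a^{\mu,\nu}(\xi,\zeta)\big)\big|_{\zeta=\xi}\frac{\partial}{\partial\xi^\nu}$. Solution of $dy_t=\mathbf{X}_{dt}(y_t)$ (in the sense of Bailleul–Riedel rough flows): for $s\le t$ let $\mu_{ts}:\mathbb{R}^d\to\mathbb{R}^d$ be the time-one map of the ordinary differential equation driven by the vector field $X_{st}+\big(\mathbb{X}_{st}-\frac12X_{st}X_{st}\big)$ (the bracket is a first order operator, i.e. a vector field, by weak geometricity). A flow of homeomorphisms $(\varphi_{ts})_{0\le s\le t\le T}$ (so $\varphi_{tt}=\mathrm{id}$, $\varphi_{tu}\circ\varphi_{us}=\varphi_{ts}$) solves the equation if there are $\delta>0$, $c>0$ and $a>1$ with $\sup_{\xi}|\varphi_{ts}(\xi)-\mu_{ts}(\xi)|\le c|t-s|^a$ whenever $0\le t-s\le\delta$; then $y_t=\varphi_{t0}$. Likewise $y^n_t:\mathbb{R}^d\to\mathbb{R}^d$ denotes the flow map of the ordinary differential equation, with $y^n_0=\mathrm{id}$. Convergence in $C^\beta([0,T],C(\mathbb{R}^d,\mathbb{R}^d))$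 means that $y^n-y$ tends to $0$ in the $\beta$-Hölder norm in $t$ with respect to the supremum norm on $C(\mathbb{R}^d,\mathbb{R}^d)$. *)

theory Defs
  imports "HOL-Analysis.Analysis"
begin

type_synonym 'd vfield = "real^'d \<Rightarrow> real^'d"
type_synonym 'd mfield = "real^'d \<Rightarrow> real^'d \<Rightarrow> real^'d^'d"

section \<open>The Sobolev space H^k\<close>

definition truncated_fourier :: "real \<Rightarrow> ('d::finite) vfield \<Rightarrow> real^'d \<Rightarrow> complex^'d" where
  "truncated_fourier R f \<omega> =
     (\<chi> j. complex_of_real ((2 * pi) powr (- (real CARD('d) / 2))) *
        (LINT \<xi>:cball 0 R|lborel. cis (- (\<omega> \<bullet> \<xi>)) * complex_of_real (f \<xi> $ j)))"

text \<open>The Fourier--Plancherel transform of a square integrable \<open>f\<close>: the \<open>L\<^sup>2\<close>-limit of the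
  transforms of the truncations of \<open>f\<close> to balls. It is determined up to a null set.\<close>

definition has_fourier :: "('d::finite) vfield \<Rightarrow> (real^'d \<Rightarrow> complex^'d) \<Rightarrow> bool" where
  "has_fourier f F \<longleftrightarrow>
     F \<in> borel_measurable lborel \<and> integrable lborel (\<lambda>\<omega>. (norm (F \<omega>))\<^sup>2) \<and>
     ((\<lambda>R. \<integral>\<^sup>+\<omega>. ennreal ((norm (F \<omega> - truncated_fourier R f \<omega>))\<^sup>2) \<partial>lborel) \<longlongrightarrow> 0) at_top"

definition fourier :: "('d::finite) vfield \<Rightarrow> real^'d \<Rightarrow> complex^'d" where
  "fourier f = (SOME F. has_fourier f F)"

text \<open>The order \<open>k\<close> is real. The space is only used for \<open>k > d/2\<close>, where every class of functions
  modulo null sets has exactly one continuous representative; elements are these representatives.\<close>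

definition sobolev_space :: "real \<Rightarrow> ('d::finite) vfield set" where
  "sobolev_space k =
     {f. continuous_on UNIV f \<and> integrable lborel (\<lambda>\<xi>. (norm (f \<xi>))\<^sup>2) \<and>
         (\<exists>F. has_fourier f F \<and>
              integrable lborel (\<lambda>\<omega>. (1 + (norm \<omega>)\<^sup>2) powr k * (norm (F \<omega>))\<^sup>2))}"

text \<open>On \<open>complex^'d\<close> the operation \<open>\<bullet>\<close> is the real part of the Hermitian inner product.\<close>

definition sobolev_inner :: "real \<Rightarrow> ('d::finite) vfield \<Rightarrow> 'd vfield \<Rightarrow> real" where
  "sobolev_inner k f g =
     (LINT \<omega>|lborel. (1 + (norm \<omega>)\<^sup>2) powr k * (fourier f \<omega> \<bullet> fourier g \<omega>))"

definition sobolev_norm :: "real \<Rightarrow> ('d::finite) vfield \<Rightarrow> real" where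
  "sobolev_norm k f = sqrt (sobolev_inner k f f)"

definition orthonormal_family :: "real \<Rightarrow> nat \<Rightarrow> (nat \<Rightarrow> ('d::finite) vfield) \<Rightarrow> bool" where
  "orthonormal_family k m u \<longleftrightarrow>
     (\<forall>i<m. u i \<in> sobolev_space k) \<and>
     (\<forall>i<m. \<forall>j<m. sobolev_inner k (u i) (u j) = (if i = j then 1 else 0))"

section \<open>Tensors and Schatten norms\<close>

definition tensor :: "('d::finite) vfield \<Rightarrow> 'd vfield \<Rightarrow> 'd mfield" where
  "tensor f g \<xi> \<zeta> = (\<chi> \<mu> \<nu>. f \<xi> $ \<mu> * g \<zeta> $ \<nu>)"

definition flip :: "('d::finite) mfield \<Rightarrow> 'd mfield" where
  "flip a \<xi> \<zeta> = transpose (a \<zeta> \<xi>)"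

definition sym_part :: "('d::finite) mfield \<Rightarrow> 'd mfield" where
  "sym_part a \<xi> \<zeta> = (1/2) *\<^sub>R (a \<xi> \<zeta> + flip a \<xi> \<zeta>)"

definition lq_norm :: "ereal \<Rightarrow> nat \<Rightarrow> (nat \<Rightarrow> real) \<Rightarrow> real" where
  "lq_norm q m \<sigma> =
     (if q = \<infinity> then Max (insert 0 (\<sigma> ` {..<m}))
      else (\<Sum>i<m. \<sigma> i powr real_of_ereal q) powr (1 / real_of_ereal q))"

text \<open>An algebraic tensor \<open>\<Sum>i. f i \<otimes> g i\<close> is regarded as the finite rank operator
  \<open>h \<mapsto> \<Sum>i. \<langle>g i, h\<rangle> f i\<close> on \<open>H\<^sup>k\<close>. A singular value decomposition of that operator, with singular
  values \<open>\<sigma> i\<close>, is an expression of the tensor as below. Every algebraic tensor has one, and the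
  \<open>\<sigma> i\<close> are unique up to order, so \<open>has_schatten_norm q k a\<close> holds of exactly one number
  if \<open>a\<close> is an algebraic tensor, and of no number otherwise.\<close>

definition has_schatten_norm :: "ereal \<Rightarrow> real \<Rightarrow> ('d::finite) mfield \<Rightarrow> real \<Rightarrow> bool" where
  "has_schatten_norm q k a r \<longleftrightarrow>
     (\<exists>m \<sigma> u v. (\<forall>i<m. 0 < \<sigma> i) \<and> orthonormal_family k m u \<and> orthonormal_family k m v \<and>
        a = (\<lambda>\<xi> \<zeta>. \<Sum>i<m. \<sigma> i *\<^sub>R tensor (u i) (v i) \<xi> \<zeta>) \<and> r = lq_norm q m \<sigma>)"

text \<open>The completion of the algebraic tensor product in the Schatten norm, together with its norm.
  Point evaluations are continuous on \<open>H\<^sup>k\<close> for \<open>k > d/2\<close>, so a Cauchy sequence of algebraic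
  tensors converges pointwise, and the pointwise limit is the function identified with its limit
  in the completion. This identification is injective.\<close>

definition has_tensor_norm :: "ereal \<Rightarrow> real \<Rightarrow> ('d::finite) mfield \<Rightarrow> real \<Rightarrow> bool" where
  "has_tensor_norm q k a r \<longleftrightarrow>
     (\<exists>b \<rho>. (\<forall>n. has_schatten_norm q k (b n) (\<rho> n)) \<and>
        (\<forall>e>0. \<exists>N. \<forall>m\<ge>N. \<forall>n\<ge>N. \<exists>r'<e. has_schatten_norm q k (\<lambda>\<xi> \<zeta>. b m \<xi> \<zeta> - b n \<xi> \<zeta>) r') \<and>
        (\<forall>\<xi> \<zeta>. (\<lambda>n. b n \<xi> \<zeta>) \<longlonglongrightarrow> a \<xi> \<zeta>) \<and> \<rho> \<longlonglongrightarrow> r)"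

section \<open>Rough paths\<close>

definition increment :: "(real \<Rightarrow> ('d::finite) vfield) \<Rightarrow> real \<Rightarrow> real \<Rightarrow> 'd vfield" where
  "increment x s t = (\<lambda>\<xi>. x t \<xi> - x s \<xi>)"

definition rough_path ::
  "ereal \<Rightarrow> real \<Rightarrow> real \<Rightarrow> real \<Rightarrow> (real \<Rightarrow> ('d::finite) vfield) \<Rightarrow> (real \<Rightarrow> real \<Rightarrow> 'd mfield) \<Rightarrow> bool"
  where
  "rough_path q k \<alpha> T x x2 \<longleftrightarrow>
     (\<forall>t\<in>{0..T}. x t \<in> sobolev_space k) \<and>
     (\<exists>C. \<forall>s\<in>{0..T}. \<forall>t\<in>{0..T}. sobolev_norm k (increment x s t) \<le> C * \<bar>t - s\<bar> powr \<alpha>) \<and>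
     (\<exists>C. \<forall>s\<in>{0..T}. \<forall>t\<in>{0..T}.
        \<exists>r. has_tensor_norm q k (x2 s t) r \<and> r \<le> C * \<bar>t - s\<bar> powr (2 * \<alpha>)) \<and>
     (\<forall>s\<in>{0..T}. \<forall>u\<in>{0..T}. \<forall>t\<in>{0..T}. \<forall>\<xi> \<zeta>.
        x2 s t \<xi> \<zeta> - x2 s u \<xi> \<zeta> - x2 u t \<xi> \<zeta> = tensor (increment x s u) (increment x u t) \<xi> \<zeta>)"

definition weakly_geometric_rough_path ::
  "ereal \<Rightarrow> real \<Rightarrow> real \<Rightarrow> real \<Rightarrow> (real \<Rightarrow> ('d::finite) vfield) \<Rightarrow> (real \<Rightarrow> real \<Rightarrow> 'd mfield) \<Rightarrow> bool"
  where
  "weakly_geometric_rough_path q k \<alpha> T x x2 \<longleftrightarrow>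
     rough_path q k \<alpha> T x x2 \<and>
     (\<forall>s\<in>{0..T}. \<forall>t\<in>{0..T}. \<forall>\<xi> \<zeta>.
        sym_part (x2 s t) \<xi> \<zeta> = (1/2) *\<^sub>R tensor (increment x s t) (increment x s t) \<xi> \<zeta>)"

section \<open>The rough driver and its solutions\<close>

definition partial :: "'d::finite \<Rightarrow> (real^'d \<Rightarrow> real) \<Rightarrow> real^'d \<Rightarrow> real" where
  "partial \<mu> f \<xi> = frechet_derivative f (at \<xi>) (axis \<mu> 1)"

definition driver1 ::
  "(real \<Rightarrow> ('d::finite) vfield) \<Rightarrow> real \<Rightarrow> real \<Rightarrow> (real^'d \<Rightarrow> real) \<Rightarrow> real^'d \<Rightarrow> real" where
  "driver1 x s t f \<xi> = (\<Sum>\<mu>\<in>UNIV. increment x s t \<xi> $ \<mu> * partial \<mu> f \<xi>)"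

definition driver2 ::
  "(real \<Rightarrow> real \<Rightarrow> ('d::finite) mfield) \<Rightarrow> real \<Rightarrow> real \<Rightarrow> (real^'d \<Rightarrow> real) \<Rightarrow> real^'d \<Rightarrow> real" where
  "driver2 x2 s t f \<xi> =
     (\<Sum>\<mu>\<in>UNIV. \<Sum>\<nu>\<in>UNIV. partial \<mu> (\<lambda>\<zeta>. x2 s t \<xi> \<zeta> $ \<mu> $ \<nu>) \<xi> * partial \<nu> f \<xi>) +
     (\<Sum>\<mu>\<in>UNIV. \<Sum>\<nu>\<in>UNIV. x2 s t \<xi> \<xi> $ \<mu> $ \<nu> * partial \<mu> (partial \<nu> f) \<xi>)"

definition driver_operator ::
  "(real \<Rightarrow> ('d::finite) vfield) \<Rightarrow> (real \<Rightarrow> real \<Rightarrow> 'd mfield) \<Rightarrow> real \<Rightarrow> real \<Rightarrow>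
     (real^'d \<Rightarrow> real) \<Rightarrow> real^'d \<Rightarrow> real" where
  "driver_operator x x2 s t f \<xi> =
     driver1 x s t f \<xi> + (driver2 x2 s t f \<xi> - 1/2 * driver1 x s t (driver1 x s t f) \<xi>)"

text \<open>For a weakly geometric rough path \<open>driver_operator\<close> has no second order part, and a first order
  operator \<open>\<Sum>\<nu>. V\<^sup>\<nu> \<partial>\<^sub>\<nu>\<close> has as \<open>\<nu>\<close>-th coefficient its value on the \<open>\<nu>\<close>-th coordinate function.\<close>

definition driver_field ::
  "(real \<Rightarrow> ('d::finite) vfield) \<Rightarrow> (real \<Rightarrow> real \<Rightarrow> 'd mfield) \<Rightarrow> real \<Rightarrow> real \<Rightarrow> 'd vfield" where
  "driver_field x x2 s t \<xi> = (\<chi> \<nu>. driver_operator x x2 s t (\<lambda>\<eta>. \<eta> $ \<nu>) \<xi>)"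

definition time_one_map :: "('d::finite) vfield \<Rightarrow> 'd vfield" where
  "time_one_map V \<xi> =
     (THE \<eta>. \<exists>z. z 0 = \<xi> \<and> z 1 = \<eta> \<and>
        (\<forall>r\<in>{0..1}. (z has_vector_derivative V (z r)) (at r within {0..1})))"

text \<open>\<open>\<phi> t s\<close> is the map from time \<open>s\<close> to time \<open>t\<close>; only \<open>0 \<le> s \<le> t \<le> T\<close> matters.\<close>

definition homeo_flow :: "real \<Rightarrow> (real \<Rightarrow> real \<Rightarrow> ('d::finite) vfield) \<Rightarrow> bool" where
  "homeo_flow T \<phi> \<longleftrightarrow>
     (\<forall>s t. 0 \<le> s \<and> s \<le> t \<and> t \<le> T \<longrightarrow> (\<exists>g. homeomorphism UNIV UNIV (\<phi> t s) g)) \<and>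
     (\<forall>t\<in>{0..T}. \<phi> t t = id) \<and>
     (\<forall>s u t. 0 \<le> s \<and> s \<le> u \<and> u \<le> t \<and> t \<le> T \<longrightarrow> \<phi> t u \<circ> \<phi> u s = \<phi> t s)"

definition solves_rough_equation ::
  "real \<Rightarrow> (real \<Rightarrow> ('d::finite) vfield) \<Rightarrow> (real \<Rightarrow> real \<Rightarrow> 'd mfield) \<Rightarrow> (real \<Rightarrow> 'd vfield) \<Rightarrow> bool"
  where
  "solves_rough_equation T x x2 y \<longleftrightarrow>
     (\<exists>\<phi>. homeo_flow T \<phi> \<and>
        (\<exists>\<delta>>0. \<exists>c>0. \<exists>a>1. \<forall>s t. 0 \<le> s \<and> s \<le> t \<and> t \<le> T \<and> t - s \<le> \<delta> \<longrightarrow>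
           (\<forall>\<xi>. norm (\<phi> t s \<xi> - time_one_map (driver_field x x2 s t) \<xi>) \<le> c * (t - s) powr a)) \<and>
        (\<forall>t\<in>{0..T}. y t = \<phi> t 0))"

section \<open>Approximating equations and mode of convergence\<close>

text \<open>Bounded variation in time, as a path in \<open>C(\<real>\<^sup>d,\<real>\<^sup>d)\<close> with the supremum norm.\<close>

definition bounded_variation_path :: "real \<Rightarrow> (real \<Rightarrow> ('d::finite) vfield) \<Rightarrow> bool" where
  "bounded_variation_path T v \<longleftrightarrow>
     (\<forall>t\<in>{0..T}. continuous_on UNIV (v t)) \<and>
     (\<exists>C. \<forall>m \<tau>. (\<forall>i\<le>m. \<tau> i \<in> {0..T}) \<and> (\<forall>i<m. \<tau> i \<le> \<tau> (Suc i)) \<longrightarrow>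
        (\<Sum>i<m. SUP \<xi>. ennreal (norm (v (\<tau> (Suc i)) \<xi> - v (\<tau> i) \<xi>))) \<le> ennreal C)"

text \<open>A vector field of bounded variation in \<open>t\<close> may jump, so solutions are taken in the sense of
  Caratheodory; for continuous \<open>v\<close> these are the classical ones.\<close>

definition ode_solution ::
  "real \<Rightarrow> (real \<Rightarrow> ('d::finite) vfield) \<Rightarrow> real^'d \<Rightarrow> (real \<Rightarrow> real^'d) \<Rightarrow> bool" where
  "ode_solution T v \<xi> z \<longleftrightarrow>
     (\<lambda>r. v r (z r)) absolutely_integrable_on {0..T} \<and>
     (\<forall>t\<in>{0..T}. z t = \<xi> + integral {0..t} (\<lambda>r. v r (z r)))"

definition ode_flow_map ::
  "real \<Rightarrow> (real \<Rightarrow> ('d::finite) vfield) \<Rightarrow> (real \<Rightarrow> 'd vfield) \<Rightarrow> bool" where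
  "ode_flow_map T v Y \<longleftrightarrow>
     (\<forall>t\<in>{0..T}. continuous_on UNIV (Y t)) \<and>
     (\<forall>\<xi>. ode_solution T v \<xi> (\<lambda>t. Y t \<xi>) \<and>
          (\<forall>z. ode_solution T v \<xi> z \<longrightarrow> (\<forall>t\<in>{0..T}. z t = Y t \<xi>)))"

definition holder_norm :: "real \<Rightarrow> real \<Rightarrow> (real \<Rightarrow> ('d::finite) vfield) \<Rightarrow> ennreal" where
  "holder_norm \<beta> T f =
     (SUP t\<in>{0..T}. SUP \<xi>. ennreal (norm (f t \<xi>))) +
     (SUP (s, t)\<in>{(s, t). 0 \<le> s \<and> s < t \<and> t \<le> T}.
        SUP \<xi>. ennreal (norm (f t \<xi> - f s \<xi>) / (t - s) powr \<beta>))"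

end

theory Submission
  imports Defs "HOL-Probability.Probability"
begin

text \<open>
  The vector fields of the approximating equations only have to be of bounded variation in time, so
  they are taken constant on the cells of a grid of mesh \<open>h\<close>: on the cell from \<open>s\<close> to \<open>t = s + h\<close> the
  field is \<open>driver_field x x2 s t\<close> divided by \<open>h\<close>. Its flow over the cell is the time-one map of
  \<open>driver_field x x2 s t\<close>, so at grid times \<open>y\<^sup>n\<close> is the composition of the time-one maps of the
  preceding cells, and the theorem says that these compositions converge to the flow \<open>\<phi>\<close>, uniformly
  and with Hoelder bounds that do not depend on \<open>n\<close>.

  Write \<open>X\<^sub>s\<^sub>t = x\<^sub>t - x\<^sub>s\<close>, and let \<open>B\<^sub>s\<^sub>t\<close> be the field with components
  \<open>\<Sum>\<mu>. \<partial> x2\<^sup>\<mu>\<^sup>\<nu>(\<xi>,\<zeta>) / \<partial>\<zeta>\<^sup>\<mu>\<close> at \<open>\<zeta> = \<xi>\<close>. The driver field is \<open>X + B - DX[X]/2\<close>, and a Taylor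
  expansion of the differential equation shows that its time-one map differs from the Euler map
  \<open>e\<^sub>s\<^sub>t = id + X\<^sub>s\<^sub>t + B\<^sub>s\<^sub>t\<close> by \<open>O(\<bar>t - s\<bar>\<^sup>3\<^sup>\<alpha>)\<close> (\<open>one_step_estimate\<close>). The point of passing to Euler maps is
  that they are explicit: Chen's relation becomes \<open>B\<^sub>s\<^sub>t = B\<^sub>s\<^sub>u + B\<^sub>u\<^sub>t + DX\<^sub>u\<^sub>t[X\<^sub>s\<^sub>u]\<close>, and the defect
  \<open>e\<^sub>u\<^sub>t \<circ> e\<^sub>s\<^sub>u - e\<^sub>s\<^sub>t\<close> is a Taylor remainder whose supremum and whose Lipschitz constant are both
  \<open>O(\<bar>t - s\<bar>\<^sup>3\<^sup>\<alpha>)\<close> (\<open>defect_bounds\<close>), without differentiating the flow of any equation in its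
  initial value. Because \<open>3 \<alpha> > 1\<close>, such defects can be summed: by \<open>discrete_sewing\<close> the compositions of
  Euler maps along a grid stay within \<open>K \<bar>t - s\<bar>\<^sup>3\<^sup>\<alpha>\<close> of \<open>e\<^sub>s\<^sub>t\<close> and are Lipschitz, with constants that
  do not depend on the mesh. Along the grid both \<open>y\<close> and \<open>y\<^sup>n\<close> are trajectories of the Euler maps up to
  an error \<open>O(h\<^sup>b)\<close> per step with some \<open>b > 1\<close>. Hence they differ by \<open>O(h\<^sup>b\<^sup>-\<^sup>1)\<close>, both are \<open>\<alpha>\<close>-Hoelder in time
  uniformly in \<open>n\<close>, and interpolation gives convergence in every \<open>\<beta>\<close>-Hoelder norm with \<open>\<beta> < \<alpha>\<close>.

  The regularity of \<open>X\<close> and \<open>B\<close> comes from Fourier inversion (\<open>fourier_inversion\<close>): a function \<open>f\<close> in the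
  Sobolev space is the absolutely convergent Fourier integral of its transform \<open>F\<close>. Values, derivatives, difference
  quotients and Taylor remainders of \<open>f\<close> are therefore integrals of \<open>m(\<omega>) F(\<omega>)\<close> for explicit symbols
  \<open>m\<close>. Such an integral is bounded by the Sobolev norm as soon as \<open>m(\<omega>) = O(\<bar>\<omega>\<bar>\<^sup>4)\<close>, because
  \<open>k > d/2 + p + 1 \<ge> d/2 + 4\<close> (\<open>symbol_fun_bound\<close>), so all estimates reduce to elementary inequalities for \<open>cis\<close>.
  For tensors, Bessel's inequality bounds the bilinear form given by a pair of symbols by the
  largest singular value, hence by every Schatten norm (\<open>svd_form_bound\<close>). The
  resulting bounds survive the passage to the completion (\<open>tensor_norm_regular_tensor\<close>).
\<close>

section \<open>Gaussian kernels\<close>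

text \<open>In coordinates, Lebesgue measure is a product measure. This reduces integrals of Gaussians and
  of Bessel weights to dimension one.\<close>
lemma lborel_integral_prod:
  fixes f :: "'a::euclidean_space \<Rightarrow> real \<Rightarrow> 'b::{real_normed_field,banach,second_countable_topology}"
  assumes f: "\<And>b. b \<in> Basis \<Longrightarrow> integrable lborel (f b)"
  shows lborel_integrable_prod: "integrable lborel (\<lambda>x. \<Prod>b\<in>Basis. f b (x \<bullet> b))"
    and "(LINT x|lborel. (\<Prod>b\<in>Basis. f b (x \<bullet> b))) = (\<Prod>b\<in>Basis. LINT t|lborel. f b t)"
proof -
  interpret product_sigma_finite "\<lambda>b::'a. lborel :: real measure"
    by standard
  have [measurable]: "f b \<in> borel_measurable borel" if "b \<in> Basis" for b
    using borel_measurable_integrable[OF f[OF that]] by simp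
  have lb: "(lborel :: 'a measure) = distr (\<Pi>\<^sub>M b\<in>Basis. lborel) borel (\<lambda>f. \<Sum>b\<in>Basis. f b *\<^sub>R b)"
    by (subst lborel_def) (simp add: lborel_eq_real)
  have meas: "(\<lambda>x::'a. \<Prod>b\<in>Basis. f b (x \<bullet> b)) \<in> borel_measurable borel"
    by measurable
  have eq: "(\<lambda>g. \<Prod>b\<in>Basis. f b ((\<Sum>c\<in>Basis. g c *\<^sub>R c) \<bullet> (b::'a))) = (\<lambda>g. \<Prod>b\<in>Basis. f b (g b))"
    by (intro ext prod.cong) auto
  have meas2: "(\<lambda>f. \<Sum>b\<in>Basis. f b *\<^sub>R b) \<in> (\<Pi>\<^sub>M b\<in>Basis. lborel) \<rightarrow>\<^sub>M (borel :: 'a measure)"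
    by measurable
  show "integrable lborel (\<lambda>x::'a. \<Prod>b\<in>Basis. f b (x \<bullet> b))"
    unfolding lb
    by (subst integrable_distr_eq[OF meas2 meas], unfold eq, intro product_integrable_prod f) auto
  show "(LINT x|(lborel::'a measure). (\<Prod>b\<in>Basis. f b (x \<bullet> b))) = (\<Prod>b\<in>Basis. LINT t|lborel. f b t)"
    unfolding lb
    by (subst integral_distr[OF meas2 meas], unfold eq, intro product_integral_prod f) auto
qed

lemma norm_sq_Basis: "(norm (x::'a::euclidean_space))\<^sup>2 = (\<Sum>b\<in>Basis. (x \<bullet> b)\<^sup>2)"
  by (subst power2_norm_eq_inner, subst euclidean_inner) (simp add: power2_eq_square)

lemma cis_sum: "finite A \<Longrightarrow> cis (\<Sum>a\<in>A. f a) = (\<Prod>a\<in>A. cis (f a))"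
  by (induction A rule: finite_induct) (simp_all flip: cis_mult)

text \<open>The known characteristic function of the normal distribution, rescaled. The right-hand
  side is written as a normal density so that the product over the coordinates is again a
  density.\<close>
lemma gaussian_integral_cis:
  fixes u \<sigma> :: real
  assumes "\<sigma> > 0"
  shows "integrable lborel (\<lambda>x. exp (- (\<sigma>\<^sup>2 * x\<^sup>2 / 2)) * cis (u * x))"
    and "(LINT x|lborel. exp (- (\<sigma>\<^sup>2 * x\<^sup>2 / 2)) * cis (u * x)) = 2 * pi * normal_density 0 \<sigma> u"
proof -
  have e: "exp (- (\<sigma>\<^sup>2 * x\<^sup>2 / 2)) = sqrt (2 * pi) * std_normal_density (0 + \<sigma> * x)" for x
    by (simp add: std_normal_density_def power_mult_distrib real_sqrt_mult)
  have int1: "integrable lborel (\<lambda>x. exp (- (\<sigma>\<^sup>2 * x\<^sup>2 / 2)))"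
    unfolding e using assms
    by (intro integrable_mult_right lborel_integrable_real_affine) auto
  show int: "integrable lborel (\<lambda>x. exp (- (\<sigma>\<^sup>2 * x\<^sup>2 / 2)) * cis (u * x))"
    by (rule Bochner_Integration.integrable_bound[OF int1])
       (auto simp: norm_mult cis_conv_exp intro!: borel_measurable_times borel_measurable_continuous_onI continuous_intros)
  let ?h = "\<lambda>x. complex_of_real (sqrt (2 * pi)) * (complex_of_real (std_normal_density x) * cis (u / \<sigma> * x))"
  have "(LINT x|lborel. exp (- (\<sigma>\<^sup>2 * x\<^sup>2 / 2)) * cis (u * x)) = (LINT x|lborel. ?h (0 + \<sigma> * x))"
    using assms by (intro Bochner_Integration.integral_cong refl) (subst e, simp)
  also have "(LINT x|lborel. ?h x) = \<bar>\<sigma>\<bar> *\<^sub>R (LINT x|lborel. ?h (0 + \<sigma> * x))"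
    using assms by (intro lborel_integral_real_affine) auto
  then have "(LINT x|lborel. ?h (0 + \<sigma> * x)) = (1 / \<sigma>) *\<^sub>R (LINT x|lborel. ?h x)"
    using assms by (simp add: field_simps)
  also have "(LINT x|lborel. complex_of_real (std_normal_density x) * cis (u / \<sigma> * x)) = char std_normal_distribution (u / \<sigma>)"
    unfolding char_def
    by (subst integral_density) (auto simp: scaleR_conv_of_real cis_conv_exp normal_density_nonneg)
  then have "(LINT x|lborel. ?h x) = sqrt (2 * pi) * exp (- (u / \<sigma>)\<^sup>2 / 2)"
    by (simp add: char_std_normal_distribution)
  also have "(1 / \<sigma>) *\<^sub>R complex_of_real (sqrt (2 * pi) * exp (- (u / \<sigma>)\<^sup>2 / 2)) = 2 * pi * normal_density 0 \<sigma> u"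
  proof -
    have "2 * pi / (sqrt (2 * pi) * \<sigma>) = sqrt (2 * pi) / \<sigma>"
      using assms by (simp add: field_simps)
    then have "(1 / \<sigma>) * (sqrt (2 * pi) * exp (- (u / \<sigma>)\<^sup>2 / 2)) = 2 * pi * normal_density 0 \<sigma> u"
      using assms by (simp add: normal_density_def real_sqrt_mult power_divide field_simps)
    then show ?thesis
      by (metis of_real_mult of_real_numeral scaleR_conv_of_real)
  qed
  finally show "(LINT x|lborel. exp (- (\<sigma>\<^sup>2 * x\<^sup>2 / 2)) * cis (u * x)) = 2 * pi * normal_density 0 \<sigma> u" .
qed

text \<open>The density of the normal distribution with mean \<open>\<xi>\<close> and covariance
  \<open>\<sigma>\<^sup>2\<close> times the identity. Both points are arguments, so that convolution
  needs no translation of integrals.\<close>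
definition gauss_kernel :: "real \<Rightarrow> 'a::euclidean_space \<Rightarrow> 'a \<Rightarrow> real" where
  "gauss_kernel \<sigma> \<xi> \<eta> = (\<Prod>b\<in>Basis. normal_density (\<xi> \<bullet> b) \<sigma> (\<eta> \<bullet> b))"

lemma gauss_kernel_nonneg: "gauss_kernel \<sigma> \<xi> \<eta> \<ge> 0"
  by (auto simp: gauss_kernel_def intro!: prod_nonneg)

lemma gauss_kernel_integrable: "\<sigma> > 0 \<Longrightarrow> integrable lborel (gauss_kernel \<sigma> \<xi>)"
  and gauss_kernel_integral: "\<sigma> > 0 \<Longrightarrow> (LINT \<eta>|lborel. gauss_kernel \<sigma> \<xi> \<eta>) = 1"
  unfolding gauss_kernel_def
  by (auto intro!: lborel_integrable_prod)
     (subst lborel_integral_prod, auto)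

lemma gauss_kernel_measurable [measurable]: "gauss_kernel \<sigma> \<xi> \<in> borel_measurable borel"
  unfolding gauss_kernel_def by measurable

lemma gauss_kernel_eq:
  "gauss_kernel \<sigma> \<xi> \<eta> = (1 / sqrt (2 * pi * \<sigma>\<^sup>2)) ^ DIM('a) * exp (- ((norm (\<eta> - \<xi>))\<^sup>2 / (2 * \<sigma>\<^sup>2)))"
  for \<xi> :: "'a::euclidean_space"
  unfolding gauss_kernel_def normal_density_def norm_sq_Basis
  by (simp add: prod_dividef exp_sum[symmetric] sum_negf sum_divide_distrib inner_diff_left power_divide)

lemma gaussian_fourier:
  fixes u :: "'a::euclidean_space"
  assumes "\<sigma> > 0"
  shows "integrable lborel (\<lambda>\<omega>. exp (- (\<sigma>\<^sup>2 * (norm \<omega>)\<^sup>2 / 2)) * cis (\<omega> \<bullet> (\<xi> - \<eta>)))"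
    and "(LINT \<omega>|lborel. exp (- (\<sigma>\<^sup>2 * (norm \<omega>)\<^sup>2 / 2)) * cis (\<omega> \<bullet> (\<xi> - \<eta>)))
       = (2 * pi) ^ DIM('a) * gauss_kernel \<sigma> \<xi> (\<eta>::'a)"
proof -
  let ?f = "\<lambda>b x. complex_of_real (exp (- (\<sigma>\<^sup>2 * x\<^sup>2 / 2))) * cis ((\<xi> \<bullet> b - \<eta> \<bullet> b) * x)"
  have eq: "exp (- (\<sigma>\<^sup>2 * (norm \<omega>)\<^sup>2 / 2)) * cis (\<omega> \<bullet> (\<xi> - \<eta>)) = (\<Prod>b\<in>Basis. ?f b (\<omega> \<bullet> b))" for \<omega> :: 'a
  proof -
    have 1: "exp (- (\<sigma>\<^sup>2 * (norm \<omega>)\<^sup>2 / 2)) = (\<Prod>b\<in>Basis. exp (- (\<sigma>\<^sup>2 * (\<omega> \<bullet> b)\<^sup>2 / 2)))"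
      unfolding norm_sq_Basis by (simp flip: exp_sum add: sum_negf sum_divide_distrib sum_distrib_left)
    have 2: "cis (\<omega> \<bullet> (\<xi> - \<eta>)) = (\<Prod>b\<in>Basis. cis ((\<xi> \<bullet> b - \<eta> \<bullet> b) * (\<omega> \<bullet> b)))"
      by (subst cis_sum[symmetric], simp, subst euclidean_inner) (simp add: inner_diff_left mult.commute)
    show ?thesis unfolding 1 2 by (simp add: prod.distrib)
  qed
  have nd: "normal_density 0 \<sigma> (\<xi> \<bullet> b - \<eta> \<bullet> b) = normal_density (\<xi> \<bullet> b) \<sigma> (\<eta> \<bullet> b)" for b
    by (simp add: normal_density_def power2_commute)
  show "integrable lborel (\<lambda>\<omega>. exp (- (\<sigma>\<^sup>2 * (norm \<omega>)\<^sup>2 / 2)) * cis (\<omega> \<bullet> (\<xi> - \<eta>)))"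
    unfolding eq by (intro lborel_integrable_prod gaussian_integral_cis assms)
  show "(LINT \<omega>|lborel. exp (- (\<sigma>\<^sup>2 * (norm \<omega>)\<^sup>2 / 2)) * cis (\<omega> \<bullet> (\<xi> - \<eta>)))
       = (2 * pi) ^ DIM('a) * gauss_kernel \<sigma> \<xi> \<eta>"
    unfolding eq
    by (subst lborel_integral_prod, intro gaussian_integral_cis assms)
       (simp add: gaussian_integral_cis[OF assms] gauss_kernel_def nd prod.distrib)
qed

text \<open>Half of the exponent is used for a factor that does not depend on \<open>\<eta>\<close>
  and becomes small with \<open>\<sigma>\<close>; the other half dominates a fixed Gaussian, which
  keeps integrability in \<open>\<eta>\<close>.\<close>
lemma gauss_kernel_tail:
  fixes \<xi> :: "'a::euclidean_space"
  assumes "0 < \<sigma>" "\<sigma> \<le> 1" "\<delta> \<le> norm (\<eta> - \<xi>)" "0 < \<delta>"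
  shows "gauss_kernel \<sigma> \<xi> \<eta> \<le> (1 / \<sigma>) ^ DIM('a) * exp (- (\<delta>\<^sup>2 / (4 * \<sigma>\<^sup>2))) * exp (- ((norm (\<eta> - \<xi>))\<^sup>2 / 4))"
proof -
  let ?r = "norm (\<eta> - \<xi>)"
  have 0: "\<sigma> * 1 \<le> sqrt (2 * pi) * \<sigma>"
    using assms pi_gt3 by simp
  have 1: "1 / sqrt (2 * pi * \<sigma>\<^sup>2) \<le> 1 / \<sigma>"
    using assms 0 by (simp add: real_sqrt_mult frac_le)
  have s: "\<sigma>\<^sup>2 \<le> 1" using assms by (simp add: power_le_one)
  have d: "\<delta>\<^sup>2 \<le> ?r\<^sup>2" using assms by (intro power_mono) auto
  have "\<delta>\<^sup>2 / (4 * \<sigma>\<^sup>2) + ?r\<^sup>2 / 4 \<le> ?r\<^sup>2 / (4 * \<sigma>\<^sup>2) + ?r\<^sup>2 / (4 * \<sigma>\<^sup>2)"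
    using assms s d by (intro add_mono divide_right_mono divide_left_mono) auto
  also have "\<dots> = ?r\<^sup>2 / (2 * \<sigma>\<^sup>2)" by (simp add: field_simps)
  finally have 2: "exp (- (?r\<^sup>2 / (2 * \<sigma>\<^sup>2))) \<le> exp (- (\<delta>\<^sup>2 / (4 * \<sigma>\<^sup>2))) * exp (- (?r\<^sup>2 / 4))"
    unfolding exp_add[symmetric] by simp
  show ?thesis
    unfolding gauss_kernel_eq mult.assoc[of _ _ "exp (- ((norm (\<eta> - \<xi>))\<^sup>2 / 4))"]
    using 1 2 assms by (intro mult_mono power_mono) auto
qed

lemma tail_factor_tendsto_0:
  assumes "0 < \<delta>"
  shows "(\<lambda>n. (1 / (1 / real (Suc n))) ^ d * exp (- (\<delta>\<^sup>2 / (4 * (1 / real (Suc n))\<^sup>2)))) \<longlonglongrightarrow> 0"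
proof -
  define c where "c = \<delta>\<^sup>2 / 4"
  have c: "c > 0" using assms by (simp add: c_def)
  have lim: "(\<lambda>n. (c * real (Suc n)) ^ d / exp (c * real (Suc n))) \<longlonglongrightarrow> 0"
    by (rule filterlim_compose[OF tendsto_power_div_exp_0])
       (use c in \<open>intro filterlim_tendsto_pos_mult_at_top[OF tendsto_const] filterlim_compose[OF filterlim_real_sequentially filterlim_Suc]\<close>)
  have lim': "(\<lambda>n. (1 / c ^ d) * ((c * real (Suc n)) ^ d / exp (c * real (Suc n)))) \<longlonglongrightarrow> 0"
    using tendsto_mult_right_zero[OF lim] .
  show ?thesis
  proof (rule Lim_null_comparison[OF _ lim'], rule always_eventually, rule allI)
    fix n
    have "real (Suc n) \<le> real (Suc n) ^ 2"
      by (rule self_le_power) auto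
    then have "exp (- (c * (real (Suc n))\<^sup>2)) \<le> exp (- (c * real (Suc n)))"
      using c by simp
    then have "real (Suc n) ^ d * exp (- (c * (real (Suc n))\<^sup>2)) \<le> real (Suc n) ^ d * exp (- (c * real (Suc n)))"
      by (intro mult_left_mono) auto
    moreover have "\<delta>\<^sup>2 / (4 * (1 / real (Suc n))\<^sup>2) = c * (real (Suc n))\<^sup>2"
      by (simp add: c_def power_divide)
    moreover have "(1 / c ^ d) * ((c * real (Suc n)) ^ d / exp (c * real (Suc n))) = real (Suc n) ^ d * exp (- (c * real (Suc n)))"
      unfolding power_mult_distrib exp_minus using c by (simp add: divide_simps)
    ultimately show "norm ((1 / (1 / real (Suc n))) ^ d * exp (- (\<delta>\<^sup>2 / (4 * (1 / real (Suc n))\<^sup>2))))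
      \<le> (1 / c ^ d) * ((c * real (Suc n)) ^ d / exp (c * real (Suc n)))"
      by (simp add: abs_mult)
  qed
qed

lemma gaussian_integrable:
  fixes \<xi> :: "'a::euclidean_space"
  shows "integrable lborel (\<lambda>\<eta>. exp (- ((norm (\<eta> - \<xi>))\<^sup>2 / 4)))"
proof -
  have "integrable lborel (\<lambda>\<eta>. (sqrt (2 * pi * (sqrt 2)\<^sup>2)) ^ DIM('a) * gauss_kernel (sqrt 2) \<xi> \<eta>)"
    by (intro integrable_mult_right gauss_kernel_integrable) auto
  then show ?thesis
    unfolding gauss_kernel_eq by (simp add: power_divide)
qed

lemma gauss_kernel_integrable_mult:
  fixes f :: "'a::euclidean_space \<Rightarrow> real"
  assumes "continuous_on UNIV f" and "integrable lborel (\<lambda>\<eta>. (f \<eta>)\<^sup>2)" and "\<sigma> > 0"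
  shows "integrable lborel (\<lambda>\<eta>. f \<eta> * gauss_kernel \<sigma> \<xi> \<eta>)"
proof -
  have [measurable]: "f \<in> borel_measurable borel"
    using assms(1) by (rule borel_measurable_continuous_onI)
  let ?M = "(1 / sqrt (2 * pi * \<sigma>\<^sup>2)) ^ DIM('a)"
  have b: "gauss_kernel \<sigma> \<xi> \<eta> \<le> ?M" for \<eta>
    unfolding gauss_kernel_eq using assms(3) by (intro mult_left_le) auto
  have "integrable lborel (\<lambda>\<eta>. gauss_kernel \<sigma> \<xi> \<eta> + (f \<eta>)\<^sup>2 * ?M)"
    using assms by (intro Bochner_Integration.integrable_add gauss_kernel_integrable integrable_mult_left) auto
  then show ?thesis
  proof (rule Bochner_Integration.integrable_bound, measurable, intro AE_I2)
    fix \<eta>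
    have "\<bar>f \<eta>\<bar> \<le> 1 + (f \<eta>)\<^sup>2"
      using sum_squares_bound[of 1 "\<bar>f \<eta>\<bar>"] by (simp add: power2_eq_square) 
    then have "norm (f \<eta> * gauss_kernel \<sigma> \<xi> \<eta>) \<le> (1 + (f \<eta>)\<^sup>2) * gauss_kernel \<sigma> \<xi> \<eta>"
      by (simp add: abs_mult gauss_kernel_nonneg mult_right_mono)
    also have "\<dots> \<le> gauss_kernel \<sigma> \<xi> \<eta> + (f \<eta>)\<^sup>2 * ?M"
      using mult_left_mono[OF b[of \<eta>], of "(f \<eta>)\<^sup>2"] by (simp add: distrib_right)
    finally show "norm (f \<eta> * gauss_kernel \<sigma> \<xi> \<eta>) \<le> norm (gauss_kernel \<sigma> \<xi> \<eta> + (f \<eta>)\<^sup>2 * ?M)"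
      by (metis abs_ge_self order_trans real_norm_def)
  qed
qed

text \<open>Gaussian means converge to the value at a point of continuity. The function need not be
  bounded or integrable; the part far from \<open>\<xi>\<close> is controlled through
  \<open>\<bar>f\<bar> \<le> 1 + f\<^sup>2\<close>.\<close>
lemma gauss_mollify:
  fixes f :: "'a::euclidean_space \<Rightarrow> real"
  assumes cont: "continuous_on UNIV f" and sq: "integrable lborel (\<lambda>\<eta>. (f \<eta>)\<^sup>2)"
  shows "(\<lambda>n. LINT \<eta>|lborel. f \<eta> * gauss_kernel (1 / real (Suc n)) \<xi> \<eta>) \<longlonglongrightarrow> f \<xi>"
proof -
  have [measurable]: "f \<in> borel_measurable borel"
    using cont by (rule borel_measurable_continuous_onI)
  let ?K = "\<lambda>n. gauss_kernel (1 / real (Suc n)) \<xi>"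
  let ?g = "\<lambda>\<eta>. exp (- ((norm (\<eta> - \<xi>))\<^sup>2 / 4))"
  define h where "h = (\<lambda>\<eta>. (1 + \<bar>f \<xi>\<bar>) * ?g \<eta> + (f \<eta>)\<^sup>2)"
  have hint: "integrable lborel h"
    unfolding h_def by (intro Bochner_Integration.integrable_add integrable_mult_right gaussian_integrable sq)
  show ?thesis
  proof (rule LIMSEQ_I)
    fix e :: real assume e: "e > 0"
    have "isCont f \<xi>" using cont by (simp add: continuous_on_eq_continuous_at)
    then obtain \<delta> where \<delta>: "\<delta> > 0" "\<And>\<eta>. norm (\<eta> - \<xi>) < \<delta> \<Longrightarrow> \<bar>f \<eta> - f \<xi>\<bar> < e / 2"
      using e unfolding continuous_at_eps_delta dist_norm real_norm_def
      by (metis half_gt_zero)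
    \<comment> \<open>\<open>A n\<close> is the small factor in the bound for the kernel outside the ball of radius \<open>\<delta>\<close>.\<close>
    define A where "A = (\<lambda>n. (1 / (1 / real (Suc n))) ^ DIM('a) * exp (- (\<delta>\<^sup>2 / (4 * (1 / real (Suc n))\<^sup>2))))"
    have "(\<lambda>n. A n * (LINT \<eta>|lborel. h \<eta>)) \<longlonglongrightarrow> 0"
      unfolding A_def by (intro tendsto_mult_left_zero tail_factor_tendsto_0 \<delta>)
    from LIMSEQ_D[OF this half_gt_zero[OF e]]
    obtain N where N: "\<And>n. n \<ge> N \<Longrightarrow> norm (A n * (LINT \<eta>|lborel. h \<eta>) - 0) < e / 2" by blast
    have A0: "A n \<ge> 0" for n by (simp add: A_def)
    have "norm ((LINT \<eta>|lborel. f \<eta> * ?K n \<eta>) - f \<xi>) < e" if "n \<ge> N" for n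
    proof -
      have K: "integrable lborel (?K n)" by (intro gauss_kernel_integrable) auto
      have fK: "integrable lborel (\<lambda>\<eta>. f \<eta> * ?K n \<eta>)"
        by (intro gauss_kernel_integrable_mult cont sq) auto
      have "f \<xi> = (LINT \<eta>|lborel. f \<xi> * ?K n \<eta>)"
        by (simp add: gauss_kernel_integral)
      then have "(LINT \<eta>|lborel. f \<eta> * ?K n \<eta>) - f \<xi> = (LINT \<eta>|lborel. f \<eta> * ?K n \<eta>) - (LINT \<eta>|lborel. f \<xi> * ?K n \<eta>)"
        by linarith
      also have "\<dots> = (LINT \<eta>|lborel. f \<eta> * ?K n \<eta> - f \<xi> * ?K n \<eta>)"
        using K fK by (intro Bochner_Integration.integral_diff[symmetric]) auto
      finally have "norm ((LINT \<eta>|lborel. f \<eta> * ?K n \<eta>) - f \<xi>) = norm (LINT \<eta>|lborel. f \<eta> * ?K n \<eta> - f \<xi> * ?K n \<eta>)"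
        by simp
      also have "\<dots> \<le> (LINT \<eta>|lborel. e / 2 * ?K n \<eta> + A n * h \<eta>)"
      proof (rule Bochner_Integration.integral_norm_bound_integral)
        fix \<eta>
        have k0: "?K n \<eta> \<ge> 0" by (rule gauss_kernel_nonneg)
        have h0: "h \<eta> \<ge> 0" unfolding h_def by auto
        show "norm (f \<eta> * ?K n \<eta> - f \<xi> * ?K n \<eta>) \<le> e / 2 * ?K n \<eta> + A n * h \<eta>"
        proof (cases "norm (\<eta> - \<xi>) < \<delta>")
          case True
          have "norm (f \<eta> * ?K n \<eta> - f \<xi> * ?K n \<eta>) = \<bar>f \<eta> - f \<xi>\<bar> * ?K n \<eta>"
            using k0 by (simp add: abs_mult flip: left_diff_distrib)
          also have "\<dots> \<le> e / 2 * ?K n \<eta>"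
            using \<delta>(2)[OF True] k0 by (intro mult_right_mono) auto
          also have "\<dots> \<le> e / 2 * ?K n \<eta> + A n * h \<eta>"
            using A0[of n] h0 by simp
          finally show ?thesis .
        next
          case False
          have kt: "?K n \<eta> \<le> A n * ?g \<eta>"
            unfolding A_def using False \<delta>(1) by (intro gauss_kernel_tail) auto
          have g1: "?g \<eta> \<le> 1" by simp
          have a: "\<bar>f \<eta>\<bar> \<le> 1 + (f \<eta>)\<^sup>2"
            using sum_squares_bound[of 1 "\<bar>f \<eta>\<bar>"] by (simp add: power2_eq_square)
          have "norm (f \<eta> * ?K n \<eta> - f \<xi> * ?K n \<eta>) = \<bar>f \<eta> - f \<xi>\<bar> * ?K n \<eta>"
            using k0 by (simp add: abs_mult flip: left_diff_distrib)
          also have "\<dots> \<le> (1 + \<bar>f \<xi>\<bar> + (f \<eta>)\<^sup>2) * ?K n \<eta>"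
            using a k0 by (intro mult_right_mono) auto
          also have "\<dots> \<le> (1 + \<bar>f \<xi>\<bar> + (f \<eta>)\<^sup>2) * (A n * ?g \<eta>)"
            using kt by (intro mult_left_mono) auto
          also have "\<dots> = A n * ((1 + \<bar>f \<xi>\<bar>) * ?g \<eta> + (f \<eta>)\<^sup>2 * ?g \<eta>)"
            by (simp add: algebra_simps)
          also have "\<dots> \<le> A n * h \<eta>"
            unfolding h_def using A0 g1 by (intro mult_left_mono add_left_mono mult_left_le) auto
          also have "\<dots> \<le> e / 2 * ?K n \<eta> + A n * h \<eta>"
            using e k0 by simp
          finally show ?thesis .
        qed
      qed (use K fK hint in auto)
      also have "\<dots> = e / 2 * (LINT \<eta>|lborel. ?K n \<eta>) + A n * (LINT \<eta>|lborel. h \<eta>)"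
        using K hint by (subst Bochner_Integration.integral_add) auto
      also have "\<dots> = e / 2 + A n * (LINT \<eta>|lborel. h \<eta>)"
        by (simp add: gauss_kernel_integral)
      also have "\<dots> < e" using N[OF that] by simp
      finally show ?thesis .
    qed
    then show "\<exists>N. \<forall>n\<ge>N. norm ((LINT \<eta>|lborel. f \<eta> * ?K n \<eta>) - f \<xi>) < e" by blast
  qed
qed

section \<open>Integrability of Bessel weights\<close>

lemma integral_Cauchy_Schwarz:
  fixes a b :: "'a \<Rightarrow> real"
  assumes [measurable]: "a \<in> borel_measurable M" "b \<in> borel_measurable M"
    and a: "integrable M (\<lambda>x. (a x)\<^sup>2)" and b: "integrable M (\<lambda>x. (b x)\<^sup>2)"
  shows "integrable M (\<lambda>x. a x * b x)"
    and "(LINT x|M. \<bar>a x * b x\<bar>) \<le> sqrt (LINT x|M. (a x)\<^sup>2) * sqrt (LINT x|M. (b x)\<^sup>2)"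
proof -
  show int: "integrable M (\<lambda>x. a x * b x)"
  proof (rule Bochner_Integration.integrable_bound)
    show "integrable M (\<lambda>x. (a x)\<^sup>2 + (b x)\<^sup>2)" using a b by simp
    show "AE x in M. norm (a x * b x) \<le> norm ((a x)\<^sup>2 + (b x)\<^sup>2)"
    proof (intro AE_I2)
      fix x
      have "2 * \<bar>a x\<bar> * \<bar>b x\<bar> \<le> (a x)\<^sup>2 + (b x)\<^sup>2"
        using sum_squares_bound[of "\<bar>a x\<bar>" "\<bar>b x\<bar>"] by simp
      moreover have "0 \<le> \<bar>a x\<bar> * \<bar>b x\<bar>" by simp
      ultimately show "norm (a x * b x) \<le> norm ((a x)\<^sup>2 + (b x)\<^sup>2)"
        unfolding real_norm_def abs_mult by linarith
    qed
  qed measurable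
  let ?I = "LINT x|M. \<bar>a x * b x\<bar>" and ?A = "LINT x|M. (a x)\<^sup>2" and ?B = "LINT x|M. (b x)\<^sup>2"
  have "(\<integral>\<^sup>+x. ennreal \<bar>a x\<bar> * ennreal \<bar>b x\<bar> \<partial>M)\<^sup>2 \<le> (\<integral>\<^sup>+x. ennreal \<bar>a x\<bar> ^ 2 \<partial>M) * (\<integral>\<^sup>+x. ennreal \<bar>b x\<bar> ^ 2 \<partial>M)"
    by (rule Cauchy_Schwarz_nn_integral) measurable
  moreover have "(\<integral>\<^sup>+x. ennreal \<bar>a x\<bar> * ennreal \<bar>b x\<bar> \<partial>M) = ennreal ?I"
    using integrable_abs[OF int] by (subst nn_integral_eq_integral[symmetric]) (auto simp: abs_mult ennreal_mult)
  moreover have "(\<integral>\<^sup>+x. ennreal \<bar>a x\<bar> ^ 2 \<partial>M) = ennreal ?A"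
    using a by (subst nn_integral_eq_integral[symmetric]) (auto simp: ennreal_power)
  moreover have "(\<integral>\<^sup>+x. ennreal \<bar>b x\<bar> ^ 2 \<partial>M) = ennreal ?B"
    using b by (subst nn_integral_eq_integral[symmetric]) (auto simp: ennreal_power)
  ultimately have "ennreal (?I\<^sup>2) \<le> ennreal (?A * ?B)"
    by (simp add: ennreal_power ennreal_mult)
  then have "?I\<^sup>2 \<le> ?A * ?B"
    by (subst (asm) ennreal_le_iff) auto
  then show "?I \<le> sqrt ?A * sqrt ?B"
    by (metis real_le_rsqrt real_sqrt_mult)
qed

text \<open>Outside \<open>[-1, 1]\<close> the integrand is dominated by
  \<open>\<bar>x\<bar>\<close> to the power \<open>-2 s\<close>.\<close>
lemma integrable_one_plus_sq_powr:
  fixes s :: real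
  assumes "s > 1/2"
  shows "integrable lborel (\<lambda>x. (1 + x\<^sup>2) powr (-s))"
proof -
  let ?h = "\<lambda>x::real. x powr (-2 * s) * indicator {1..} x"
  define F where "F = (\<lambda>x. - (x powr (1 - 2 * s)) / (2 * s - 1))"
  have lim: "((\<lambda>x. F x) \<longlongrightarrow> 0) at_top"
  proof -
    have "((\<lambda>x::real. x powr (1 - 2 * s)) \<longlongrightarrow> 0) at_top"
      using assms by (intro tendsto_neg_powr filterlim_ident) auto
    then have "((\<lambda>x::real. - (x powr (1 - 2 * s)) / (2 * s - 1)) \<longlongrightarrow> - 0 / (2 * s - 1)) at_top"
      using assms by (intro tendsto_intros) auto
    then show ?thesis by (simp add: F_def)
  qed
  have "(\<integral>\<^sup>+x. ennreal (x powr (-2 * s)) * indicator {1..} x \<partial>lborel) = ennreal (0 - F 1)"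
  proof (rule nn_integral_FTC_atLeast[OF _ _ _ lim])
    fix x :: real assume x: "1 \<le> x"
    have "((\<lambda>x. x powr (1 - 2 * s)) has_real_derivative (1 - 2 * s) * x powr (1 - 2 * s - 1)) (at x)"
      using x by (intro has_real_derivative_powr) auto
    from DERIV_cdivide[OF DERIV_minus[OF this], of "2 * s-1"]
    have "(F has_real_derivative (- ((1 - 2 * s) * x powr (1 - 2 * s - 1)) / (2 * s - 1))) (at x)"
      unfolding F_def .
    moreover have "- ((1 - 2 * s) * x powr (1 - 2 * s - 1)) / (2 * s - 1) = x powr (-2 * s)"
      using assms by (simp add: field_simps)
    ultimately show "(F has_real_derivative (x powr (-2 * s))) (at x)" by simp
  qed auto
  then have "(\<integral>\<^sup>+x. ennreal (?h x) \<partial>lborel) < \<infinity>"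
    by (simp add: ennreal_mult'' ennreal_indicator)
  then have h: "integrable lborel ?h"
    by (intro integrableI_nonneg) auto
  then have h': "integrable lborel (\<lambda>x. ?h (0 + (-1) * x))"
    by (rule lborel_integrable_real_affine) auto
  have "integrable lborel (\<lambda>x. indicator {-1..1} x + (?h x + ?h (0 + (-1) * x)))"
    using h h' by (intro Bochner_Integration.integrable_add) auto
  then show ?thesis
  proof (rule Bochner_Integration.integrable_bound, measurable, intro AE_I2)
    fix x :: real
    have key: "(1 + y\<^sup>2) powr (-s) \<le> y powr (-2 * s)" if "y \<ge> 1" for y :: real
    proof -
      have "(1 + y\<^sup>2) powr (-s) \<le> (y\<^sup>2) powr (-s)"
        using that assms by (intro powr_mono2') auto
      also have "(y\<^sup>2) powr (-s) = (y powr 2) powr (-s)" using that by simp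
      also have "\<dots> = y powr (-2 * s)" by (subst powr_powr) simp
      finally show ?thesis .
    qed
    have one: "(1 + x\<^sup>2) powr (-s) \<le> 1"
      using assms powr_mono2'[of "-s" 1 "1 + x\<^sup>2"] by auto
    consider "x \<ge> 1" | "x \<le> -1" | "-1 < x" "x < 1" by linarith
    then show "norm ((1 + x\<^sup>2) powr (-s)) \<le> norm (indicator {-1..1} x + (?h x + ?h (0 + (-1) * x)))"
    proof cases
      case 1 then show ?thesis using key[of x] by (auto simp: indicator_def)
    next
      case 2 then show ?thesis using key[of "-x"] by (auto simp: indicator_def)
    next
      case 3 then show ?thesis using one by (auto simp: indicator_def)
    qed
  qed
qed

text \<open>Since \<open>1 + \<bar>\<omega>\<bar>\<^sup>2\<close> dominates each \<open>1 +
  \<omega>\<^sub>b\<^sup>2\<close>, it dominates their geometric mean, and the weight is at most a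
  product of one-dimensional weights with exponent \<open>r / d > 1/2\<close>.\<close>
lemma integrable_bessel_weight:
  fixes r :: real
  assumes "r > real DIM('a::euclidean_space) / 2"
  shows "integrable lborel (\<lambda>\<omega>::'a. (1 + (norm \<omega>)\<^sup>2) powr (-r))"
proof -
  let ?s = "r / real DIM('a)"
  have s: "?s > 1/2" using assms DIM_positive[where 'a='a] by (simp add: field_simps)
  have "integrable lborel (\<lambda>\<omega>::'a. \<Prod>b\<in>Basis. (1 + (\<omega> \<bullet> b)\<^sup>2) powr (- ?s))"
    by (rule lborel_integrable_prod[where f = "\<lambda>b x. (1 + x\<^sup>2) powr (- ?s)"]) (rule integrable_one_plus_sq_powr[OF s])
  then show ?thesis
  proof (rule Bochner_Integration.integrable_bound, measurable, intro AE_I2)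
    fix \<omega> :: 'a
    have "(1 + (norm \<omega>)\<^sup>2) powr (-r) = ((1 + (norm \<omega>)\<^sup>2) powr (- ?s)) ^ DIM('a)"
      by (subst powr_power) (auto simp: add_nonneg_eq_0_iff)
    also have "\<dots> = (\<Prod>b\<in>(Basis::'a set). (1 + (norm \<omega>)\<^sup>2) powr (- ?s))"
      by simp
    also have "\<dots> \<le> (\<Prod>b\<in>Basis. (1 + (\<omega> \<bullet> b)\<^sup>2) powr (- ?s))"
    proof (intro prod_mono conjI)
      fix b :: 'a assume b: "b \<in> Basis"
      have "(\<omega> \<bullet> b)\<^sup>2 \<le> (norm \<omega>)\<^sup>2"
        using Basis_le_norm[OF b, of \<omega>] by (metis abs_ge_zero power2_abs power_mono)
      then show "(1 + (norm \<omega>)\<^sup>2) powr (- ?s) \<le> (1 + (\<omega> \<bullet> b)\<^sup>2) powr (- ?s)"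
        using s by (intro powr_mono2') (auto intro: add_pos_nonneg)
    qed auto
    finally show "norm ((1 + (norm \<omega>)\<^sup>2) powr (-r)) \<le> norm (\<Prod>b\<in>Basis. (1 + (\<omega> \<bullet> b)\<^sup>2) powr (- ?s))"
      by simp
  qed
qed

section \<open>Fourier inversion\<close>

lemma truncated_fourier_integrable:
  fixes f :: "('d::finite) vfield"
  assumes "continuous_on UNIV f"
  shows "set_integrable lborel (cball 0 R) (\<lambda>\<xi>. cis (- (\<omega> \<bullet> \<xi>)) * complex_of_real (f \<xi> $ j))"
    and "set_integrable lborel (cball 0 R) (\<lambda>\<xi>. f \<xi> $ j)"
proof -
  show "set_integrable lborel (cball 0 R) (\<lambda>\<xi>. cis (- (\<omega> \<bullet> \<xi>)) * complex_of_real (f \<xi> $ j))"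
    unfolding set_integrable_def using assms unfolding cis_conv_exp
    by (intro borel_integrable_compact continuous_intros) (auto intro: continuous_on_subset)
  show "set_integrable lborel (cball 0 R) (\<lambda>\<xi>. f \<xi> $ j)"
    unfolding set_integrable_def using assms
    by (intro borel_integrable_compact continuous_intros) (auto intro: continuous_on_subset)
qed

lemma vec_nth_measurable [measurable (raw)]:
  fixes F :: "'a \<Rightarrow> ('b::real_normed_vector)^'d::finite"
  assumes "F \<in> borel_measurable M"
  shows "(\<lambda>\<omega>. F \<omega> $ j) \<in> borel_measurable M"
  using measurable_compose[OF assms borel_measurable_continuous_onI[of "\<lambda>x. x $ j"]]
  by (simp add: continuous_on_component)

lemma truncated_fourier_measurable [measurable]:
  fixes f :: "('d::finite) vfield"
  assumes "continuous_on UNIV f"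
  shows "truncated_fourier R f \<in> borel_measurable borel"
    and "(\<lambda>\<omega>. truncated_fourier R f \<omega> $ j) \<in> borel_measurable borel"
proof -
  have [measurable]: "f \<in> borel_measurable borel" "cball (0::real^'d) R \<in> sets borel"
    using assms by (auto intro: borel_measurable_continuous_onI)
  have "(\<lambda>\<omega>. LINT \<xi>|lborel. indicator (cball 0 R) \<xi> *\<^sub>R (exp (\<i> * complex_of_real (- (\<omega> \<bullet> \<xi>))) * complex_of_real (f \<xi> $ j)))
      \<in> borel_measurable borel" for j
    by measurable
  then have *: "(\<lambda>\<omega>. truncated_fourier R f \<omega> $ j) \<in> borel_measurable borel" for j
    unfolding truncated_fourier_def set_lebesgue_integral_def cis_conv_exp vec_lambda_beta
    by (intro borel_measurable_times) auto
  show "(\<lambda>\<omega>. truncated_fourier R f \<omega> $ j) \<in> borel_measurable borel" by fact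
  have "(\<lambda>\<omega>. truncated_fourier R f \<omega> \<bullet> b) \<in> borel_measurable borel" if "b \<in> Basis" for b
  proof -
    obtain i u where "b = axis i u" using \<open>b \<in> Basis\<close> by (auto simp: Basis_vec_def)
    then show ?thesis by (simp add: inner_axis borel_measurable_inner *)
  qed
  then show "truncated_fourier R f \<in> borel_measurable borel"
    by (subst borel_measurable_euclidean_space) auto
qed

lemma fourier_const: "((2 * pi) powr (- (real d / 2)))\<^sup>2 * (2 * pi) ^ d = 1"
proof -
  have "((2 * pi) powr (- (real d / 2)))\<^sup>2 = (2 * pi) powr (- real d)"
    by (subst powr_power) auto
  moreover have "(2 * pi) powr (- real d) * (2 * pi) ^ d = 1"
    by (subst powr_realpow[symmetric]) (auto simp: powr_add[symmetric] simp del: power_mult_distrib)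
  ultimately show ?thesis by simp
qed

text \<open>Fubini moves the transform from the truncated function to the Gaussian, where it is
  explicit. All functions are integrable here because the truncation has compact support.\<close>
lemma truncated_fourier_gaussian:
  fixes f :: "('d::finite) vfield"
  assumes f: "continuous_on UNIV f" and \<sigma>: "\<sigma> > 0"
  shows "integrable lborel (\<lambda>\<omega>. exp (- (\<sigma>\<^sup>2 * (norm \<omega>)\<^sup>2 / 2)) * cis (\<omega> \<bullet> \<xi>) * truncated_fourier R f \<omega> $ j)" (is ?int)
    and "complex_of_real ((2 * pi) powr (- (real CARD('d) / 2))) *
         (LINT \<omega>|lborel. exp (- (\<sigma>\<^sup>2 * (norm \<omega>)\<^sup>2 / 2)) * cis (\<omega> \<bullet> \<xi>) * truncated_fourier R f \<omega> $ j)
       = complex_of_real (LINT \<eta>:cball 0 R|lborel. f \<eta> $ j * gauss_kernel \<sigma> \<xi> \<eta>)" (is ?eq)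
proof -
  let ?g = "\<lambda>\<omega>::real^'d. exp (- (\<sigma>\<^sup>2 * (norm \<omega>)\<^sup>2 / 2))"
  let ?c = "complex_of_real ((2 * pi) powr (- (real CARD('d) / 2)))"
  define fR where "fR = (\<lambda>\<eta>. indicator (cball 0 R) \<eta> * f \<eta> $ j)"
  have [measurable]: "f \<in> borel_measurable borel" "cball (0::real^'d) R \<in> sets borel"
    using f by (auto intro: borel_measurable_continuous_onI)
  have [measurable]: "fR \<in> borel_measurable borel" unfolding fR_def by measurable
  have fR: "integrable lborel fR"
    using truncated_fourier_integrable(2)[OF f] by (simp add: fR_def set_integrable_def)
  have g: "integrable lborel ?g"
    using integrable_norm[OF gaussian_fourier(1)[OF \<sigma>, of 0 0]] by simp
  define H where "H = (\<lambda>(\<eta>::real^'d) (\<omega>::real^'d). complex_of_real (fR \<eta> * ?g \<omega>) * (exp (\<i> * complex_of_real (\<omega> \<bullet> \<xi>)) * exp (\<i> * complex_of_real (- (\<omega> \<bullet> \<eta>)))))"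
  have H_norm: "norm (H \<eta> \<omega>) = \<bar>fR \<eta>\<bar> * ?g \<omega>" for \<eta> \<omega>
    by (simp add: H_def norm_mult abs_mult)
  have H_meas: "case_prod H \<in> borel_measurable (lborel \<Otimes>\<^sub>M lborel)"
    unfolding H_def by measurable
  have H_int: "integrable (lborel \<Otimes>\<^sub>M lborel) (case_prod H)"
  proof (rule lborel_pair.Fubini_integrable[OF H_meas])
    show "integrable lborel (\<lambda>\<eta>. LINT \<omega>|lborel. norm (case_prod H (\<eta>, \<omega>)))"
      using fR by (simp add: H_norm)
    show "AE \<eta> in lborel. integrable lborel (\<lambda>\<omega>. case_prod H (\<eta>, \<omega>))"
    proof (rule AE_I2)
      fix \<eta>
      have "integrable lborel (\<lambda>\<omega>. norm (H \<eta> \<omega>))"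
        unfolding H_norm using g by simp
      then show "integrable lborel (\<lambda>\<omega>. case_prod H (\<eta>, \<omega>))"
        by (rule Bochner_Integration.integrable_bound) (auto simp: H_def)
    qed
  qed
  have tf: "?c * (LINT \<eta>|lborel. H \<eta> \<omega>) = ?g \<omega> * cis (\<omega> \<bullet> \<xi>) * truncated_fourier R f \<omega> $ j" for \<omega>
  proof -
    have "(LINT \<eta>|lborel. H \<eta> \<omega>) = (LINT \<eta>|lborel. (?g \<omega> * cis (\<omega> \<bullet> \<xi>)) * (indicator (cball 0 R) \<eta> *\<^sub>R (cis (- (\<omega> \<bullet> \<eta>)) * complex_of_real (f \<eta> $ j))))"
      by (intro Bochner_Integration.integral_cong) (auto simp: H_def fR_def cis_conv_exp indicator_def)
    also have "\<dots> = (?g \<omega> * cis (\<omega> \<bullet> \<xi>)) * (LINT \<eta>:cball 0 R|lborel. cis (- (\<omega> \<bullet> \<eta>)) * complex_of_real (f \<eta> $ j))"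
      unfolding set_lebesgue_integral_def by (rule integral_mult_right_zero)
    finally show ?thesis unfolding truncated_fourier_def by simp
  qed
  have "integrable lborel (\<lambda>\<omega>. ?c * (LINT \<eta>|lborel. H \<eta> \<omega>))"
    using lborel_pair.integrable_snd[OF H_int] by (intro integrable_mult_right) simp
  then show ?int unfolding tf .
  have "?c * (LINT \<omega>|lborel. ?g \<omega> * cis (\<omega> \<bullet> \<xi>) * truncated_fourier R f \<omega> $ j) = ?c * (?c * (LINT \<omega>|lborel. LINT \<eta>|lborel. H \<eta> \<omega>))"
    unfolding tf[symmetric] by (simp only: integral_mult_right_zero)
  also have "(LINT \<omega>|lborel. LINT \<eta>|lborel. H \<eta> \<omega>) = (LINT \<eta>|lborel. LINT \<omega>|lborel. H \<eta> \<omega>)"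
    by (rule lborel_pair.Fubini_integral[OF H_int])
  also have "\<dots> = (LINT \<eta>|lborel. complex_of_real ((2 * pi) ^ CARD('d) * (fR \<eta> * gauss_kernel \<sigma> \<xi> \<eta>)))"
  proof (intro Bochner_Integration.integral_cong refl)
    fix \<eta> :: "real^'d"
    have "H \<eta> \<omega> = complex_of_real (fR \<eta>) * (?g \<omega> * cis (\<omega> \<bullet> (\<xi> - \<eta>)))" for \<omega>
      by (simp add: H_def cis_conv_exp inner_diff_right mult_exp_exp algebra_simps)
    then have "(LINT \<omega>|lborel. H \<eta> \<omega>) = complex_of_real (fR \<eta>) * (LINT \<omega>|lborel. ?g \<omega> * cis (\<omega> \<bullet> (\<xi> - \<eta>)))"
      by (simp only: integral_mult_right_zero)
    then show "(LINT \<omega>|lborel. H \<eta> \<omega>) = complex_of_real ((2 * pi) ^ CARD('d) * (fR \<eta> * gauss_kernel \<sigma> \<xi> \<eta>))"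
      by (simp add: gaussian_fourier(2)[OF \<sigma>])
  qed
  also have "\<dots> = complex_of_real ((2 * pi) ^ CARD('d) * (LINT \<eta>|lborel. fR \<eta> * gauss_kernel \<sigma> \<xi> \<eta>))"
    by (simp only: integral_complex_of_real integral_mult_right_zero)
  also have "(LINT \<eta>|lborel. fR \<eta> * gauss_kernel \<sigma> \<xi> \<eta>) = (LINT \<eta>:cball 0 R|lborel. f \<eta> $ j * gauss_kernel \<sigma> \<xi> \<eta>)"
    unfolding set_lebesgue_integral_def fR_def by (simp add: mult.assoc)
  also have "?c * (?c * complex_of_real ((2 * pi) ^ CARD('d) * (LINT \<eta>:cball 0 R|lborel. f \<eta> $ j * gauss_kernel \<sigma> \<xi> \<eta>)))
    = complex_of_real (((2 * pi) powr (- (real CARD('d) / 2)))\<^sup>2 * (2 * pi) ^ CARD('d) * (LINT \<eta>:cball 0 R|lborel. f \<eta> $ j * gauss_kernel \<sigma> \<xi> \<eta>))"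
    by (simp add: power2_eq_square)
  also have "\<dots> = complex_of_real (LINT \<eta>:cball 0 R|lborel. f \<eta> $ j * gauss_kernel \<sigma> \<xi> \<eta>)"
    unfolding fourier_const by simp
  finally show ?eq .
qed

text \<open>The Plancherel transform is only known as a limit in \<open>L\<^sup>2\<close>; the
  Gaussian is square integrable, so Cauchy-Schwarz turns this into convergence of the
  pairings.\<close>
lemma fourier_pairing_tendsto:
  fixes f :: "('d::finite) vfield"
  assumes f: "continuous_on UNIV f" and F: "has_fourier f F"
    and Fj: "integrable lborel (\<lambda>\<omega>. F \<omega> $ j)" and \<sigma>: "\<sigma> > 0"
  shows "(\<lambda>n. LINT \<omega>|lborel. exp (- (\<sigma>\<^sup>2 * (norm \<omega>)\<^sup>2 / 2)) * cis (\<omega> \<bullet> \<xi>) * truncated_fourier (real n) f \<omega> $ j)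
     \<longlonglongrightarrow> (LINT \<omega>|lborel. exp (- (\<sigma>\<^sup>2 * (norm \<omega>)\<^sup>2 / 2)) * cis (\<omega> \<bullet> \<xi>) * F \<omega> $ j)"
proof -
  let ?g = "\<lambda>\<omega>::real^'d. exp (- (\<sigma>\<^sup>2 * (norm \<omega>)\<^sup>2 / 2))"
  let ?t = "\<lambda>n. truncated_fourier (real n) f"
  let ?I = "\<lambda>n. LINT \<omega>|lborel. ?g \<omega> * cis (\<omega> \<bullet> \<xi>) * ?t n \<omega> $ j"
  let ?J = "LINT \<omega>|lborel. ?g \<omega> * cis (\<omega> \<bullet> \<xi>) * F \<omega> $ j"
  have [measurable]: "F \<in> borel_measurable borel" using F by (simp add: has_fourier_def)
  have [measurable]: "?t n \<in> borel_measurable borel" for n using f by (rule truncated_fourier_measurable)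
  define N where "N = (\<lambda>n. \<integral>\<^sup>+\<omega>. ennreal ((norm (F \<omega> - ?t n \<omega>))\<^sup>2) \<partial>lborel)"
  have N: "N \<longlonglongrightarrow> 0"
    unfolding N_def using F filterlim_compose[OF _ filterlim_real_sequentially] unfolding has_fourier_def by blast
  have g: "integrable lborel ?g"
    using integrable_norm[OF gaussian_fourier(1)[OF \<sigma>, of 0 0]] by simp
  define C where "C = (\<integral>\<^sup>+\<omega>. (ennreal (?g \<omega>))\<^sup>2 \<partial>lborel)"
  have "C \<le> (\<integral>\<^sup>+\<omega>. ennreal (?g \<omega>) \<partial>lborel)"
    unfolding C_def by (intro nn_integral_mono) (auto simp: ennreal_power power2_eq_square mult_left_le intro!: ennreal_leI)
  also have "\<dots> < \<infinity>" using g by (simp add: nn_integral_eq_integral)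
  finally have C: "C < \<infinity>" .
  have iF: "integrable lborel (\<lambda>\<omega>. ?g \<omega> * cis (\<omega> \<bullet> \<xi>) * F \<omega> $ j)"
  proof (rule Bochner_Integration.integrable_bound[OF Fj])
    show "(\<lambda>\<omega>. ?g \<omega> * cis (\<omega> \<bullet> \<xi>) * F \<omega> $ j) \<in> borel_measurable lborel"
      unfolding cis_conv_exp by measurable
  qed (auto simp: norm_mult mult_left_le_one_le)
  have bound: "ennreal ((norm (?I n - ?J))\<^sup>2) \<le> C * N n" for n
  proof -
    have "?I n - ?J = (LINT \<omega>|lborel. ?g \<omega> * cis (\<omega> \<bullet> \<xi>) * ?t n \<omega> $ j - ?g \<omega> * cis (\<omega> \<bullet> \<xi>) * F \<omega> $ j)"
      by (intro Bochner_Integration.integral_diff[symmetric] truncated_fourier_gaussian f \<sigma> iF)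
    then have "ennreal (norm (?I n - ?J)) \<le> (\<integral>\<^sup>+\<omega>. ennreal (norm (?g \<omega> * cis (\<omega> \<bullet> \<xi>) * ?t n \<omega> $ j - ?g \<omega> * cis (\<omega> \<bullet> \<xi>) * F \<omega> $ j)) \<partial>lborel)"
      using integral_norm_bound_ennreal[OF Bochner_Integration.integrable_diff[OF truncated_fourier_gaussian(1)[OF f \<sigma>] iF]] by simp
    also have "\<dots> \<le> (\<integral>\<^sup>+\<omega>. ennreal (?g \<omega>) * ennreal (norm (F \<omega> - ?t n \<omega>)) \<partial>lborel)"
    proof (intro nn_integral_mono)
      fix \<omega>
      have "norm (?g \<omega> * cis (\<omega> \<bullet> \<xi>) * ?t n \<omega> $ j - ?g \<omega> * cis (\<omega> \<bullet> \<xi>) * F \<omega> $ j) = ?g \<omega> * norm ((F \<omega> - ?t n \<omega>) $ j)"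
        by (simp add: right_diff_distrib[symmetric] norm_mult norm_minus_commute)
      also have "\<dots> \<le> ?g \<omega> * norm (F \<omega> - ?t n \<omega>)"
        by (intro mult_left_mono Finite_Cartesian_Product.norm_nth_le) auto
      finally show "ennreal (norm (?g \<omega> * cis (\<omega> \<bullet> \<xi>) * ?t n \<omega> $ j - ?g \<omega> * cis (\<omega> \<bullet> \<xi>) * F \<omega> $ j)) \<le> ennreal (?g \<omega>) * ennreal (norm (F \<omega> - ?t n \<omega>))"
        by (simp add: ennreal_mult[symmetric] ennreal_leI)
    qed
    finally have "(ennreal (norm (?I n - ?J)))\<^sup>2 \<le> (\<integral>\<^sup>+\<omega>. ennreal (?g \<omega>) * ennreal (norm (F \<omega> - ?t n \<omega>)) \<partial>lborel)\<^sup>2"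
      by (intro power_mono) auto
    also have "\<dots> \<le> (\<integral>\<^sup>+\<omega>. (ennreal (?g \<omega>))\<^sup>2 \<partial>lborel) * (\<integral>\<^sup>+\<omega>. (ennreal (norm (F \<omega> - ?t n \<omega>)))\<^sup>2 \<partial>lborel)"
      by (rule Cauchy_Schwarz_nn_integral) measurable
    also have "\<dots> = C * N n"
      unfolding C_def N_def by (simp add: ennreal_power)
    finally show ?thesis by (simp add: ennreal_power)
  qed
  have "(\<lambda>n. C * N n) \<longlonglongrightarrow> C * 0"
    using C N by (intro ennreal_tendsto_cmult) auto
  then have lim: "(\<lambda>n. C * N n) \<longlonglongrightarrow> ennreal 0" by simp
  have "(\<lambda>n. ennreal ((norm (?I n - ?J))\<^sup>2)) \<longlonglongrightarrow> ennreal 0"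
    by (rule tendsto_sandwich[OF _ _ tendsto_const lim]) (use bound in \<open>auto intro!: always_eventually\<close>)
  then have "(\<lambda>n. (norm (?I n - ?J))\<^sup>2) \<longlonglongrightarrow> 0"
    by (rule tendsto_ennrealD) auto
  from tendsto_real_sqrt[OF this] have "(\<lambda>n. norm (?I n - ?J)) \<longlonglongrightarrow> 0"
    by simp
  then have "(\<lambda>n. ?I n - ?J) \<longlonglongrightarrow> 0" by (rule tendsto_norm_zero_cancel)
  then show ?thesis by (rule LIM_zero_cancel)
qed

text \<open>Both sides are paired with a Gaussian, first removing the truncation (\<open>R
  \<rightarrow> \<infinity>\<close>), then letting the Gaussian in frequency tend to
  \<open>1\<close>. On the space side this is a Gaussian mean of \<open>f\<close>, and continuity of
  \<open>f\<close> makes the identity hold at every point instead of almost everywhere.\<close>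
theorem fourier_inversion:
  fixes f :: "('d::finite) vfield"
  assumes f: "continuous_on UNIV f" and sq: "integrable lborel (\<lambda>\<xi>. (norm (f \<xi>))\<^sup>2)"
    and F: "has_fourier f F" and Fj: "integrable lborel (\<lambda>\<omega>. F \<omega> $ j)"
  shows "complex_of_real (f \<xi> $ j) =
    complex_of_real ((2 * pi) powr (- (real CARD('d) / 2))) * (LINT \<omega>|lborel. cis (\<omega> \<bullet> \<xi>) * F \<omega> $ j)"
proof -
  let ?g = "\<lambda>\<sigma> \<omega>::real^'d. exp (- (\<sigma>\<^sup>2 * (norm \<omega>)\<^sup>2 / 2))"
  let ?c = "complex_of_real ((2 * pi) powr (- (real CARD('d) / 2)))"
  have [measurable]: "F \<in> borel_measurable borel" using F by (simp add: has_fourier_def)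
  have cj: "continuous_on UNIV (\<lambda>\<xi>. f \<xi> $ j)" using f by (intro continuous_intros)
  have [measurable]: "f \<in> borel_measurable borel"  using f by (auto intro: borel_measurable_continuous_onI)
  have sqj: "integrable lborel (\<lambda>\<xi>. (f \<xi> $ j)\<^sup>2)"
  proof (rule Bochner_Integration.integrable_bound[OF sq])
    have "(f \<xi> $ j)\<^sup>2 \<le> (norm (f \<xi>))\<^sup>2" for \<xi>
      using component_le_norm_cart[of "f \<xi>" j] by (metis abs_ge_zero power2_abs power_mono)
    then show "AE \<xi> in lborel. norm ((f \<xi> $ j)\<^sup>2) \<le> norm ((norm (f \<xi>))\<^sup>2)" by simp
  qed measurable
  have eq: "?c * (LINT \<omega>|lborel. ?g \<sigma> \<omega> * cis (\<omega> \<bullet> \<xi>) * F \<omega> $ j) = complex_of_real (LINT \<eta>|lborel. f \<eta> $ j * gauss_kernel \<sigma> \<xi> \<eta>)"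
    if \<sigma>: "\<sigma> > 0" for \<sigma>
  proof (rule LIMSEQ_unique)
    show "(\<lambda>n. ?c * (LINT \<omega>|lborel. ?g \<sigma> \<omega> * cis (\<omega> \<bullet> \<xi>) * truncated_fourier (real n) f \<omega> $ j))
      \<longlonglongrightarrow> ?c * (LINT \<omega>|lborel. ?g \<sigma> \<omega> * cis (\<omega> \<bullet> \<xi>) * F \<omega> $ j)"
      by (intro tendsto_mult tendsto_const fourier_pairing_tendsto f F Fj \<sigma>)
    have int: "integrable lborel (\<lambda>\<eta>. f \<eta> $ j * gauss_kernel \<sigma> \<xi> \<eta>)"
      by (rule gauss_kernel_integrable_mult[OF cj sqj \<sigma>])
    have "(\<lambda>n. LINT \<eta>|lborel. indicator (cball 0 (real n)) \<eta> *\<^sub>R (f \<eta> $ j * gauss_kernel \<sigma> \<xi> \<eta>))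
       \<longlonglongrightarrow> (LINT \<eta>|lborel. f \<eta> $ j * gauss_kernel \<sigma> \<xi> \<eta>)"
    proof (rule integral_dominated_convergence)
      show "integrable lborel (\<lambda>\<eta>. norm (f \<eta> $ j * gauss_kernel \<sigma> \<xi> \<eta>))" using int by (rule integrable_norm)
      show "AE \<eta> in lborel. (\<lambda>n. indicator (cball 0 (real n)) \<eta> *\<^sub>R (f \<eta> $ j * gauss_kernel \<sigma> \<xi> \<eta>)) \<longlonglongrightarrow> f \<eta> $ j * gauss_kernel \<sigma> \<xi> \<eta>"
      proof (rule AE_I2, rule tendsto_eventually)
        fix \<eta> :: "real^'d"
        obtain n0 where "norm \<eta> \<le> real n0" using real_arch_simple by blast
        then have "indicator (cball 0 (real n)) \<eta> *\<^sub>R (f \<eta> $ j * gauss_kernel \<sigma> \<xi> \<eta>) = f \<eta> $ j * gauss_kernel \<sigma> \<xi> \<eta>" if "n \<ge> n0" for n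
          using that by (auto simp: indicator_def)
        then show "\<forall>\<^sub>F n in sequentially. indicator (cball 0 (real n)) \<eta> *\<^sub>R (f \<eta> $ j * gauss_kernel \<sigma> \<xi> \<eta>) = f \<eta> $ j * gauss_kernel \<sigma> \<xi> \<eta>"
          unfolding eventually_sequentially by blast
      qed
    qed (use int in \<open>auto simp: indicator_def\<close>)
    then show "(\<lambda>n. ?c * (LINT \<omega>|lborel. ?g \<sigma> \<omega> * cis (\<omega> \<bullet> \<xi>) * truncated_fourier (real n) f \<omega> $ j))
      \<longlonglongrightarrow> complex_of_real (LINT \<eta>|lborel. f \<eta> $ j * gauss_kernel \<sigma> \<xi> \<eta>)"
      unfolding truncated_fourier_gaussian(2)[OF f \<sigma>] set_lebesgue_integral_def by (rule tendsto_of_real)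
  qed
  have "(\<lambda>n. ?c * (LINT \<omega>|lborel. ?g (1 / real (Suc n)) \<omega> * cis (\<omega> \<bullet> \<xi>) * F \<omega> $ j)) \<longlonglongrightarrow> complex_of_real (f \<xi> $ j)"
    by (subst eq, simp, intro tendsto_of_real gauss_mollify cj sqj)
  moreover have "(\<lambda>n. LINT \<omega>|lborel. ?g (1 / real (Suc n)) \<omega> * cis (\<omega> \<bullet> \<xi>) * F \<omega> $ j) \<longlonglongrightarrow> (LINT \<omega>|lborel. cis (\<omega> \<bullet> \<xi>) * F \<omega> $ j)"
  proof (rule integral_dominated_convergence)
    show "integrable lborel (\<lambda>\<omega>. norm (F \<omega> $ j))" using Fj by (rule integrable_norm)
    show "AE \<omega> in lborel. norm (?g (1 / real (Suc n)) \<omega> * cis (\<omega> \<bullet> \<xi>) * F \<omega> $ j) \<le> norm (F \<omega> $ j)" for n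
      by (auto simp: norm_mult mult_left_le_one_le)
    show "AE \<omega> in lborel. (\<lambda>n. ?g (1 / real (Suc n)) \<omega> * cis (\<omega> \<bullet> \<xi>) * F \<omega> $ j) \<longlonglongrightarrow> cis (\<omega> \<bullet> \<xi>) * F \<omega> $ j"
    proof (rule AE_I2)
      fix \<omega> :: "real^'d"
      have "(\<lambda>n. 1 / real (Suc n)) \<longlonglongrightarrow> 0" using LIMSEQ_inverse_real_of_nat by (simp add: inverse_eq_divide)
      then have "(\<lambda>n. ?g (1 / real (Suc n)) \<omega>) \<longlonglongrightarrow> exp (- (0\<^sup>2 * (norm \<omega>)\<^sup>2 / 2))"
        by (intro tendsto_intros) auto
      then have "(\<lambda>n. complex_of_real (?g (1 / real (Suc n)) \<omega>) * cis (\<omega> \<bullet> \<xi>) * F \<omega> $ j) \<longlonglongrightarrow> complex_of_real 1 * cis (\<omega> \<bullet> \<xi>) * F \<omega> $ j"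
        by (intro tendsto_intros) auto
      then show "(\<lambda>n. ?g (1 / real (Suc n)) \<omega> * cis (\<omega> \<bullet> \<xi>) * F \<omega> $ j) \<longlonglongrightarrow> cis (\<omega> \<bullet> \<xi>) * F \<omega> $ j"
        by simp
    qed
  qed (unfold cis_conv_exp, measurable)
  then have "(\<lambda>n. ?c * (LINT \<omega>|lborel. ?g (1 / real (Suc n)) \<omega> * cis (\<omega> \<bullet> \<xi>) * F \<omega> $ j)) \<longlonglongrightarrow> ?c * (LINT \<omega>|lborel. cis (\<omega> \<bullet> \<xi>) * F \<omega> $ j)"
    by (intro tendsto_mult tendsto_const)
  ultimately show ?thesis by (rule LIMSEQ_unique)
qed

section \<open>Functionals given by a Fourier symbol\<close>

definition weighted_L2 :: "real \<Rightarrow> (real^'d::finite \<Rightarrow> complex^'d) \<Rightarrow> bool" where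
  "weighted_L2 k F \<longleftrightarrow> F \<in> borel_measurable borel \<and>
     integrable lborel (\<lambda>\<omega>. (1 + (norm \<omega>)\<^sup>2) powr k * (norm (F \<omega>))\<^sup>2)"

definition weighted_norm :: "real \<Rightarrow> (real^'d::finite \<Rightarrow> complex^'d) \<Rightarrow> real" where
  "weighted_norm k F = sqrt (LINT \<omega>|lborel. (1 + (norm \<omega>)\<^sup>2) powr k * (norm (F \<omega>))\<^sup>2)"

text \<open>The weight has order four, the largest order that square integrability against \<open>(1
  + \<bar>\<omega>\<bar>\<^sup>2)\<close> to the power \<open>k\<close> allows uniformly for
  \<open>k > d/2 + 4\<close>.\<close>
definition symbol_le :: "(real^'d::finite \<Rightarrow> complex) \<Rightarrow> real \<Rightarrow> bool" where
  "symbol_le m A \<longleftrightarrow> m \<in> borel_measurable borel \<and> (\<forall>\<omega>. norm (m \<omega>) \<le> A * (1 + (norm \<omega>)\<^sup>2)\<^sup>2)"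

text \<open>For \<open>m \<omega> = cis (\<omega> \<bullet> \<xi>)\<close> this is the
  \<open>j\<close>-th component at \<open>\<xi>\<close> of the function with transform
  \<open>F\<close>.\<close>
definition symbol_fun :: "(real^'d::finite \<Rightarrow> complex) \<Rightarrow> 'd \<Rightarrow> (real^'d \<Rightarrow> complex^'d) \<Rightarrow> real" where
  "symbol_fun m j F = (2 * pi) powr (- (real CARD('d) / 2)) * Re (LINT \<omega>|lborel. m \<omega> * F \<omega> $ j)"

definition symbol_const :: "'d::finite itself \<Rightarrow> real \<Rightarrow> real" where
  "symbol_const _ k = (2 * pi) powr (- (real CARD('d) / 2)) *
     sqrt (LINT \<omega>::real^'d|lborel. (1 + (norm \<omega>)\<^sup>2) powr (4 - k))"

lemma symbol_const_nonneg: "symbol_const a k \<ge> 0"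
  by (simp add: symbol_const_def)

lemma weighted_norm_nonneg: "weighted_norm k F \<ge> 0"
  by (simp add: weighted_norm_def)

lemma symbol_le_nonneg: "symbol_le m A \<Longrightarrow> A \<ge> 0"
proof -
  assume "symbol_le m A"
  then have "norm (m 0) \<le> A * (1 + (norm (0::real^'a))\<^sup>2)\<^sup>2"
    unfolding symbol_le_def by blast
  then show "A \<ge> 0" using norm_ge_zero[of "m 0"] by (simp del: norm_ge_zero)
qed

lemma one_plus_sq_pos [simp]: "0 < 1 + (norm x)\<^sup>2" "1 + (norm x)\<^sup>2 \<noteq> 0"
  by (auto simp: add_nonneg_eq_0_iff intro: add_pos_nonneg)

text \<open>Cauchy-Schwarz with the weight \<open>(1 + \<bar>\<omega>\<bar>\<^sup>2)\<close> to the
  power \<open>k/2\<close> on \<open>F\<close>; what remains on the other side is \<open>(1 +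
  \<bar>\<omega>\<bar>\<^sup>2)\<close> to the power \<open>4 - k\<close>, integrable because
  \<open>k - 4 > d/2\<close>.\<close>
lemma symbol_fun_bound:
  fixes F :: "real^'d::finite \<Rightarrow> complex^'d"
  assumes k: "k > real CARD('d) / 2 + 4" and F: "weighted_L2 k F" and m: "symbol_le m A"
  shows "integrable lborel (\<lambda>\<omega>. m \<omega> * F \<omega> $ j)"
    and "\<bar>symbol_fun m j F\<bar> \<le> A * symbol_const TYPE('d) k * weighted_norm k F"
proof -
  define w :: "real^'d \<Rightarrow> real" where "w = (\<lambda>\<omega>. 1 + (norm \<omega>)\<^sup>2)"
  have w: "w \<omega> > 0" for \<omega> by (simp add: w_def)
  have wm [measurable]: "w \<in> borel_measurable borel" unfolding w_def by measurable
  have [measurable]: "F \<in> borel_measurable borel" using F by (simp add: weighted_L2_def)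
  have [measurable]: "m \<in> borel_measurable borel" using m by (simp add: symbol_le_def)
  define a where "a = (\<lambda>\<omega>. w \<omega> powr ((4 - k) / 2))"
  define b where "b = (\<lambda>\<omega>. w \<omega> powr (k / 2) * norm (F \<omega>))"
  have [measurable]: "a \<in> borel_measurable borel" "b \<in> borel_measurable borel"
    unfolding a_def b_def by measurable
  have a2: "(a \<omega>)\<^sup>2 = w \<omega> powr (4 - k)" and b2: "(b \<omega>)\<^sup>2 = w \<omega> powr k * (norm (F \<omega>))\<^sup>2" for \<omega>
    using w[of \<omega>] by (simp_all add: a_def b_def power_mult_distrib power2_eq_square flip: powr_add)
  have ia: "integrable lborel (\<lambda>\<omega>. (a \<omega>)\<^sup>2)"
    unfolding a2 w_def using integrable_bessel_weight[where 'a="real^'d" and r="k - 4"] k by simp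
  have ib: "integrable lborel (\<lambda>\<omega>. (b \<omega>)\<^sup>2)"
    unfolding b2 w_def using F by (simp add: weighted_L2_def)
  have "a \<in> borel_measurable lborel" "b \<in> borel_measurable lborel" by measurable
  note CS = integral_Cauchy_Schwarz[OF this ia ib]
  have iab: "integrable lborel (\<lambda>\<omega>. a \<omega> * b \<omega>)" by (rule CS(1))
  have ab: "a \<omega> * b \<omega> = (w \<omega>)\<^sup>2 * norm (F \<omega>)" for \<omega>
  proof -
    have "w \<omega> powr ((4 - k) / 2) * w \<omega> powr (k / 2) = w \<omega> powr 2"
      by (subst powr_add[symmetric]) (simp add: field_simps)
    also have "\<dots> = (w \<omega>)\<^sup>2" using w[of \<omega>] by simp
    finally show ?thesis by (simp add: a_def b_def mult.assoc[symmetric])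
  qed
  have bound: "norm (m \<omega> * F \<omega> $ j) \<le> A * (a \<omega> * b \<omega>)" for \<omega>
  proof -
    have "norm (m \<omega> * F \<omega> $ j) \<le> (A * (w \<omega>)\<^sup>2) * norm (F \<omega>)"
      unfolding norm_mult using m symbol_le_nonneg[OF m]
      by (intro mult_mono Finite_Cartesian_Product.norm_nth_le) (auto simp: symbol_le_def w_def)
    then show ?thesis by (simp add: ab mult.assoc)
  qed
  have ab0: "a \<omega> * b \<omega> \<ge> 0" for \<omega> by (simp add: ab)
  show int: "integrable lborel (\<lambda>\<omega>. m \<omega> * F \<omega> $ j)"
  proof (rule Bochner_Integration.integrable_bound)
    show "integrable lborel (\<lambda>\<omega>. A * (a \<omega> * b \<omega>))" using iab by simp
    show "AE \<omega> in lborel. norm (m \<omega> * F \<omega> $ j) \<le> norm (A * (a \<omega> * b \<omega>))"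
      using bound by (intro AE_I2) (metis abs_ge_self order_trans real_norm_def)
  qed measurable
  have "norm (LINT \<omega>|lborel. m \<omega> * F \<omega> $ j) \<le> (LINT \<omega>|lborel. A * (a \<omega> * b \<omega>))"
    by (rule Bochner_Integration.integral_norm_bound_integral[OF int]) (use iab bound in auto)
  also have "\<dots> = A * (LINT \<omega>|lborel. \<bar>a \<omega> * b \<omega>\<bar>)"
    using ab0 by simp
  also have "\<dots> \<le> A * (sqrt (LINT \<omega>|lborel. (a \<omega>)\<^sup>2) * sqrt (LINT \<omega>|lborel. (b \<omega>)\<^sup>2))"
    by (intro mult_left_mono CS(2) symbol_le_nonneg[OF m])
  also have "\<dots> = A * (sqrt (LINT \<omega>|lborel. w \<omega> powr (4 - k)) * weighted_norm k F)"
    by (simp add: a2 b2 weighted_norm_def w_def)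
  finally have "\<bar>Re (LINT \<omega>|lborel. m \<omega> * F \<omega> $ j)\<bar> \<le> A * (sqrt (LINT \<omega>|lborel. w \<omega> powr (4 - k)) * weighted_norm k F)"
    using abs_Re_le_cmod order_trans by blast
  then have "(2 * pi) powr (- (real CARD('d) / 2)) * \<bar>Re (LINT \<omega>|lborel. m \<omega> * F \<omega> $ j)\<bar>
     \<le> (2 * pi) powr (- (real CARD('d) / 2)) * (A * (sqrt (LINT \<omega>|lborel. w \<omega> powr (4 - k)) * weighted_norm k F))"
    by (intro mult_left_mono) auto
  then show "\<bar>symbol_fun m j F\<bar> \<le> A * symbol_const TYPE('d) k * weighted_norm k F"
    unfolding symbol_fun_def symbol_const_def w_def by (simp add: abs_mult mult_ac)
qed

lemma symbol_fun_diff: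
  fixes F :: "real^'d::finite \<Rightarrow> complex^'d"
  assumes "k > real CARD('d) / 2 + 4" "weighted_L2 k F" "symbol_le m A" "symbol_le m' A'"
  shows "symbol_fun (\<lambda>\<omega>. m \<omega> - m' \<omega>) j F = symbol_fun m j F - symbol_fun m' j F"
  unfolding symbol_fun_def left_diff_distrib
  by (subst Bochner_Integration.integral_diff)
     (use symbol_fun_bound(1)[OF assms(1,2)] assms(3,4) in \<open>auto simp: right_diff_distrib\<close>)

lemma symbol_fun_add:
  fixes F :: "real^'d::finite \<Rightarrow> complex^'d"
  assumes "k > real CARD('d) / 2 + 4" "weighted_L2 k F" "symbol_le m A" "symbol_le m' A'"
  shows "symbol_fun (\<lambda>\<omega>. m \<omega> + m' \<omega>) j F = symbol_fun m j F + symbol_fun m' j F"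
  unfolding symbol_fun_def distrib_right
  by (subst Bochner_Integration.integral_add)
     (use symbol_fun_bound(1)[OF assms(1,2)] assms(3,4) in \<open>auto simp: distrib_left\<close>)

lemma symbol_fun_scale: "symbol_fun (\<lambda>\<omega>. complex_of_real r * m \<omega>) j F = r * symbol_fun m j F"
  unfolding symbol_fun_def mult.assoc integral_mult_right_zero by simp

lemma weighted_L2_lincomb:
  fixes U :: "nat \<Rightarrow> real^'d::finite \<Rightarrow> complex^'d"
  assumes U: "\<And>i. i < n \<Longrightarrow> weighted_L2 k (U i)"
    and ip: "\<And>i j. i < n \<Longrightarrow> j < n \<Longrightarrow>
      (LINT \<omega>|lborel. (1 + (norm \<omega>)\<^sup>2) powr k * (U i \<omega> \<bullet> U j \<omega>)) = (if i = j then 1 else 0)"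
  shows "weighted_L2 k (\<lambda>\<omega>. \<Sum>i<n. c i *\<^sub>R U i \<omega>)"
    and "(weighted_norm k (\<lambda>\<omega>. \<Sum>i<n. c i *\<^sub>R U i \<omega>))\<^sup>2 = (\<Sum>i<n. (c i)\<^sup>2)"
proof -
  let ?w = "\<lambda>\<omega>::real^'d. (1 + (norm \<omega>)\<^sup>2) powr k"
  have Um [measurable]: "U i \<in> borel_measurable borel" if "i < n" for i using U[OF that] by (simp add: weighted_L2_def)
  have iU: "integrable lborel (\<lambda>\<omega>. ?w \<omega> * (U i \<omega> \<bullet> U j \<omega>))" if ij: "i < n" "j < n" for i j
  proof (rule Bochner_Integration.integrable_bound)
    note [measurable] = Um[OF ij(1)] Um[OF ij(2)]
    show "integrable lborel (\<lambda>\<omega>. ?w \<omega> * (norm (U i \<omega>))\<^sup>2 + ?w \<omega> * (norm (U j \<omega>))\<^sup>2)"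
      using U[OF ij(1)] U[OF ij(2)] by (auto simp: weighted_L2_def)
    show "(\<lambda>\<omega>. ?w \<omega> * (U i \<omega> \<bullet> U j \<omega>)) \<in> borel_measurable lborel" by measurable
    show "AE \<omega> in lborel. norm (?w \<omega> * (U i \<omega> \<bullet> U j \<omega>)) \<le> norm (?w \<omega> * (norm (U i \<omega>))\<^sup>2 + ?w \<omega> * (norm (U j \<omega>))\<^sup>2)"
    proof (rule AE_I2)
      fix \<omega>
      have "\<bar>U i \<omega> \<bullet> U j \<omega>\<bar> \<le> norm (U i \<omega>) * norm (U j \<omega>)" by (rule Cauchy_Schwarz_ineq2)
      also have "\<dots> \<le> (norm (U i \<omega>))\<^sup>2 + (norm (U j \<omega>))\<^sup>2"
      proof -
        have "2 * norm (U i \<omega>) * norm (U j \<omega>) \<le> (norm (U i \<omega>))\<^sup>2 + (norm (U j \<omega>))\<^sup>2" by (rule sum_squares_bound)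
        moreover have "0 \<le> norm (U i \<omega>) * norm (U j \<omega>)" by simp
        ultimately show ?thesis by linarith
      qed
      finally show "norm (?w \<omega> * (U i \<omega> \<bullet> U j \<omega>)) \<le> norm (?w \<omega> * (norm (U i \<omega>))\<^sup>2 + ?w \<omega> * (norm (U j \<omega>))\<^sup>2)"
        by (simp add: abs_mult distrib_left[symmetric] mult_left_mono)
    qed
  qed
  have eq: "?w \<omega> * (norm (\<Sum>i<n. c i *\<^sub>R U i \<omega>))\<^sup>2 = (\<Sum>i<n. \<Sum>j<n. c i * c j * (?w \<omega> * (U i \<omega> \<bullet> U j \<omega>)))" for \<omega>
  proof -
    have "(norm (\<Sum>i<n. c i *\<^sub>R U i \<omega>))\<^sup>2 = (\<Sum>i<n. \<Sum>j<n. c i * c j * (U i \<omega> \<bullet> U j \<omega>))"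
      unfolding power2_norm_eq_inner[of "sum _ _"] inner_sum_left
      unfolding inner_sum_right by (simp add: mult_ac)
    then show ?thesis by (simp only: sum_distrib_left) (simp add: mult_ac)
  qed
  have int: "integrable lborel (\<lambda>\<omega>. \<Sum>i<n. \<Sum>j<n. c i * c j * (?w \<omega> * (U i \<omega> \<bullet> U j \<omega>)))"
    using iU by (intro Bochner_Integration.integrable_sum integrable_mult_right) auto
  show "weighted_L2 k (\<lambda>\<omega>. \<Sum>i<n. c i *\<^sub>R U i \<omega>)"
    unfolding weighted_L2_def eq using int by (auto intro!: borel_measurable_sum borel_measurable_scaleR Um)
  have "(LINT \<omega>|lborel. ?w \<omega> * (norm (\<Sum>i<n. c i *\<^sub>R U i \<omega>))\<^sup>2)
      = (\<Sum>i<n. \<Sum>j<n. c i * c j * (LINT \<omega>|lborel. ?w \<omega> * (U i \<omega> \<bullet> U j \<omega>)))"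
    unfolding eq using iU
    by (subst Bochner_Integration.integral_sum, force)+ simp
  also have "\<dots> = (\<Sum>i<n. \<Sum>j<n. if i = j then c i * c j else 0)"
    by (intro sum.cong refl) (auto simp: ip)
  also have "\<dots> = (\<Sum>i<n. (c i)\<^sup>2)"
    by (simp add: power2_eq_square)
  finally show "(weighted_norm k (\<lambda>\<omega>. \<Sum>i<n. c i *\<^sub>R U i \<omega>))\<^sup>2 = (\<Sum>i<n. (c i)\<^sup>2)"
    unfolding weighted_norm_def by (simp add: sum_nonneg)
qed

text \<open>Bessel's inequality by duality: applied to \<open>\<Sum>i. c\<^sub>i U\<^sub>i\<close>
  with \<open>c\<^sub>i = symbol_fun m j U\<^sub>i\<close>, the functional takes the value \<open>S
  = \<Sum>i. c\<^sub>i\<^sup>2\<close>, while the norm of the combination is \<open>sqrt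
  S\<close>.\<close>
lemma symbol_fun_bessel:
  fixes U :: "nat \<Rightarrow> real^'d::finite \<Rightarrow> complex^'d"
  assumes k: "k > real CARD('d) / 2 + 4" and U: "\<And>i. i < n \<Longrightarrow> weighted_L2 k (U i)"
    and ip: "\<And>i j. i < n \<Longrightarrow> j < n \<Longrightarrow>
      (LINT \<omega>|lborel. (1 + (norm \<omega>)\<^sup>2) powr k * (U i \<omega> \<bullet> U j \<omega>)) = (if i = j then 1 else 0)"
    and m: "symbol_le m A"
  shows "(\<Sum>i<n. (symbol_fun m j (U i))\<^sup>2) \<le> (A * symbol_const TYPE('d) k)\<^sup>2"
proof -
  define c where "c = (\<lambda>i. symbol_fun m j (U i))"
  let ?G = "\<lambda>\<omega>. \<Sum>i<n. c i *\<^sub>R U i \<omega>"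
  let ?S = "\<Sum>i<n. (c i)\<^sup>2"
  let ?K = "A * symbol_const TYPE('d) k"
  have L: "weighted_L2 k ?G" "(weighted_norm k ?G)\<^sup>2 = ?S"
    using weighted_L2_lincomb[where c=c, OF U ip] by auto
  have K0: "?K \<ge> 0" by (intro mult_nonneg_nonneg symbol_le_nonneg[OF m] symbol_const_nonneg)
  have S0: "?S \<ge> 0" by (simp add: sum_nonneg)
  have nm: "weighted_norm k ?G = sqrt ?S"
    by (rule real_sqrt_unique[OF L(2) weighted_norm_nonneg, symmetric])
  have "(LINT \<omega>|lborel. m \<omega> * ?G \<omega> $ j) = (LINT \<omega>|lborel. (\<Sum>i<n. complex_of_real (c i) * (m \<omega> * U i \<omega> $ j)))"
    by (intro Bochner_Integration.integral_cong refl) (simp add: sum_distrib_left scaleR_conv_of_real[where 'a=complex] mult_ac)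
  also have "\<dots> = (\<Sum>i<n. complex_of_real (c i) * (LINT \<omega>|lborel. m \<omega> * U i \<omega> $ j))"
    using symbol_fun_bound(1)[OF k U m] by (subst Bochner_Integration.integral_sum) auto
  finally have "symbol_fun m j ?G = (\<Sum>i<n. c i * c i)"
    unfolding c_def symbol_fun_def by (simp add: sum_distrib_left mult_ac)
  then have "?S = symbol_fun m j ?G" by (simp add: power2_eq_square)
  also have "\<dots> \<le> ?K * sqrt ?S"
    using symbol_fun_bound(2)[OF k L(1) m, of j] nm by simp
  finally have *: "?S \<le> ?K * sqrt ?S" .
  have "sqrt ?S \<le> ?K"
  proof (cases "?S = 0")
    case False
    then have "sqrt ?S > 0" using S0 by simp
    moreover have "sqrt ?S * sqrt ?S \<le> ?K * sqrt ?S" using * S0 by simp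
    ultimately show ?thesis by (rule mult_right_le_imp_le[rotated])
  qed (use K0 in simp)
  then have "(sqrt ?S)\<^sup>2 \<le> ?K\<^sup>2" using S0 by (intro power_mono) auto
  then show ?thesis using S0 by (simp add: c_def)
qed

section \<open>Sobolev functions as Fourier integrals\<close>

lemma norm_diff_sq_le: "(norm (a - b))\<^sup>2 \<le> 2 * (norm a)\<^sup>2 + 2 * (norm b)\<^sup>2"
  for a b :: "'a::real_normed_vector"
proof -
  have "(norm (a - b))\<^sup>2 \<le> (norm a + norm b)\<^sup>2"
    by (intro power_mono norm_triangle_ineq4) auto
  also have "\<dots> \<le> 2 * (norm a)\<^sup>2 + 2 * (norm b)\<^sup>2"
    using sum_squares_bound[of "norm a" "norm b"] by (simp add: power2_sum)
  finally show ?thesis .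
qed

lemma integrable_weighted_diff:
  fixes F G :: "'a \<Rightarrow> 'b::{real_normed_vector,second_countable_topology}"
  assumes [measurable]: "F \<in> borel_measurable M" "G \<in> borel_measurable M" "w \<in> borel_measurable M"
    and w: "\<And>x. w x \<ge> (0::real)"
    and "integrable M (\<lambda>x. w x * (norm (F x))\<^sup>2)" "integrable M (\<lambda>x. w x * (norm (G x))\<^sup>2)"
  shows "integrable M (\<lambda>x. w x * (norm (F x - G x))\<^sup>2)"
proof (rule Bochner_Integration.integrable_bound)
  show "integrable M (\<lambda>x. 2 * (w x * (norm (F x))\<^sup>2) + 2 * (w x * (norm (G x))\<^sup>2))"
    using assms by simp
  show "AE x in M. norm (w x * (norm (F x - G x))\<^sup>2) \<le> norm (2 * (w x * (norm (F x))\<^sup>2) + 2 * (w x * (norm (G x))\<^sup>2))"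
  proof (rule AE_I2)
    fix x
    show "norm (w x * (norm (F x - G x))\<^sup>2) \<le> norm (2 * (w x * (norm (F x))\<^sup>2) + 2 * (w x * (norm (G x))\<^sup>2))"
      using mult_left_mono[OF norm_diff_sq_le[of "F x" "G x"] w[of x]] w[of x] by (simp add: algebra_simps)
  qed
qed measurable

lemma nn_integral_diff_sq_le:
  fixes F G :: "'a \<Rightarrow> 'b::{real_normed_vector,second_countable_topology}"
  assumes [measurable]: "F \<in> borel_measurable M" "G \<in> borel_measurable M"
  shows "(\<integral>\<^sup>+x. ennreal ((norm (F x - G x))\<^sup>2) \<partial>M)
      \<le> 2 * (\<integral>\<^sup>+x. ennreal ((norm (F x))\<^sup>2) \<partial>M) + 2 * (\<integral>\<^sup>+x. ennreal ((norm (G x))\<^sup>2) \<partial>M)"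
proof -
  have "(\<integral>\<^sup>+x. ennreal ((norm (F x - G x))\<^sup>2) \<partial>M) \<le> (\<integral>\<^sup>+x. 2 * ennreal ((norm (F x))\<^sup>2) + 2 * ennreal ((norm (G x))\<^sup>2) \<partial>M)"
  proof (intro nn_integral_mono)
    fix x
    have "ennreal ((norm (F x - G x))\<^sup>2) \<le> ennreal (2 * (norm (F x))\<^sup>2 + 2 * (norm (G x))\<^sup>2)"
      by (intro ennreal_leI norm_diff_sq_le)
    then show "ennreal ((norm (F x - G x))\<^sup>2) \<le> 2 * ennreal ((norm (F x))\<^sup>2) + 2 * ennreal ((norm (G x))\<^sup>2)"
      by (simp add: ennreal_plus ennreal_mult)
  qed
  also have "\<dots> = 2 * (\<integral>\<^sup>+x. ennreal ((norm (F x))\<^sup>2) \<partial>M) + 2 * (\<integral>\<^sup>+x. ennreal ((norm (G x))\<^sup>2) \<partial>M)"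
    by (simp add: nn_integral_add nn_integral_cmult)
  finally show ?thesis .
qed

text \<open>Needed because \<open>fourier f\<close> is a choice: the weighted integrability in the
  definition of the Sobolev space is stated for some transform and has to be transferred to the
  chosen one.\<close>
lemma has_fourier_AE_unique:
  fixes f :: "('d::finite) vfield"
  assumes f: "continuous_on UNIV f" and F: "has_fourier f F" and G: "has_fourier f G"
  shows "AE \<omega> in lborel. F \<omega> = G \<omega>"
proof -
  have [measurable]: "F \<in> borel_measurable borel" "G \<in> borel_measurable borel"
    using F G by (simp_all add: has_fourier_def)
  have [measurable]: "truncated_fourier R f \<in> borel_measurable borel" for R using f by (rule truncated_fourier_measurable)
  let ?N = "\<lambda>F R. \<integral>\<^sup>+\<omega>. ennreal ((norm (F \<omega> - truncated_fourier R f \<omega>))\<^sup>2) \<partial>lborel"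
  let ?D = "\<integral>\<^sup>+\<omega>. ennreal ((norm (F \<omega> - G \<omega>))\<^sup>2) \<partial>lborel"
  have bd: "?D \<le> 2 * ?N F R + 2 * ?N G R" for R
    using nn_integral_diff_sq_le[of "\<lambda>\<omega>. F \<omega> - truncated_fourier R f \<omega>" lborel "\<lambda>\<omega>. G \<omega> - truncated_fourier R f \<omega>"] by simp
  have "((\<lambda>R. 2 * ?N F R + 2 * ?N G R) \<longlongrightarrow> 2 * 0 + 2 * 0) at_top"
    using F G unfolding has_fourier_def by (intro tendsto_add ennreal_tendsto_cmult) auto
  then have "?D \<le> 2 * 0 + 2 * 0"
    by (rule tendsto_lowerbound) (auto intro!: always_eventually bd)
  then have "?D = 0" by simp
  then have "AE \<omega> in lborel. ennreal ((norm (F \<omega> - G \<omega>))\<^sup>2) = 0"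
    by (subst (asm) nn_integral_0_iff_AE) auto
  then show ?thesis by eventually_elim (simp add: ennreal_eq_0_iff)
qed

lemma has_fourier_diff:
  fixes f g :: "('d::finite) vfield"
  assumes f: "continuous_on UNIV f" "has_fourier f F" and g: "continuous_on UNIV g" "has_fourier g G"
  shows "has_fourier (\<lambda>\<xi>. f \<xi> - g \<xi>) (\<lambda>\<omega>. F \<omega> - G \<omega>)"
proof -
  have [measurable]: "F \<in> borel_measurable borel" "G \<in> borel_measurable borel"
    using f g by (simp_all add: has_fourier_def)
  have [measurable]: "truncated_fourier R f \<in> borel_measurable borel" "truncated_fourier R g \<in> borel_measurable borel" for R
    using f(1) g(1) by (auto intro: truncated_fourier_measurable)
  have tf: "truncated_fourier R (\<lambda>\<xi>. f \<xi> - g \<xi>) \<omega> = truncated_fourier R f \<omega> - truncated_fourier R g \<omega>" for R \<omega>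
  proof -
    have "(LINT \<xi>:cball 0 R|lborel. cis (- (\<omega> \<bullet> \<xi>)) * complex_of_real ((f \<xi> - g \<xi>) $ j))
      = (LINT \<xi>:cball 0 R|lborel. cis (- (\<omega> \<bullet> \<xi>)) * complex_of_real (f \<xi> $ j))
      - (LINT \<xi>:cball 0 R|lborel. cis (- (\<omega> \<bullet> \<xi>)) * complex_of_real (g \<xi> $ j))" for j
      using truncated_fourier_integrable(1)[OF f(1)] truncated_fourier_integrable(1)[OF g(1)]
      by (subst set_integral_diff(2)[symmetric]) (auto simp: right_diff_distrib)
    then show ?thesis
      by (simp add: truncated_fourier_def vec_eq_iff right_diff_distrib)
  qed
  let ?N = "\<lambda>F f R. \<integral>\<^sup>+\<omega>. ennreal ((norm (F \<omega> - truncated_fourier R f \<omega>))\<^sup>2) \<partial>lborel"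
  have bd: "(\<integral>\<^sup>+\<omega>. ennreal ((norm (F \<omega> - G \<omega> - truncated_fourier R (\<lambda>\<xi>. f \<xi> - g \<xi>) \<omega>))\<^sup>2) \<partial>lborel) \<le> 2 * ?N F f R + 2 * ?N G g R" for R
    using nn_integral_diff_sq_le[of "\<lambda>\<omega>. F \<omega> - truncated_fourier R f \<omega>" lborel "\<lambda>\<omega>. G \<omega> - truncated_fourier R g \<omega>"]
    by (simp add: tf algebra_simps)
  have lim: "((\<lambda>R. 2 * ?N F f R + 2 * ?N G g R) \<longlongrightarrow> 2 * 0 + 2 * 0) at_top"
    using f g unfolding has_fourier_def by (intro tendsto_add ennreal_tendsto_cmult) auto
  have "((\<lambda>R. \<integral>\<^sup>+\<omega>. ennreal ((norm (F \<omega> - G \<omega> - truncated_fourier R (\<lambda>\<xi>. f \<xi> - g \<xi>) \<omega>))\<^sup>2) \<partial>lborel) \<longlongrightarrow> 0) at_top"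
    by (rule tendsto_sandwich[OF _ _ tendsto_const lim[simplified]])
       (use bd in \<open>auto intro!: always_eventually\<close>)
  moreover have "integrable lborel (\<lambda>\<omega>. (norm (F \<omega> - G \<omega>))\<^sup>2)"
    using integrable_weighted_diff[of F lborel G "\<lambda>_. 1"] f g by (simp add: has_fourier_def)
  ultimately show ?thesis unfolding has_fourier_def by simp
qed

lemma sobolev_space_fourier:
  fixes f :: "('d::finite) vfield"
  assumes "f \<in> sobolev_space k"
  shows "has_fourier f (fourier f)" and "weighted_L2 k (fourier f)"
    and "sobolev_norm k f = weighted_norm k (fourier f)"
proof -
  obtain F where F: "has_fourier f F" "integrable lborel (\<lambda>\<omega>. (1 + (norm \<omega>)\<^sup>2) powr k * (norm (F \<omega>))\<^sup>2)"
    and c: "continuous_on UNIV f"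
    using assms by (auto simp: sobolev_space_def)
  show hf: "has_fourier f (fourier f)" unfolding fourier_def by (rule someI[of "has_fourier f", OF F(1)])
  have [measurable]: "F \<in> borel_measurable borel" "fourier f \<in> borel_measurable borel"
    using F hf by (simp_all add: has_fourier_def)
  have "AE \<omega> in lborel. F \<omega> = fourier f \<omega>" by (rule has_fourier_AE_unique[OF c F(1) hf])
  then have "integrable lborel (\<lambda>\<omega>. (1 + (norm \<omega>)\<^sup>2) powr k * (norm (fourier f \<omega>))\<^sup>2)"
    using F(2) by (subst integrable_cong_AE[of _ lborel "\<lambda>\<omega>. (1 + (norm \<omega>)\<^sup>2) powr k * (norm (F \<omega>))\<^sup>2"]) auto
  then show "weighted_L2 k (fourier f)" by (simp add: weighted_L2_def)
  show "sobolev_norm k f = weighted_norm k (fourier f)"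
    by (simp add: sobolev_norm_def sobolev_inner_def weighted_norm_def power2_norm_eq_inner)
qed

lemma sobolev_space_diff:
  fixes f g :: "('d::finite) vfield"
  assumes "f \<in> sobolev_space k" "g \<in> sobolev_space k"
  shows "(\<lambda>\<xi>. f \<xi> - g \<xi>) \<in> sobolev_space k"
proof -
  have c: "continuous_on UNIV f" "continuous_on UNIV g" using assms by (auto simp: sobolev_space_def)
  then have [measurable]: "f \<in> borel_measurable borel" "g \<in> borel_measurable borel"
    by (auto intro: borel_measurable_continuous_onI)
  note F = sobolev_space_fourier[OF assms(1)] and G = sobolev_space_fourier[OF assms(2)]
  have [measurable]: "fourier f \<in> borel_measurable borel" "fourier g \<in> borel_measurable borel"
    using F G by (simp_all add: has_fourier_def)
  have "integrable lborel (\<lambda>\<xi>. (norm (f \<xi> - g \<xi>))\<^sup>2)"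
    using integrable_weighted_diff[of f lborel g "\<lambda>_. 1"] assms by (simp add: sobolev_space_def)
  moreover have "integrable lborel (\<lambda>\<omega>. (1 + (norm \<omega>)\<^sup>2) powr k * (norm (fourier f \<omega> - fourier g \<omega>))\<^sup>2)"
    using F(2) G(2) by (intro integrable_weighted_diff) (auto simp: weighted_L2_def)
  ultimately show ?thesis
    unfolding sobolev_space_def
    using has_fourier_diff[OF c(1) F(1) c(2) G(1)] c by (auto intro!: continuous_intros)
qed

theorem sobolev_space_eval:
  fixes f :: "('d::finite) vfield"
  assumes k: "k > real CARD('d) / 2 + 4" and f: "f \<in> sobolev_space k"
  shows "f \<xi> $ j = symbol_fun (\<lambda>\<omega>. cis (\<omega> \<bullet> \<xi>)) j (fourier f)"
proof -
  note F = sobolev_space_fourier[OF f]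
  have "symbol_le (\<lambda>\<omega>::real^'d. 1) 1" by (simp add: symbol_le_def one_le_power)
  from symbol_fun_bound(1)[OF k F(2) this, of j]
  have "integrable lborel (\<lambda>\<omega>. fourier f \<omega> $ j)" by simp
  from fourier_inversion[OF _ _ F(1) this, of \<xi>] f
  have "complex_of_real (f \<xi> $ j) = complex_of_real ((2 * pi) powr (- (real CARD('d) / 2))) * (LINT \<omega>|lborel. cis (\<omega> \<bullet> \<xi>) * fourier f \<omega> $ j)"
    by (simp add: sobolev_space_def)
  from arg_cong[OF this, of Re] show ?thesis
    by (simp add: symbol_fun_def)
qed

section \<open>Plane waves as symbols\<close>

lemma cis_approx0: "norm (cis s - 1) \<le> \<bar>s\<bar>"
  using iexp_approx1[of s 0] by (simp add: cis_conv_exp)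

lemma cis_approx1: "norm (cis s - 1 - \<i> * s) \<le> s\<^sup>2"
proof -
  have "norm (cis s - 1 - \<i> * s) \<le> \<bar>s\<bar>\<^sup>2 / 2"
    using iexp_approx1[of s 1] by (simp add: cis_conv_exp power2_eq_square algebra_simps)
  also have "\<dots> \<le> s\<^sup>2" by simp
  finally show ?thesis .
qed

lemma cis_diff: "norm (cis s - cis t) \<le> \<bar>s - t\<bar>"
proof -
  have "cis s - cis t = cis t * (cis (s - t) - 1)" by (simp add: cis_mult right_diff_distrib)
  then show ?thesis using cis_approx0[of "s - t"] by (simp add: norm_mult)
qed

text \<open>The remainder \<open>cis s - 1 - \<i> s\<close> is locally Lipschitz with a constant
  that vanishes linearly at \<open>0\<close>.\<close>
lemma cis_remainder_diff:
  "norm ((cis s - 1 - \<i> * s) - (cis t - 1 - \<i> * t)) \<le> 2 * (\<bar>s\<bar> + \<bar>t\<bar>) * \<bar>s - t\<bar>"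
proof -
  have "(cis s - 1 - \<i> * s) - (cis t - 1 - \<i> * t)
     = cis t * (cis (s - t) - 1 - \<i> * (s - t)) + \<i> * (s - t) * (cis t - 1)"
    by (simp add: cis_mult algebra_simps)
  also have "norm \<dots> \<le> norm (cis t * (cis (s - t) - 1 - \<i> * (s - t))) + norm (\<i> * (s - t) * (cis t - 1))"
    by (rule norm_triangle_ineq)
  also have "\<dots> \<le> (s - t)\<^sup>2 + \<bar>s - t\<bar> * \<bar>t\<bar>"
    using cis_approx1[of "s - t"] mult_left_mono[OF cis_approx0[of t], of "\<bar>s - t\<bar>"]
    by (simp add: norm_mult flip: of_real_diff)
  also have "(s - t)\<^sup>2 = \<bar>s - t\<bar> * \<bar>s - t\<bar>" by (simp add: power2_eq_square)
  also have "\<bar>s - t\<bar> * \<bar>s - t\<bar> + \<bar>s - t\<bar> * \<bar>t\<bar> \<le> 2 * (\<bar>s\<bar> + \<bar>t\<bar>) * \<bar>s - t\<bar>"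
    using mult_left_mono[of "\<bar>s - t\<bar> + \<bar>t\<bar>" "2 * (\<bar>s\<bar> + \<bar>t\<bar>)" "\<bar>s - t\<bar>"] by (simp add: algebra_simps)
  finally show ?thesis .
qed

text \<open>A second order difference quotient at four points that need not form a parallelogram.
  The first term on the right measures the deviation from a parallelogram.\<close>
lemma cis_four_point:
  "norm (cis s - cis t - cis u + cis v) \<le> \<bar>s - t - u + v\<bar> + \<bar>s - t\<bar> * \<bar>t - v\<bar>"
proof -
  have "cis s - cis t - cis u + cis v
     = (cis t - cis v) * (cis (s - t) - 1) + cis v * (cis (s - t) - cis (u - v))"
    by (simp add: cis_mult algebra_simps)
  also have "norm \<dots> \<le> norm ((cis t - cis v) * (cis (s - t) - 1)) + norm (cis v * (cis (s - t) - cis (u - v)))"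
    by (rule norm_triangle_ineq)
  also have "\<dots> \<le> \<bar>t - v\<bar> * \<bar>s - t\<bar> + \<bar>s - t - (u - v)\<bar>"
    unfolding norm_mult using cis_diff[of t v] cis_approx0[of "s - t"] cis_diff[of "s - t" "u - v"]
    by (intro add_mono mult_mono) auto
  finally show ?thesis by (simp add: algebra_simps)
qed

lemma weight_powers:
  fixes r :: real
  assumes "r \<ge> 0"
  shows "1 \<le> (1 + r\<^sup>2)\<^sup>2" "r \<le> (1 + r\<^sup>2)\<^sup>2" "r\<^sup>2 \<le> (1 + r\<^sup>2)\<^sup>2" "r\<^sup>2 * r \<le> (1 + r\<^sup>2)\<^sup>2"
proof -
  have w1: "1 \<le> 1 + r\<^sup>2" "r\<^sup>2 \<le> 1 + r\<^sup>2" by auto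
  have w2: "r \<le> 1 + r\<^sup>2" using sum_squares_bound[of 1 r] assms by (simp add: power2_eq_square)
  have sq: "1 + r\<^sup>2 \<le> (1 + r\<^sup>2)\<^sup>2" using w1 by (intro self_le_power) auto
  show "1 \<le> (1 + r\<^sup>2)\<^sup>2" "r \<le> (1 + r\<^sup>2)\<^sup>2" "r\<^sup>2 \<le> (1 + r\<^sup>2)\<^sup>2"
    using w1 w2 sq by linarith+
  show "r\<^sup>2 * r \<le> (1 + r\<^sup>2)\<^sup>2"
    unfolding power2_eq_square[of "1 + r\<^sup>2"] using w1 w2 assms by (intro mult_mono) auto
qed

lemma symbol_leI:
  fixes m :: "real^'d::finite \<Rightarrow> complex"
  assumes "m \<in> borel_measurable borel" "c0 \<ge> 0" "c1 \<ge> 0" "c2 \<ge> 0" "c3 \<ge> 0"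
    and "\<And>\<omega>. norm (m \<omega>) \<le> c0 + c1 * norm \<omega> + c2 * (norm \<omega>)\<^sup>2 + c3 * ((norm \<omega>)\<^sup>2 * norm \<omega>)"
    and "c0 + c1 + c2 + c3 \<le> A"
  shows "symbol_le m A"
  unfolding symbol_le_def
proof (intro conjI allI assms(1))
  fix \<omega> :: "real^'d"
  let ?w = "(1 + (norm \<omega>)\<^sup>2)\<^sup>2"
  have "norm (m \<omega>) \<le> c0 + c1 * norm \<omega> + c2 * (norm \<omega>)\<^sup>2 + c3 * ((norm \<omega>)\<^sup>2 * norm \<omega>)" by fact
  also have "\<dots> \<le> c0 * ?w + c1 * ?w + c2 * ?w + c3 * ?w"
    using assms(2-5) weight_powers[of "norm \<omega>"] mult_left_mono[OF weight_powers(1)[of "norm \<omega>"], of c0]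
    by (intro add_mono mult_left_mono) auto
  also have "\<dots> = (c0 + c1 + c2 + c3) * ?w" by (simp add: algebra_simps)
  also have "\<dots> \<le> A * ?w" using assms(7) by (intro mult_right_mono) auto
  finally show "norm (m \<omega>) \<le> A * ?w" .
qed

text \<open>The symbol of evaluation at \<open>a\<close>; \<open>dwave v a\<close> below is the
  symbol of the derivative at \<open>a\<close> in direction \<open>v\<close>, and \<open>wave_rem a
  \<delta>\<close> that of the first order Taylor remainder.\<close>
definition wave :: "real^'d::finite \<Rightarrow> real^'d \<Rightarrow> complex" where
  "wave a \<omega> = cis (\<omega> \<bullet> a)"

definition dwave :: "real^'d::finite \<Rightarrow> real^'d \<Rightarrow> real^'d \<Rightarrow> complex" where
  "dwave v a \<omega> = \<i> * complex_of_real (\<omega> \<bullet> v) * cis (\<omega> \<bullet> a)"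

lemma wave_measurable [measurable]: "wave a \<in> borel_measurable borel" "dwave v a \<in> borel_measurable borel"
  unfolding wave_def[abs_def] dwave_def[abs_def] cis_conv_exp by measurable

lemma inner_le: "\<bar>\<omega> \<bullet> a\<bar> \<le> norm a * norm \<omega>"
  using Cauchy_Schwarz_ineq2[of \<omega> a] by (simp add: mult.commute)

lemma wave_le: "symbol_le (wave a) 1"
  by (rule symbol_leI[of _ 1 0 0 0]) (auto simp: wave_def)

lemma wave_diff_le: "symbol_le (\<lambda>\<omega>. wave a \<omega> - wave b \<omega>) (norm (a - b))"
proof (rule symbol_leI[of _ 0 "norm (a - b)" 0 0])
  fix \<omega>
  have "norm (wave a \<omega> - wave b \<omega>) \<le> \<bar>\<omega> \<bullet> (a - b)\<bar>"
    unfolding wave_def inner_diff_right by (rule cis_diff)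
  also have "\<dots> \<le> norm (a - b) * norm \<omega>" by (rule inner_le)
  finally show "norm (wave a \<omega> - wave b \<omega>) \<le> 0 + norm (a - b) * norm \<omega> + 0 * (norm \<omega>)\<^sup>2 + 0 * ((norm \<omega>)\<^sup>2 * norm \<omega>)" by simp
qed auto

lemma wave_four_point_norm:
  "norm (wave a \<omega> - wave b \<omega> - wave c \<omega> + wave d \<omega>)
    \<le> norm (a - b - c + d) * norm \<omega> + norm (a - b) * norm (b - d) * (norm \<omega>)\<^sup>2"
proof -
  have "norm (wave a \<omega> - wave b \<omega> - wave c \<omega> + wave d \<omega>)
    \<le> \<bar>\<omega> \<bullet> (a - b - c + d)\<bar> + \<bar>\<omega> \<bullet> (a - b)\<bar> * \<bar>\<omega> \<bullet> (b - d)\<bar>"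
    unfolding wave_def inner_diff_right inner_add_right by (rule cis_four_point)
  also have "\<dots> \<le> norm (a - b - c + d) * norm \<omega> + (norm (a - b) * norm \<omega>) * (norm (b - d) * norm \<omega>)"
    by (intro add_mono mult_mono inner_le) auto
  finally show ?thesis by (simp add: power2_eq_square mult_ac)
qed

lemma wave_four_point_le:
  "symbol_le (\<lambda>\<omega>. wave a \<omega> - wave b \<omega> - wave c \<omega> + wave d \<omega>) (norm (a - b - c + d) + norm (a - b) * norm (b - d))"
  by (rule symbol_leI[of _ 0 "norm (a - b - c + d)" "norm (a - b) * norm (b - d)" 0])
     (use wave_four_point_norm in auto)

lemma dwave_eq: "dwave v a \<omega> = \<i> * complex_of_real (\<omega> \<bullet> v) * wave a \<omega>"
  by (simp add: dwave_def wave_def)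

lemma dwave_le: "symbol_le (dwave v a) (norm v)"
  by (rule symbol_leI[of _ 0 "norm v" 0 0]) (auto simp: dwave_def norm_mult inner_le)

lemma dwave_diff_le: "symbol_le (\<lambda>\<omega>. dwave v a \<omega> - dwave v b \<omega>) (norm v * norm (a - b))"
proof (rule symbol_leI[of _ 0 0 "norm v * norm (a - b)" 0])
  fix \<omega>
  have "dwave v a \<omega> - dwave v b \<omega> = \<i> * complex_of_real (\<omega> \<bullet> v) * (cis (\<omega> \<bullet> a) - cis (\<omega> \<bullet> b))"
    by (simp add: dwave_def algebra_simps)
  then have "norm (dwave v a \<omega> - dwave v b \<omega>) \<le> \<bar>\<omega> \<bullet> v\<bar> * \<bar>\<omega> \<bullet> (a - b)\<bar>"
    using cis_diff[of "\<omega> \<bullet> a" "\<omega> \<bullet> b"] by (simp add: norm_mult inner_diff_right mult_left_mono)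
  also have "\<dots> \<le> (norm v * norm \<omega>) * (norm (a - b) * norm \<omega>)"
    by (intro mult_mono inner_le) auto
  finally show "norm (dwave v a \<omega> - dwave v b \<omega>) \<le> 0 + 0 * norm \<omega> + norm v * norm (a - b) * (norm \<omega>)\<^sup>2 + 0 * ((norm \<omega>)\<^sup>2 * norm \<omega>)"
    by (simp add: power2_eq_square mult_ac)
qed auto

lemma dwave_four_point_le:
  "symbol_le (\<lambda>\<omega>. dwave v a \<omega> - dwave v b \<omega> - dwave v c \<omega> + dwave v d \<omega>)
     (norm v * (norm (a - b - c + d) + norm (a - b) * norm (b - d)))"
proof (rule symbol_leI[of _ 0 0 "norm v * norm (a - b - c + d)" "norm v * (norm (a - b) * norm (b - d))"])
  fix \<omega>
  have "dwave v a \<omega> - dwave v b \<omega> - dwave v c \<omega> + dwave v d \<omega>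
     = \<i> * complex_of_real (\<omega> \<bullet> v) * (wave a \<omega> - wave b \<omega> - wave c \<omega> + wave d \<omega>)"
    by (simp add: dwave_eq algebra_simps)
  then have "norm (dwave v a \<omega> - dwave v b \<omega> - dwave v c \<omega> + dwave v d \<omega>)
     = \<bar>\<omega> \<bullet> v\<bar> * norm (wave a \<omega> - wave b \<omega> - wave c \<omega> + wave d \<omega>)"
    by (simp add: norm_mult)
  also have "\<dots> \<le> (norm v * norm \<omega>) * (norm (a - b - c + d) * norm \<omega> + norm (a - b) * norm (b - d) * (norm \<omega>)\<^sup>2)"
    by (intro mult_mono inner_le wave_four_point_norm) auto
  finally show "norm (dwave v a \<omega> - dwave v b \<omega> - dwave v c \<omega> + dwave v d \<omega>)
     \<le> 0 + 0 * norm \<omega> + norm v * norm (a - b - c + d) * (norm \<omega>)\<^sup>2 + norm v * (norm (a - b) * norm (b - d)) * ((norm \<omega>)\<^sup>2 * norm \<omega>)"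
    by (simp add: power2_eq_square algebra_simps)
qed (auto simp: algebra_simps)

definition wave_rem :: "real^'d::finite \<Rightarrow> real^'d \<Rightarrow> real^'d \<Rightarrow> complex" where
  "wave_rem a \<delta> \<omega> = wave (a + \<delta>) \<omega> - wave a \<omega> - dwave \<delta> a \<omega>"

lemma wave_rem_eq: "wave_rem a \<delta> \<omega> = cis (\<omega> \<bullet> a) * (cis (\<omega> \<bullet> \<delta>) - 1 - \<i> * complex_of_real (\<omega> \<bullet> \<delta>))"
  by (simp add: wave_rem_def wave_def dwave_def inner_add_right cis_mult algebra_simps)

lemma wave_rem_measurable [measurable]: "wave_rem a \<delta> \<in> borel_measurable borel"
  unfolding wave_rem_def[abs_def] by measurable

lemma inner_sq_le: "(\<omega> \<bullet> a)\<^sup>2 \<le> (norm a)\<^sup>2 * (norm \<omega>)\<^sup>2"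
  using inner_le[of \<omega> a] by (metis abs_ge_zero power2_abs power_mono power_mult_distrib)

lemma wave_rem_le: "symbol_le (wave_rem a \<delta>) ((norm \<delta>)\<^sup>2)"
proof (rule symbol_leI[of _ 0 0 "(norm \<delta>)\<^sup>2" 0])
  fix \<omega>
  have "norm (wave_rem a \<delta> \<omega>) \<le> (\<omega> \<bullet> \<delta>)\<^sup>2"
    unfolding wave_rem_eq norm_mult using cis_approx1 by simp
  also have "\<dots> \<le> (norm \<delta>)\<^sup>2 * (norm \<omega>)\<^sup>2" by (rule inner_sq_le)
  finally show "norm (wave_rem a \<delta> \<omega>) \<le> 0 + 0 * norm \<omega> + (norm \<delta>)\<^sup>2 * (norm \<omega>)\<^sup>2 + 0 * ((norm \<omega>)\<^sup>2 * norm \<omega>)" by simp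
qed auto

text \<open>The third order term comes from moving the base point of a quadratic remainder. It is
  the reason why three derivatives are needed for the Lipschitz estimate of the defect of the Euler
  maps.\<close>
lemma wave_rem_diff_le:
  "symbol_le (\<lambda>\<omega>. wave_rem a \<delta> \<omega> - wave_rem b \<epsilon> \<omega>)
     ((norm \<delta>)\<^sup>2 * norm (a - b) + 2 * (norm \<delta> + norm \<epsilon>) * norm (\<delta> - \<epsilon>))"
proof (rule symbol_leI[of _ 0 0 "2 * (norm \<delta> + norm \<epsilon>) * norm (\<delta> - \<epsilon>)" "(norm \<delta>)\<^sup>2 * norm (a - b)"])
  fix \<omega>
  let ?\<rho> = "\<lambda>s. cis s - 1 - \<i> * complex_of_real s"
  have "wave_rem a \<delta> \<omega> - wave_rem b \<epsilon> \<omega> = (cis (\<omega> \<bullet> a) - cis (\<omega> \<bullet> b)) * ?\<rho> (\<omega> \<bullet> \<delta>) + cis (\<omega> \<bullet> b) * (?\<rho> (\<omega> \<bullet> \<delta>) - ?\<rho> (\<omega> \<bullet> \<epsilon>))"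
    unfolding wave_rem_eq by (simp add: algebra_simps)
  also have "norm \<dots> \<le> norm (cis (\<omega> \<bullet> a) - cis (\<omega> \<bullet> b)) * norm (?\<rho> (\<omega> \<bullet> \<delta>)) + norm (?\<rho> (\<omega> \<bullet> \<delta>) - ?\<rho> (\<omega> \<bullet> \<epsilon>))"
    using norm_triangle_ineq[of "(cis (\<omega> \<bullet> a) - cis (\<omega> \<bullet> b)) * ?\<rho> (\<omega> \<bullet> \<delta>)" "cis (\<omega> \<bullet> b) * (?\<rho> (\<omega> \<bullet> \<delta>) - ?\<rho> (\<omega> \<bullet> \<epsilon>))"] by (simp add: norm_mult)
  also have "\<dots> \<le> \<bar>\<omega> \<bullet> (a - b)\<bar> * (\<omega> \<bullet> \<delta>)\<^sup>2 + 2 * (\<bar>\<omega> \<bullet> \<delta>\<bar> + \<bar>\<omega> \<bullet> \<epsilon>\<bar>) * \<bar>\<omega> \<bullet> (\<delta> - \<epsilon>)\<bar>"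
    unfolding inner_diff_right by (intro add_mono mult_mono cis_diff cis_approx1 cis_remainder_diff) auto
  also have "\<dots> \<le> (norm (a - b) * norm \<omega>) * ((norm \<delta>)\<^sup>2 * (norm \<omega>)\<^sup>2) + 2 * (norm \<delta> * norm \<omega> + norm \<epsilon> * norm \<omega>) * (norm (\<delta> - \<epsilon>) * norm \<omega>)"
    by (intro add_mono mult_mono inner_le inner_sq_le) auto
  finally show "norm (wave_rem a \<delta> \<omega> - wave_rem b \<epsilon> \<omega>) \<le> 0 + 0 * norm \<omega> + 2 * (norm \<delta> + norm \<epsilon>) * norm (\<delta> - \<epsilon>) * (norm \<omega>)\<^sup>2 + (norm \<delta>)\<^sup>2 * norm (a - b) * ((norm \<omega>)\<^sup>2 * norm \<omega>)"
    by (simp add: power2_eq_square algebra_simps)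
qed auto

section \<open>Regularity of Sobolev fields\<close>

lemma symbol_le_diff:
  assumes "symbol_le m A" "symbol_le m' A'"
  shows "symbol_le (\<lambda>\<omega>. m \<omega> - m' \<omega>) (A + A')"
  unfolding symbol_le_def
proof (intro conjI allI)
  have [measurable]: "m \<in> borel_measurable borel" "m' \<in> borel_measurable borel" using assms by (auto simp: symbol_le_def)
  show "(\<lambda>\<omega>. m \<omega> - m' \<omega>) \<in> borel_measurable borel" by measurable
  fix \<omega> :: "real^'a"
  show "norm (m \<omega> - m' \<omega>) \<le> (A + A') * (1 + (norm \<omega>)\<^sup>2)\<^sup>2"
    using norm_triangle_ineq4[of "m \<omega>" "m' \<omega>"] assms unfolding symbol_le_def distrib_right
    by (meson add_mono order_trans)
qed

lemma symbol_le_add: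
  assumes "symbol_le m A" "symbol_le m' A'"
  shows "symbol_le (\<lambda>\<omega>. m \<omega> + m' \<omega>) (A + A')"
  unfolding symbol_le_def
proof (intro conjI allI)
  have [measurable]: "m \<in> borel_measurable borel" "m' \<in> borel_measurable borel" using assms by (auto simp: symbol_le_def)
  show "(\<lambda>\<omega>. m \<omega> + m' \<omega>) \<in> borel_measurable borel" by measurable
  fix \<omega> :: "real^'a"
  show "norm (m \<omega> + m' \<omega>) \<le> (A + A') * (1 + (norm \<omega>)\<^sup>2)\<^sup>2"
    using norm_triangle_ineq[of "m \<omega>" "m' \<omega>"] assms unfolding symbol_le_def distrib_right
    by (meson add_mono order_trans)
qed

text \<open>The third clause is the substitute for a Lipschitz derivative. It is formulated with
  values only, so it is stable under pointwise limits and needs no derivative of the field.\<close>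
definition tame :: "real \<Rightarrow> ('a::real_normed_vector \<Rightarrow> 'b::real_normed_vector) \<Rightarrow> bool" where
  "tame M g \<longleftrightarrow> (\<forall>a. norm (g a) \<le> M) \<and> (\<forall>a b. norm (g a - g b) \<le> M * norm (a - b)) \<and>
     (\<forall>a b c d. norm (g a - g b - g c + g d) \<le> M * (norm (a - b - c + d) + norm (a - b) * norm (b - d)))"

lemma tame_mono: "tame M g \<Longrightarrow> M \<le> N \<Longrightarrow> tame N g"
  unfolding tame_def
  by (meson add_nonneg_nonneg mult_nonneg_nonneg mult_right_mono norm_ge_zero order_trans)

lemma tame_limit:
  assumes g: "\<And>n::nat. tame (M n) (g n)" and M: "M \<longlonglongrightarrow> m" and lim: "\<And>a. (\<lambda>n. g n a) \<longlonglongrightarrow> h a"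
  shows "tame m h"
  unfolding tame_def
proof (intro conjI allI)
  show "norm (h a) \<le> m" for a
    by (rule LIMSEQ_le[OF tendsto_norm[OF lim] M]) (use g in \<open>auto simp: tame_def\<close>)
  show "norm (h a - h b) \<le> m * norm (a - b)" for a b
    by (rule LIMSEQ_le[OF tendsto_norm[OF tendsto_diff[OF lim lim]] tendsto_mult_right[OF M]]) (use g in \<open>auto simp: tame_def\<close>)
  show "norm (h a - h b - h c + h d) \<le> m * (norm (a - b - c + d) + norm (a - b) * norm (b - d))" for a b c d
    by (rule LIMSEQ_le[OF tendsto_norm[OF tendsto_add[OF tendsto_diff[OF tendsto_diff[OF lim lim] lim] lim]] tendsto_mult_right[OF M]])
       (use g in \<open>auto simp: tame_def\<close>)
qed

lemma norm_le_components:
  fixes v :: "real^'d::finite"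
  assumes "\<And>j. \<bar>v $ j\<bar> \<le> B"
  shows "norm v \<le> real CARD('d) * B"
proof -
  have "norm v \<le> (\<Sum>j\<in>UNIV. \<bar>v $ j\<bar>)" by (rule norm_le_l1_cart)
  also have "\<dots> \<le> (\<Sum>j\<in>(UNIV::'d set). B)" by (intro sum_mono assms)
  finally show ?thesis by simp
qed

lemma tame_componentwise:
  fixes g :: "'a::real_normed_vector \<Rightarrow> real^'d::finite"
  assumes "\<And>j. tame M (\<lambda>a. g a $ j)"
  shows "tame (real CARD('d) * M) g"
  unfolding tame_def mult.assoc
  using assms by (intro conjI allI norm_le_components) (auto simp: tame_def)

lemma tame_sum:
  assumes "finite I" "\<And>i. i \<in> I \<Longrightarrow> tame (M i) (g i)"
  shows "tame (\<Sum>i\<in>I. M i) (\<lambda>a. \<Sum>i\<in>I. g i a)"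
  unfolding tame_def
proof (intro conjI allI)
  show "norm (\<Sum>i\<in>I. g i a) \<le> sum M I" for a
    by (rule sum_norm_le) (use assms in \<open>auto simp: tame_def\<close>)
  show "norm ((\<Sum>i\<in>I. g i a) - (\<Sum>i\<in>I. g i b)) \<le> sum M I * norm (a - b)" for a b
    unfolding sum_subtractf[symmetric] sum_distrib_right
    by (rule sum_norm_le) (use assms in \<open>auto simp: tame_def\<close>)
  show "norm ((\<Sum>i\<in>I. g i a) - (\<Sum>i\<in>I. g i b) - (\<Sum>i\<in>I. g i c) + (\<Sum>i\<in>I. g i d))
     \<le> sum M I * (norm (a - b - c + d) + norm (a - b) * norm (b - d))" for a b c d
    unfolding sum_subtractf[symmetric] sum.distrib[symmetric] sum_distrib_right
    by (rule sum_norm_le) (use assms in \<open>auto simp: tame_def\<close>)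
qed

text \<open>A field with Lipschitz derivative \<open>D\<close>, with all constants measured by
  \<open>M\<close>. In the last clause the Taylor remainder moves by an amount quadratic in the
  increment when the base point moves, and linear in the increments when they move.\<close>
definition regular_field :: "real \<Rightarrow> (real^'d::finite \<Rightarrow> real^'d) \<Rightarrow> (real^'d \<Rightarrow> real^'d \<Rightarrow> real^'d) \<Rightarrow> bool" where
  "regular_field M f D \<longleftrightarrow> tame M f \<and> (\<forall>\<xi>. linear (D \<xi>)) \<and> (\<forall>\<xi> v. norm (D \<xi> v) \<le> M * norm v) \<and>
     (\<forall>a b v. norm (D a v - D b v) \<le> M * norm (a - b) * norm v) \<and>
     (\<forall>\<xi> \<delta>. norm (f (\<xi> + \<delta>) - f \<xi> - D \<xi> \<delta>) \<le> M * (norm \<delta>)\<^sup>2) \<and>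
     (\<forall>\<xi> \<eta> \<delta> \<epsilon>. norm ((f (\<xi> + \<delta>) - f \<xi> - D \<xi> \<delta>) - (f (\<eta> + \<epsilon>) - f \<eta> - D \<eta> \<epsilon>))
        \<le> M * ((norm \<delta>)\<^sup>2 * norm (\<xi> - \<eta>) + 2 * (norm \<delta> + norm \<epsilon>) * norm (\<delta> - \<epsilon>)))"

lemma quadratic_has_derivative:
  fixes f :: "'a::euclidean_space \<Rightarrow> 'b::real_normed_vector"
  assumes lin: "linear D" and q: "\<And>\<delta>. norm (f (\<xi> + \<delta>) - f \<xi> - D \<delta>) \<le> M * (norm \<delta>)\<^sup>2"
  shows "(f has_derivative D) (at \<xi>)"
proof (rule has_derivativeI_sandwich[of 1])
  show "bounded_linear D" using lin by (rule linear_conv_bounded_linear[THEN iffD1])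
  show "norm (f y - f \<xi> - D (y - \<xi>)) / norm (y - \<xi>) \<le> M * norm (y - \<xi>)" if "y \<noteq> \<xi>" for y
    using q[of "y - \<xi>"] that by (simp add: divide_le_eq power2_eq_square mult_ac)
  have "((\<lambda>y. M * norm (y - \<xi>)) \<longlongrightarrow> M * norm (\<xi> - \<xi>)) (at \<xi>)"
    by (intro tendsto_intros)
  then show "((\<lambda>y. M * norm (y - \<xi>)) \<longlongrightarrow> 0) (at \<xi>)" by simp
qed simp

lemma regular_field_has_derivative:
  "regular_field M f D \<Longrightarrow> (f has_derivative D \<xi>) (at \<xi>)"
  by (rule quadratic_has_derivative[of _ _ _ M]) (auto simp: regular_field_def)

text \<open>Every clause of \<open>regular_field\<close> is a bound for a functional with an
  explicit symbol, treated in each component.\<close>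
lemma sobolev_regular_field:
  fixes f :: "('d::finite) vfield"
  assumes k: "k > real CARD('d) / 2 + 4" and f: "f \<in> sobolev_space k"
  shows "\<exists>D. regular_field (real CARD('d) * (symbol_const TYPE('d) k * sobolev_norm k f)) f D"
proof -
  note F = sobolev_space_fourier[OF f]
  let ?K = "symbol_const TYPE('d) k * sobolev_norm k f"
  let ?l = "\<lambda>m j. symbol_fun m j (fourier f)"
  define D where "D = (\<lambda>\<xi> v. \<chi> j. ?l (dwave v \<xi>) j)"
  have f_eq: "f \<xi> $ j = ?l (wave \<xi>) j" for \<xi> j
    using sobolev_space_eval[OF k f] by (simp add: wave_def[abs_def])
  have bound: "symbol_le m A \<Longrightarrow> \<bar>?l m j\<bar> \<le> ?K * A" for m A j
    using symbol_fun_bound(2)[OF k F(2), of m A j] F(3) by (simp add: mult_ac)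
  note ld = symbol_fun_diff[OF k F(2)] and la = symbol_fun_add[OF k F(2)]
  have f2: "f a $ j - f b $ j = ?l (\<lambda>\<omega>. wave a \<omega> - wave b \<omega>) j" for a b j
    by (simp add: f_eq ld[OF wave_le wave_le])
  have f4: "f a $ j - f b $ j - f c $ j + f d $ j = ?l (\<lambda>\<omega>. wave a \<omega> - wave b \<omega> - wave c \<omega> + wave d \<omega>) j" for a b c d j
    by (simp add: f_eq ld[OF wave_le wave_le] ld[OF wave_diff_le wave_le] la[OF symbol_le_diff[OF wave_diff_le wave_le] wave_le])
  have tame: "tame (real CARD('d) * ?K) f"
  proof (rule tame_componentwise)
    fix j
    show "tame ?K (\<lambda>a. f a $ j)"
      unfolding tame_def real_norm_def
    proof (intro conjI allI)
      show "\<bar>f a $ j\<bar> \<le> ?K" for a using bound[OF wave_le] by (simp add: f_eq)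
      show "\<bar>f a $ j - f b $ j\<bar> \<le> ?K * norm (a - b)" for a b
        by (subst f2) (rule bound[OF wave_diff_le])
      show "\<bar>f a $ j - f b $ j - f c $ j + f d $ j\<bar> \<le> ?K * (norm (a - b - c + d) + norm (a - b) * norm (b - d))" for a b c d
        by (subst f4) (rule bound[OF wave_four_point_le])
    qed
  qed
  have lin: "linear (D \<xi>)" for \<xi>
  proof (rule linearI)
    fix v w :: "real^'d" and r :: real
    have "dwave (v + w) \<xi> = (\<lambda>\<omega>. dwave v \<xi> \<omega> + dwave w \<xi> \<omega>)"
      by (simp add: dwave_def[abs_def] inner_add_right algebra_simps)
    then show "D \<xi> (v + w) = D \<xi> v + D \<xi> w"
      by (simp add: D_def vec_eq_iff la[OF dwave_le dwave_le])
    have "dwave (r *\<^sub>R v) \<xi> = (\<lambda>\<omega>. complex_of_real r * dwave v \<xi> \<omega>)"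
      by (simp add: dwave_def[abs_def] algebra_simps)
    then show "D \<xi> (r *\<^sub>R v) = r *\<^sub>R D \<xi> v"
      by (simp add: D_def vec_eq_iff symbol_fun_scale)
  qed
  have rem: "(f (\<xi> + \<delta>) - f \<xi> - D \<xi> \<delta>) $ j = ?l (wave_rem \<xi> \<delta>) j" for \<xi> \<delta> j
    by (simp add: f_eq D_def wave_rem_def[abs_def] ld[OF wave_le wave_le] ld[OF wave_diff_le dwave_le])
  have "regular_field (real CARD('d) * ?K) f D"
    unfolding regular_field_def
  proof (intro conjI allI tame lin, unfold mult.assoc)
    fix \<xi> \<eta> v \<delta> \<epsilon> :: "real^'d"
    show "norm (D \<xi> v) \<le> real CARD('d) * (symbol_const TYPE('d) k * (sobolev_norm k f * norm v))"
      by (rule norm_le_components) (use bound[OF dwave_le] in \<open>simp add: D_def mult.assoc\<close>)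
    show "norm (D \<xi> v - D \<eta> v) \<le> real CARD('d) * (symbol_const TYPE('d) k * (sobolev_norm k f * (norm (\<xi> - \<eta>) * norm v)))"
    proof (rule norm_le_components)
      fix j
      show "\<bar>(D \<xi> v - D \<eta> v) $ j\<bar> \<le> symbol_const TYPE('d) k * (sobolev_norm k f * (norm (\<xi> - \<eta>) * norm v))"
        using bound[OF dwave_diff_le[of v \<xi> \<eta>], of j] by (simp add: D_def ld[OF dwave_le dwave_le] mult_ac)
    qed
    show "norm (f (\<xi> + \<delta>) - f \<xi> - D \<xi> \<delta>) \<le> real CARD('d) * (symbol_const TYPE('d) k * (sobolev_norm k f * (norm \<delta>)\<^sup>2))"
      by (rule norm_le_components, unfold rem) (use bound[OF wave_rem_le] in \<open>simp add: mult.assoc\<close>)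
    show "norm ((f (\<xi> + \<delta>) - f \<xi> - D \<xi> \<delta>) - (f (\<eta> + \<epsilon>) - f \<eta> - D \<eta> \<epsilon>))
        \<le> real CARD('d) * (symbol_const TYPE('d) k * (sobolev_norm k f * ((norm \<delta>)\<^sup>2 * norm (\<xi> - \<eta>) + 2 * ((norm \<delta> + norm \<epsilon>) * norm (\<delta> - \<epsilon>)))))"
    proof (rule norm_le_components, subst vector_minus_component, unfold rem)
      fix j
      show "\<bar>?l (wave_rem \<xi> \<delta>) j - ?l (wave_rem \<eta> \<epsilon>) j\<bar>
        \<le> symbol_const TYPE('d) k * (sobolev_norm k f * ((norm \<delta>)\<^sup>2 * norm (\<xi> - \<eta>) + 2 * ((norm \<delta> + norm \<epsilon>) * norm (\<delta> - \<epsilon>))))"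
        using bound[OF wave_rem_diff_le[of \<xi> \<delta> \<eta> \<epsilon>], of j]
          unfolding ld[OF wave_rem_le wave_rem_le] mult.assoc .
    qed
  qed
  then show ?thesis by blast
qed


section \<open>Regularity of tensors\<close>

text \<open>The Schatten norms dominate the operator norm, the quantity that controls bilinear
  evaluations.\<close>
lemma lq_norm_ge:
  assumes q: "1 \<le> q" and \<sigma>: "\<And>i. i < m \<Longrightarrow> 0 < \<sigma> i" and i: "i < m"
  shows "\<sigma> i \<le> lq_norm q m \<sigma>"
proof (cases "q = \<infinity>")
  case True
  then show ?thesis using i by (auto simp: lq_norm_def intro!: Max_ge)
next
  case False
  then obtain r where r: "q = ereal r" using q by (cases q) auto
  then have r1: "r \<ge> 1" using q by simp
  have "\<sigma> i powr r \<le> (\<Sum>i<m. \<sigma> i powr r)"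
    using i by (intro member_le_sum) auto
  then have "(\<sigma> i powr r) powr (1 / r) \<le> (\<Sum>i<m. \<sigma> i powr r) powr (1 / r)"
    using r1 by (intro powr_mono2) auto
  moreover have "(\<sigma> i powr r) powr (1 / r) = \<sigma> i"
    using r1 \<sigma>[OF i] by (simp add: powr_powr)
  ultimately show ?thesis using False r by (simp add: lq_norm_def)
qed

lemma lq_norm_nonneg: "0 \<le> lq_norm q m \<sigma>"
  by (auto simp: lq_norm_def intro!: Max_ge)

text \<open>The tensor with singular value decomposition \<open>\<Sum>i. \<sigma>\<^sub>i u\<^sub>i
  \<otimes> v\<^sub>i\<close>, with the functional of symbol \<open>m\<close> applied to the first
  factor (component \<open>\<mu>\<close>) and that of symbol \<open>m'\<close> to the second
  (component \<open>\<nu>\<close>).\<close>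
definition svd_form :: "nat \<Rightarrow> (nat \<Rightarrow> real) \<Rightarrow> (nat \<Rightarrow> 'd vfield) \<Rightarrow> (nat \<Rightarrow> 'd vfield) \<Rightarrow> 'd \<Rightarrow> 'd \<Rightarrow>
    (real^'d::finite \<Rightarrow> complex) \<Rightarrow> (real^'d \<Rightarrow> complex) \<Rightarrow> real" where
  "svd_form n \<sigma> u v \<mu> \<nu> m m' =
     (\<Sum>i<n. \<sigma> i * (symbol_fun m \<mu> (fourier (u i)) * symbol_fun m' \<nu> (fourier (v i))))"

text \<open>Cauchy-Schwarz over the singular values, and Bessel's inequality for each of the two
  orthonormal families. The bound does not see the rank.\<close>
lemma svd_form_bound:
  fixes u v :: "nat \<Rightarrow> ('d::finite) vfield"
  assumes k: "k > real CARD('d) / 2 + 4"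
    and u: "orthonormal_family k n u" and v: "orthonormal_family k n v"
    and \<sigma>: "\<And>i. i < n \<Longrightarrow> 0 < \<sigma> i" "\<And>i. i < n \<Longrightarrow> \<sigma> i \<le> \<rho>" and \<rho>: "0 \<le> \<rho>"
    and m: "symbol_le m A" and m': "symbol_le m' A'"
  shows "\<bar>svd_form n \<sigma> u v \<mu> \<nu> m m'\<bar> \<le> (symbol_const TYPE('d) k)\<^sup>2 * \<rho> * (A * A')"
proof -
  let ?S = "symbol_const TYPE('d) k"
  have ip: "(\<Sum>i<n. (symbol_fun m j (fourier (w i)))\<^sup>2) \<le> (A * ?S)\<^sup>2"
    if w: "orthonormal_family k n w" and m: "symbol_le m A" for w :: "nat \<Rightarrow> 'd vfield" and m A j
  proof (rule symbol_fun_bessel[OF k _ _ m])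
    show "weighted_L2 k (fourier (w i))" if "i < n" for i
      using w that by (intro sobolev_space_fourier) (auto simp: orthonormal_family_def)
    show "(LINT \<omega>|lborel. (1 + (norm \<omega>)\<^sup>2) powr k * (fourier (w i) \<omega> \<bullet> fourier (w j) \<omega>)) = (if i = j then 1 else 0)"
      if "i < n" "j < n" for i j
      using w that by (auto simp: orthonormal_family_def sobolev_inner_def)
  qed
  let ?p = "\<lambda>i. symbol_fun m \<mu> (fourier (u i))" and ?q = "\<lambda>i. symbol_fun m' \<nu> (fourier (v i))"
  have "\<bar>svd_form n \<sigma> u v \<mu> \<nu> m m'\<bar> \<le> (\<Sum>i<n. \<bar>\<sigma> i * (?p i * ?q i)\<bar>)"
    unfolding svd_form_def by (rule sum_abs)
  also have "\<dots> \<le> (\<Sum>i<n. \<rho> * (\<bar>?p i\<bar> * \<bar>?q i\<bar>))"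
    using \<sigma> by (intro sum_mono) (auto simp: abs_mult less_imp_le intro!: mult_right_mono)
  also have "\<dots> = \<rho> * (\<Sum>i<n. \<bar>?p i\<bar> * \<bar>?q i\<bar>)" by (simp add: sum_distrib_left)
  also have "\<dots> \<le> \<rho> * (L2_set ?p {..<n} * L2_set ?q {..<n})"
    by (intro mult_left_mono L2_set_mult_ineq \<rho>)
  also have "\<dots> \<le> \<rho> * ((A * ?S) * (A' * ?S))"
  proof (intro mult_left_mono mult_mono \<rho>)
    have 0: "0 \<le> A * ?S" "0 \<le> A' * ?S"
      using symbol_le_nonneg[OF m] symbol_le_nonneg[OF m'] symbol_const_nonneg by (auto intro!: mult_nonneg_nonneg)
    show "L2_set ?p {..<n} \<le> A * ?S" "L2_set ?q {..<n} \<le> A' * ?S"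
      unfolding L2_set_def using ip[OF u m] ip[OF v m'] 0 by (auto intro!: real_le_lsqrt sum_nonneg)
    show "0 \<le> A * ?S" by fact
  qed auto
  also have "\<dots> = ?S\<^sup>2 * \<rho> * (A * A')" by (simp add: power2_eq_square mult_ac)
  finally show ?thesis .
qed

text \<open>\<open>G \<mu> \<nu> \<xi> \<zeta>\<close> is the gradient of the entry \<open>\<mu>
  \<nu>\<close> in the second variable. Tameness is only asked on the diagonal, where the driver
  evaluates it. The quadratic Taylor estimate determines \<open>G\<close> and passes to pointwise
  limits.\<close>
definition regular_tensor :: "real \<Rightarrow> ('d::finite) mfield \<Rightarrow> ('d \<Rightarrow> 'd \<Rightarrow> real^'d \<Rightarrow> real^'d \<Rightarrow> real^'d) \<Rightarrow> bool" where
  "regular_tensor M a G \<longleftrightarrow>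
     (\<forall>\<mu> \<nu> \<xi> \<zeta> \<delta>. \<bar>a \<xi> (\<zeta> + \<delta>) $ \<mu> $ \<nu> - a \<xi> \<zeta> $ \<mu> $ \<nu> - G \<mu> \<nu> \<xi> \<zeta> \<bullet> \<delta>\<bar> \<le> M * (norm \<delta>)\<^sup>2) \<and>
     (\<forall>\<mu> \<nu> \<xi> \<zeta> \<kappa>. \<bar>G \<mu> \<nu> \<xi> \<zeta> $ \<kappa>\<bar> \<le> M) \<and>
     (\<forall>\<mu> \<nu> \<kappa>. tame M (\<lambda>\<xi>. G \<mu> \<nu> \<xi> \<xi> $ \<kappa>))"

lemma linear_quadratic_zero:
  fixes g :: "'a::real_inner"
  assumes "\<And>\<delta>. \<bar>g \<bullet> \<delta>\<bar> \<le> M * (norm \<delta>)\<^sup>2"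
  shows "g = 0"
proof (rule ccontr)
  assume g: "g \<noteq> 0"
  \<comment> \<open>At \<open>\<delta> = r g\<close> the quadratic bound is at most half of the linear term.\<close>
  define r where "r = 1 / (2 * (\<bar>M\<bar> + 1))"
  have r: "r > 0" "(\<bar>M\<bar> + 1) * r = 1 / 2" by (auto simp: r_def)
  have n: "(norm g)\<^sup>2 > 0" using g by simp
  have "r * (norm g)\<^sup>2 = \<bar>g \<bullet> (r *\<^sub>R g)\<bar>" using r by (simp add: power2_norm_eq_inner)
  also have "\<dots> \<le> M * (norm (r *\<^sub>R g))\<^sup>2" by (rule assms)
  also have "\<dots> \<le> (\<bar>M\<bar> + 1) * (norm (r *\<^sub>R g))\<^sup>2" by (intro mult_right_mono) auto
  also have "\<dots> = ((\<bar>M\<bar> + 1) * r) * (r * (norm g)\<^sup>2)" using r(1) by (simp add: power2_eq_square algebra_simps)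
  also have "\<dots> = (r * (norm g)\<^sup>2) / 2" by (simp add: r(2))
  finally show False using r n by simp
qed

text \<open>The decomposition of a difference of two algebraic tensors is unrelated to those of the
  tensors. Uniqueness of the gradient still identifies the gradient of the difference.\<close>
lemma regular_tensor_diff_unique:
  assumes a: "regular_tensor M a G" and b: "regular_tensor N b H"
    and c: "regular_tensor L (\<lambda>\<xi> \<zeta>. a \<xi> \<zeta> - b \<xi> \<zeta>) J"
  shows "J \<mu> \<nu> \<xi> \<zeta> = G \<mu> \<nu> \<xi> \<zeta> - H \<mu> \<nu> \<xi> \<zeta>"
proof -
  have "G \<mu> \<nu> \<xi> \<zeta> - H \<mu> \<nu> \<xi> \<zeta> - J \<mu> \<nu> \<xi> \<zeta> = 0"
  proof (rule linear_quadratic_zero[of _ "M + N + L"])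
    fix \<delta>
    have 1: "\<bar>a \<xi> (\<zeta> + \<delta>) $ \<mu> $ \<nu> - a \<xi> \<zeta> $ \<mu> $ \<nu> - G \<mu> \<nu> \<xi> \<zeta> \<bullet> \<delta>\<bar> \<le> M * (norm \<delta>)\<^sup>2"
      and 2: "\<bar>b \<xi> (\<zeta> + \<delta>) $ \<mu> $ \<nu> - b \<xi> \<zeta> $ \<mu> $ \<nu> - H \<mu> \<nu> \<xi> \<zeta> \<bullet> \<delta>\<bar> \<le> N * (norm \<delta>)\<^sup>2"
      and 3: "\<bar>(a \<xi> (\<zeta> + \<delta>) - b \<xi> (\<zeta> + \<delta>)) $ \<mu> $ \<nu> - (a \<xi> \<zeta> - b \<xi> \<zeta>) $ \<mu> $ \<nu> - J \<mu> \<nu> \<xi> \<zeta> \<bullet> \<delta>\<bar> \<le> L * (norm \<delta>)\<^sup>2"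
      using a b c unfolding regular_tensor_def by auto
    show "\<bar>(G \<mu> \<nu> \<xi> \<zeta> - H \<mu> \<nu> \<xi> \<zeta> - J \<mu> \<nu> \<xi> \<zeta>) \<bullet> \<delta>\<bar> \<le> (M + N + L) * (norm \<delta>)\<^sup>2"
      using 1 2 3 unfolding distrib_right inner_diff_left vector_minus_component by linarith
  qed
  then show ?thesis by simp
qed

text \<open>Evaluation, gradient and Taylor remainder of an algebraic tensor are values of
  \<open>svd_form\<close> at symbols of plane waves. On the diagonal both arguments move, and the
  differences are expanded by the product rule.\<close>
lemma schatten_regular_tensor:
  fixes a :: "('d::finite) mfield"
  assumes k: "k > real CARD('d) / 2 + 4" and q: "1 \<le> q" and a: "has_schatten_norm q k a \<rho>"
  shows "\<exists>G. regular_tensor (6 * (symbol_const TYPE('d) k)\<^sup>2 * \<rho>) a G" and "0 \<le> \<rho>"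
proof -
  obtain n \<sigma> u v where \<sigma>: "\<And>i. i < n \<Longrightarrow> 0 < \<sigma> i" and u: "orthonormal_family k n u" and v: "orthonormal_family k n v"
    and a_eq: "a = (\<lambda>\<xi> \<zeta>. \<Sum>i<n. \<sigma> i *\<^sub>R tensor (u i) (v i) \<xi> \<zeta>)" and \<rho>_eq: "\<rho> = lq_norm q n \<sigma>"
    using a unfolding has_schatten_norm_def by blast
  show \<rho>: "0 \<le> \<rho>" unfolding \<rho>_eq by (rule lq_norm_nonneg)
  have us: "u i \<in> sobolev_space k" and vs: "v i \<in> sobolev_space k" if "i < n" for i
    using u v that by (auto simp: orthonormal_family_def)
  have uL: "weighted_L2 k (fourier (u i))" and vL: "weighted_L2 k (fourier (v i))" if "i < n" for i
    using sobolev_space_fourier(2)[OF us] sobolev_space_fourier(2)[OF vs] that by auto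
  let ?C = "(symbol_const TYPE('d) k)\<^sup>2 * \<rho>"
  let ?T = "svd_form n \<sigma> u v"
  have C0: "0 \<le> ?C" using \<rho> by simp
  have bound: "\<bar>?T \<mu> \<nu> m m'\<bar> \<le> ?C * (A * A')" if "symbol_le m A" "symbol_le m' A'" for m m' A A' \<mu> \<nu>
    by (rule svd_form_bound[OF k u v \<sigma> _ \<rho> that]) (auto simp: \<rho>_eq intro!: lq_norm_ge q \<sigma>)
  have Tdiff2: "?T \<mu> \<nu> m (\<lambda>\<omega>. m1 \<omega> - m2 \<omega>) = ?T \<mu> \<nu> m m1 - ?T \<mu> \<nu> m m2"
    if "symbol_le m1 A1" "symbol_le m2 A2" for m m1 m2 A1 A2 \<mu> \<nu>
    unfolding svd_form_def sum_subtractf[symmetric]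
    by (intro sum.cong refl) (simp add: symbol_fun_diff[OF k vL that] algebra_simps)
  have Tadd2: "?T \<mu> \<nu> m (\<lambda>\<omega>. m1 \<omega> + m2 \<omega>) = ?T \<mu> \<nu> m m1 + ?T \<mu> \<nu> m m2"
    if "symbol_le m1 A1" "symbol_le m2 A2" for m m1 m2 A1 A2 \<mu> \<nu>
    unfolding svd_form_def sum.distrib[symmetric]
    by (intro sum.cong refl) (simp add: symbol_fun_add[OF k vL that] algebra_simps)
  have Tdiff1: "?T \<mu> \<nu> (\<lambda>\<omega>. m1 \<omega> - m2 \<omega>) m = ?T \<mu> \<nu> m1 m - ?T \<mu> \<nu> m2 m"
    if "symbol_le m1 A1" "symbol_le m2 A2" for m m1 m2 A1 A2 \<mu> \<nu>
    unfolding svd_form_def sum_subtractf[symmetric]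
    by (intro sum.cong refl) (simp add: symbol_fun_diff[OF k uL that] algebra_simps)
  have Tadd1: "?T \<mu> \<nu> (\<lambda>\<omega>. m1 \<omega> + m2 \<omega>) m = ?T \<mu> \<nu> m1 m + ?T \<mu> \<nu> m2 m"
    if "symbol_le m1 A1" "symbol_le m2 A2" for m m1 m2 A1 A2 \<mu> \<nu>
    unfolding svd_form_def sum.distrib[symmetric]
    by (intro sum.cong refl) (simp add: symbol_fun_add[OF k uL that] algebra_simps)
  have a_T: "a \<xi> \<zeta> $ \<mu> $ \<nu> = ?T \<mu> \<nu> (wave \<xi>) (wave \<zeta>)" for \<xi> \<zeta> \<mu> \<nu>
  proof -
    have "a \<xi> \<zeta> $ \<mu> $ \<nu> = (\<Sum>i<n. \<sigma> i * (u i \<xi> $ \<mu> * v i \<zeta> $ \<nu>))"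
      by (simp add: a_eq tensor_def)
    also have "\<dots> = ?T \<mu> \<nu> (wave \<xi>) (wave \<zeta>)"
      unfolding svd_form_def using sobolev_space_eval[OF k us] sobolev_space_eval[OF k vs]
      by (intro sum.cong refl) (simp add: wave_def[abs_def])
    finally show ?thesis .
  qed
  define G where "G = (\<lambda>\<mu> \<nu> \<xi> \<zeta>. \<chi> \<kappa>. ?T \<mu> \<nu> (wave \<xi>) (dwave (axis \<kappa> 1) \<zeta>))"
  have dw: "?T \<mu> \<nu> m (dwave \<delta> \<zeta>) = (\<Sum>\<kappa>\<in>UNIV. \<delta> $ \<kappa> * ?T \<mu> \<nu> m (dwave (axis \<kappa> 1) \<zeta>))" for \<mu> \<nu> m \<delta> \<zeta>
  proof -
    let ?L = "\<lambda>\<delta>. ?T \<mu> \<nu> m (dwave \<delta> \<zeta>)"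
    have lin: "linear ?L"
    proof (rule linearI)
      fix v w :: "real^'d" and r :: real
      have "dwave (v + w) \<zeta> = (\<lambda>\<omega>. dwave v \<zeta> \<omega> + dwave w \<zeta> \<omega>)"
        by (simp add: dwave_def[abs_def] inner_add_right algebra_simps)
      then show "?L (v + w) = ?L v + ?L w"
        by (simp add: Tadd2[OF dwave_le dwave_le])
      have "dwave (r *\<^sub>R v) \<zeta> = (\<lambda>\<omega>. complex_of_real r * dwave v \<zeta> \<omega>)"
        by (simp add: dwave_def[abs_def] algebra_simps)
      then show "?L (r *\<^sub>R v) = r *\<^sub>R ?L v"
        by (simp add: svd_form_def symbol_fun_scale sum_distrib_left mult_ac)
    qed
    have e: "\<delta> = (\<Sum>\<kappa>\<in>UNIV. \<delta> $ \<kappa> *\<^sub>R axis \<kappa> 1)"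
      by (simp add: vec_eq_iff axis_def if_distrib cong: if_cong)
    have "?L \<delta> = ?L (\<Sum>\<kappa>\<in>UNIV. \<delta> $ \<kappa> *\<^sub>R axis \<kappa> 1)"
      by (rule arg_cong[where f="?L", OF e])
    also have "\<dots> = (\<Sum>\<kappa>\<in>UNIV. ?L (\<delta> $ \<kappa> *\<^sub>R axis \<kappa> 1))"
      by (rule linear_sum[OF lin])
    also have "\<dots> = (\<Sum>\<kappa>\<in>UNIV. \<delta> $ \<kappa> * ?L (axis \<kappa> 1))"
      using linear_scale[OF lin] by simp
    finally show ?thesis .
  qed
  have "regular_tensor (6 * ?C) a G"
    unfolding regular_tensor_def
  proof (intro conjI allI)
    fix \<mu> \<nu> \<kappa> :: 'd and \<xi> \<zeta> \<delta> :: "real^'d"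
    have "G \<mu> \<nu> \<xi> \<zeta> \<bullet> \<delta> = ?T \<mu> \<nu> (wave \<xi>) (dwave \<delta> \<zeta>)"
      unfolding dw[of _ _ _ \<delta>] by (simp add: inner_vec_def G_def mult.commute)
    then have "a \<xi> (\<zeta> + \<delta>) $ \<mu> $ \<nu> - a \<xi> \<zeta> $ \<mu> $ \<nu> - G \<mu> \<nu> \<xi> \<zeta> \<bullet> \<delta> = ?T \<mu> \<nu> (wave \<xi>) (wave_rem \<zeta> \<delta>)"
      by (simp add: a_T wave_rem_def[abs_def] Tdiff2[OF wave_le wave_le] Tdiff2[OF wave_diff_le dwave_le])
    then have "\<bar>a \<xi> (\<zeta> + \<delta>) $ \<mu> $ \<nu> - a \<xi> \<zeta> $ \<mu> $ \<nu> - G \<mu> \<nu> \<xi> \<zeta> \<bullet> \<delta>\<bar> \<le> ?C * (1 * (norm \<delta>)\<^sup>2)"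
      using bound[OF wave_le wave_rem_le] by simp
    also have "\<dots> \<le> 6 * ?C * (norm \<delta>)\<^sup>2" using mult_nonneg_nonneg[OF C0 zero_le_power2[of "norm \<delta>"]] by (simp only: mult.assoc)
    finally show "\<bar>a \<xi> (\<zeta> + \<delta>) $ \<mu> $ \<nu> - a \<xi> \<zeta> $ \<mu> $ \<nu> - G \<mu> \<nu> \<xi> \<zeta> \<bullet> \<delta>\<bar> \<le> 6 * ?C * (norm \<delta>)\<^sup>2" .
    let ?q = "dwave (axis \<kappa> 1) :: real^'d \<Rightarrow> _"
    have q1: "symbol_le (?q a) 1" for a using dwave_le[of "axis \<kappa> 1" a] by simp
    have q2: "symbol_le (\<lambda>\<omega>. ?q a \<omega> - ?q b \<omega>) (norm (a - b))" for a b using dwave_diff_le[of "axis \<kappa> 1" a b] by simp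
    have q4: "symbol_le (\<lambda>\<omega>. ?q a \<omega> - ?q b \<omega> - ?q c \<omega> + ?q d \<omega>) (norm (a - b - c + d) + norm (a - b) * norm (b - d))" for a b c d
      using dwave_four_point_le[of "axis \<kappa> 1" a b c d] by simp
    have Gb: "\<bar>G \<mu> \<nu> \<xi> \<zeta> $ \<kappa>\<bar> \<le> ?C" for \<xi> \<zeta>
      using bound[OF wave_le q1] by (simp add: G_def)
    show Gb6: "\<bar>G \<mu> \<nu> \<xi> \<zeta> $ \<kappa>\<bar> \<le> 6 * ?C" for \<xi> \<zeta>
      using Gb[of \<xi> \<zeta>] C0 by linarith
    let ?g = "\<lambda>\<xi>. ?T \<mu> \<nu> (wave \<xi>) (?q \<xi>)"
    show "tame (6 * ?C) (\<lambda>\<xi>. G \<mu> \<nu> \<xi> \<xi> $ \<kappa>)"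
      unfolding tame_def
    proof (intro conjI allI)
      show "norm (G \<mu> \<nu> a a $ \<kappa>) \<le> 6 * ?C" for a using Gb6 by simp
      show "norm (G \<mu> \<nu> a a $ \<kappa> - G \<mu> \<nu> b b $ \<kappa>) \<le> 6 * ?C * norm (a - b)" for a b
      proof -
        have "?g a - ?g b = ?T \<mu> \<nu> (\<lambda>\<omega>. wave a \<omega> - wave b \<omega>) (?q a) + ?T \<mu> \<nu> (wave b) (\<lambda>\<omega>. ?q a \<omega> - ?q b \<omega>)"
          by (simp add: Tdiff1[OF wave_le wave_le] Tdiff2[OF q1 q1])
        moreover have "\<bar>?T \<mu> \<nu> (\<lambda>\<omega>. wave a \<omega> - wave b \<omega>) (?q a)\<bar> \<le> ?C * norm (a - b)"
          using bound[OF wave_diff_le q1] by simp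
        moreover have "\<bar>?T \<mu> \<nu> (wave b) (\<lambda>\<omega>. ?q a \<omega> - ?q b \<omega>)\<bar> \<le> ?C * norm (a - b)"
          using bound[OF wave_le q2] by simp
        moreover have "0 \<le> ?C * norm (a - b)" using C0 by simp
        ultimately have "\<bar>?g a - ?g b\<bar> \<le> 6 * (?C * norm (a - b))" by linarith
        then show ?thesis by (simp add: G_def mult.assoc)
      qed
      show "norm (G \<mu> \<nu> a a $ \<kappa> - G \<mu> \<nu> b b $ \<kappa> - G \<mu> \<nu> c c $ \<kappa> + G \<mu> \<nu> d d $ \<kappa>)
          \<le> 6 * ?C * (norm (a - b - c + d) + norm (a - b) * norm (b - d))" for a b c d
      proof -
        let ?E = "norm (a - b - c + d) + norm (a - b) * norm (b - d)"
        let ?dp = "\<lambda>\<omega>. wave a \<omega> - wave b \<omega> - wave c \<omega> + wave d \<omega>"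
        let ?dq = "\<lambda>\<omega>. ?q a \<omega> - ?q b \<omega> - ?q c \<omega> + ?q d \<omega>"
        let ?pp = "\<lambda>\<omega>. wave a \<omega> - wave b \<omega> + wave d \<omega>"
        have pp: "symbol_le ?pp 3"
          using symbol_le_add[OF symbol_le_diff[OF wave_le wave_le] wave_le, of a b d] by simp
        have e1: "?T \<mu> \<nu> ?dp m = ?T \<mu> \<nu> (wave a) m - ?T \<mu> \<nu> (wave b) m - ?T \<mu> \<nu> (wave c) m + ?T \<mu> \<nu> (wave d) m" for m
          by (simp add: Tdiff1[OF wave_le wave_le] Tdiff1[OF wave_diff_le wave_le] Tadd1[OF symbol_le_diff[OF wave_diff_le wave_le] wave_le])
        have e2: "?T \<mu> \<nu> m ?dq = ?T \<mu> \<nu> m (?q a) - ?T \<mu> \<nu> m (?q b) - ?T \<mu> \<nu> m (?q c) + ?T \<mu> \<nu> m (?q d)" for m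
          by (simp add: Tdiff2[OF q1 q1] Tdiff2[OF q2 q1] Tadd2[OF symbol_le_diff[OF q2 q1] q1])
        have e3: "?T \<mu> \<nu> ?pp m = ?T \<mu> \<nu> (wave a) m - ?T \<mu> \<nu> (wave b) m + ?T \<mu> \<nu> (wave d) m" for m
          by (simp add: Tdiff1[OF wave_le wave_le] Tadd1[OF wave_diff_le wave_le])
        \<comment> \<open>Product rule for four points: each summand contains either a four point difference of one factor or a product of first differences of both along \<open>a - b\<close> and \<open>b - d\<close>.\<close>
        have dec: "?g a - ?g b - ?g c + ?g d = ?T \<mu> \<nu> ?dp (?q c)
            + ?T \<mu> \<nu> (\<lambda>\<omega>. wave a \<omega> - wave b \<omega>) (\<lambda>\<omega>. ?q b \<omega> - ?q d \<omega>)
            + ?T \<mu> \<nu> ?pp ?dq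
            + ?T \<mu> \<nu> (\<lambda>\<omega>. wave b \<omega> - wave d \<omega>) (\<lambda>\<omega>. ?q a \<omega> - ?q b \<omega>)"
          unfolding e1 e2 e3
          by (simp add: Tdiff1[OF wave_le wave_le] Tdiff2[OF q1 q1])
        have "\<bar>?T \<mu> \<nu> ?dp (?q c)\<bar> \<le> ?C * ?E"
          using bound[OF wave_four_point_le q1] by simp
        moreover have "\<bar>?T \<mu> \<nu> (\<lambda>\<omega>. wave a \<omega> - wave b \<omega>) (\<lambda>\<omega>. ?q b \<omega> - ?q d \<omega>)\<bar> \<le> ?C * (norm (a - b) * norm (b - d))"
          by (rule bound[OF wave_diff_le q2])
        moreover have "\<bar>?T \<mu> \<nu> ?pp ?dq\<bar> \<le> ?C * (3 * ?E)"
          by (rule bound[OF pp q4])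
        moreover have "\<bar>?T \<mu> \<nu> (\<lambda>\<omega>. wave b \<omega> - wave d \<omega>) (\<lambda>\<omega>. ?q a \<omega> - ?q b \<omega>)\<bar> \<le> ?C * (norm (a - b) * norm (b - d))"
          using bound[OF wave_diff_le q2, of \<mu> \<nu> b d a b] by (simp add: mult.commute)
        moreover have "?C * (norm (a - b) * norm (b - d)) \<le> ?C * ?E"
          using C0 by (intro mult_left_mono) auto
        ultimately have "\<bar>?g a - ?g b - ?g c + ?g d\<bar> \<le> 6 * (?C * ?E)"
          unfolding dec by linarith
        then show ?thesis by (simp add: G_def mult.assoc)
      qed
    qed
  qed
  then show "\<exists>G. regular_tensor (6 * (symbol_const TYPE('d) k)\<^sup>2 * \<rho>) a G" by (auto simp: mult.assoc)
qed

text \<open>Along a Cauchy sequence of algebraic tensors the gradients converge, since the gradient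
  of a difference is bounded by its Schatten norm. All clauses of \<open>regular_tensor\<close> are
  closed conditions.\<close>
lemma tensor_norm_regular_tensor:
  fixes a :: "('d::finite) mfield"
  assumes k: "k > real CARD('d) / 2 + 4" and q: "1 \<le> q" and a: "has_tensor_norm q k a r"
  shows "\<exists>G. regular_tensor (6 * (symbol_const TYPE('d) k)\<^sup>2 * r) a G" and "0 \<le> r"
proof -
  let ?C = "6 * (symbol_const TYPE('d) k)\<^sup>2"
  obtain b \<rho> where b: "\<And>n. has_schatten_norm q k (b n) (\<rho> n)"
    and cau: "\<And>e. e > 0 \<Longrightarrow> \<exists>N. \<forall>m\<ge>N. \<forall>n\<ge>N. \<exists>r'<e. has_schatten_norm q k (\<lambda>\<xi> \<zeta>. b m \<xi> \<zeta> - b n \<xi> \<zeta>) r'"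
    and lim: "\<And>\<xi> \<zeta>. (\<lambda>n. b n \<xi> \<zeta>) \<longlonglongrightarrow> a \<xi> \<zeta>" and \<rho>: "\<rho> \<longlonglongrightarrow> r"
    using a unfolding has_tensor_norm_def by blast
  show "0 \<le> r" using \<rho> schatten_regular_tensor(2)[OF k q b] by (intro LIMSEQ_le_const) auto
  have "\<exists>G. \<forall>n. regular_tensor (?C * \<rho> n) (b n) (G n)"
    using schatten_regular_tensor(1)[OF k q b] by (intro choice) blast
  then obtain G where G: "\<And>n. regular_tensor (?C * \<rho> n) (b n) (G n)" by blast
  have "Cauchy (\<lambda>n. G n \<mu> \<nu> \<xi> \<zeta> $ \<kappa>)" for \<mu> \<nu> \<xi> \<zeta> \<kappa>
  proof (rule CauchyI)
    fix e :: real assume e: "e > 0"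
    have "e / (?C + 1) > 0" using e by (simp add: add_nonneg_pos)
    from cau[OF this] obtain N where N: "\<And>m n. m \<ge> N \<Longrightarrow> n \<ge> N \<Longrightarrow> \<exists>r'<e / (?C + 1). has_schatten_norm q k (\<lambda>\<xi> \<zeta>. b m \<xi> \<zeta> - b n \<xi> \<zeta>) r'"
      by blast
    have "norm (G m \<mu> \<nu> \<xi> \<zeta> $ \<kappa> - G n \<mu> \<nu> \<xi> \<zeta> $ \<kappa>) < e" if mn: "m \<ge> N" "n \<ge> N" for m n
    proof -
      obtain r' where r': "r' < e / (?C + 1)" "has_schatten_norm q k (\<lambda>\<xi> \<zeta>. b m \<xi> \<zeta> - b n \<xi> \<zeta>) r'"
        using N[OF mn] by blast
      obtain J where J: "regular_tensor (?C * r') (\<lambda>\<xi> \<zeta>. b m \<xi> \<zeta> - b n \<xi> \<zeta>) J"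
        using schatten_regular_tensor(1)[OF k q r'(2)] by blast
      have "norm (G m \<mu> \<nu> \<xi> \<zeta> $ \<kappa> - G n \<mu> \<nu> \<xi> \<zeta> $ \<kappa>) = \<bar>J \<mu> \<nu> \<xi> \<zeta> $ \<kappa>\<bar>"
        using regular_tensor_diff_unique[OF G G J] by simp
      also have "\<dots> \<le> ?C * r'" using J by (simp add: regular_tensor_def)
      also have "\<dots> \<le> (?C + 1) * r'"
        using schatten_regular_tensor(2)[OF k q r'(2)] by (intro mult_right_mono) auto
      also have "\<dots> < e"
        using r'(1) by (simp add: pos_less_divide_eq add_nonneg_pos mult.commute)
      finally show ?thesis .
    qed
    then show "\<exists>M. \<forall>m\<ge>M. \<forall>n\<ge>M. norm (G m \<mu> \<nu> \<xi> \<zeta> $ \<kappa> - G n \<mu> \<nu> \<xi> \<zeta> $ \<kappa>) < e" by blast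
  qed
  then have conv: "convergent (\<lambda>n. G n \<mu> \<nu> \<xi> \<zeta> $ \<kappa>)" for \<mu> \<nu> \<xi> \<zeta> \<kappa>
    by (rule Cauchy_convergent)
  define H where "H = (\<lambda>\<mu> \<nu> \<xi> \<zeta>. \<chi> \<kappa>. Topological_Spaces.lim (\<lambda>n. G n \<mu> \<nu> \<xi> \<zeta> $ \<kappa>))"
  have H: "(\<lambda>n. G n \<mu> \<nu> \<xi> \<zeta> $ \<kappa>) \<longlonglongrightarrow> H \<mu> \<nu> \<xi> \<zeta> $ \<kappa>" for \<mu> \<nu> \<xi> \<zeta> \<kappa>
    unfolding H_def using conv by (simp add: convergent_LIMSEQ_iff)
  have HG: "(\<lambda>n. G n \<mu> \<nu> \<xi> \<zeta>) \<longlonglongrightarrow> H \<mu> \<nu> \<xi> \<zeta>" for \<mu> \<nu> \<xi> \<zeta>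
    by (rule vec_tendstoI) (rule H)
  have C\<rho>: "(\<lambda>n. ?C * \<rho> n) \<longlonglongrightarrow> ?C * r" by (intro tendsto_intros \<rho>)
  have "regular_tensor (?C * r) a H"
    unfolding regular_tensor_def
  proof (intro conjI allI)
    fix \<mu> \<nu> \<kappa> :: 'd and \<xi> \<zeta> \<delta> :: "real^'d"
    have lim': "(\<lambda>n. b n \<xi> \<zeta> $ \<mu> $ \<nu>) \<longlonglongrightarrow> a \<xi> \<zeta> $ \<mu> $ \<nu>" for \<zeta>
      by (intro tendsto_vec_nth lim)
    show "\<bar>a \<xi> (\<zeta> + \<delta>) $ \<mu> $ \<nu> - a \<xi> \<zeta> $ \<mu> $ \<nu> - H \<mu> \<nu> \<xi> \<zeta> \<bullet> \<delta>\<bar> \<le> ?C * r * (norm \<delta>)\<^sup>2"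
    proof (rule LIMSEQ_le)
      show "(\<lambda>n. \<bar>b n \<xi> (\<zeta> + \<delta>) $ \<mu> $ \<nu> - b n \<xi> \<zeta> $ \<mu> $ \<nu> - G n \<mu> \<nu> \<xi> \<zeta> \<bullet> \<delta>\<bar>)
         \<longlonglongrightarrow> \<bar>a \<xi> (\<zeta> + \<delta>) $ \<mu> $ \<nu> - a \<xi> \<zeta> $ \<mu> $ \<nu> - H \<mu> \<nu> \<xi> \<zeta> \<bullet> \<delta>\<bar>"
        by (intro tendsto_intros lim' HG)
      show "(\<lambda>n. ?C * \<rho> n * (norm \<delta>)\<^sup>2) \<longlonglongrightarrow> ?C * r * (norm \<delta>)\<^sup>2"
        by (intro tendsto_mult_right C\<rho>)
    qed (use G in \<open>auto simp: regular_tensor_def\<close>)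
    show "\<bar>H \<mu> \<nu> \<xi> \<zeta> $ \<kappa>\<bar> \<le> ?C * r"
      by (rule LIMSEQ_le[OF tendsto_rabs[OF H] C\<rho>]) (use G in \<open>auto simp: regular_tensor_def\<close>)
    show "tame (?C * r) (\<lambda>\<xi>. H \<mu> \<nu> \<xi> \<xi> $ \<kappa>)"
      by (rule tame_limit[OF _ C\<rho> H]) (use G in \<open>auto simp: regular_tensor_def\<close>)
  qed
  then show "\<exists>G. regular_tensor (?C * r) a G" by blast
qed

section \<open>Caratheodory equations\<close>

lemma increment_bound:
  fixes w :: "real \<Rightarrow> 'a::banach"
  assumes t: "0 \<le> t" and w: "\<And>r. r \<in> {0..t} \<Longrightarrow> (w has_vector_derivative w' r) (at r within {0..t})"
    and b: "\<And>r. r \<in> {0..t} \<Longrightarrow> norm (w' r) \<le> E"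
  shows "norm (w t - w 0) \<le> E * t"
proof -
  have "(w' has_integral (w t - w 0)) {0..t}"
    by (rule fundamental_theorem_of_calculus[OF t w])
  moreover have "E \<ge> 0" using b[of 0] t norm_ge_zero[of "w' 0"] by (simp del: norm_ge_zero)
  ultimately show ?thesis
    using has_integral_bound[of E w' "w t - w 0" 0 t] b t by simp
qed

lemma exp_has_integral:
  fixes L :: real assumes "L > 0" "0 \<le> c"
  shows "((\<lambda>r. L * exp (2 * L * r)) has_integral (exp (2 * L * c) - 1) / 2) {0..c}"
proof -
  have "((\<lambda>r. exp (2 * L * r) / 2) has_vector_derivative (L * exp (2 * L * r))) (at r within {0..c})" for r
    by (auto intro!: derivative_eq_intros simp flip: has_real_derivative_iff_has_vector_derivative)
  from fundamental_theorem_of_calculus[OF assms(2) this] show ?thesis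
    by (simp add: diff_divide_distrib)
qed

lemma ode_solution_continuous:
  assumes "ode_solution T v \<xi> z" shows "continuous_on {0..T} z"
proof -
  have zi: "(\<lambda>r. v r (z r)) integrable_on {0..T}"
    using assms unfolding ode_solution_def by (auto intro: set_lebesgue_integral_eq_integral(1))
  have "continuous_on {0..T} (\<lambda>t. \<xi> + integral {0..t} (\<lambda>r. v r (z r)))"
    by (intro continuous_intros indefinite_integral_continuous_1 zi)
  then show ?thesis
    by (rule continuous_on_cong[THEN iffD1, rotated 2]) (use assms in \<open>auto simp: ode_solution_def\<close>)
qed

text \<open>Picard iteration on the whole interval at once. In the unknown \<open>exp (- 2 L t) z
  t\<close> the integral operator contracts by \<open>1/2\<close>, whatever \<open>T\<close> and
  \<open>L\<close> are, and it is Lipschitz in the initial value; existence, uniqueness and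
  continuity in the initial value follow together.\<close>
lemma caratheodory_flow_exists:
  fixes v :: "real \<Rightarrow> ('d::finite) vfield"
  assumes T: "0 \<le> T" and L: "L > 0"
    and int: "\<And>z. continuous_on {0..T} z \<Longrightarrow> (\<lambda>r. v r (z r)) absolutely_integrable_on {0..T}"
    and lip: "\<And>r a b. r \<in> {0..T} \<Longrightarrow> norm (v r a - v r b) \<le> L * norm (a - b)"
  shows "\<exists>Y. ode_flow_map T v Y"
proof -
  \<comment> \<open>Functions on the whole line are constant outside \<open>[0, T]\<close>, which makes bounded continuous functions a complete space for the iteration.\<close>
  define c where "c = (\<lambda>t. max 0 (min T t))"
  have c: "c t \<in> {0..T}" for t using T by (auto simp: c_def)
  have c_id: "c t = t" if "t \<in> {0..T}" for t using that by (auto simp: c_def)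
  have c_cont: "continuous_on UNIV c" unfolding c_def by (intro continuous_intros)
  define U where "U = (\<lambda>(g::real \<Rightarrow>\<^sub>C (real^'d)) r. exp (2 * L * r) *\<^sub>R apply_bcontfun g r)"
  have U_cont: "continuous_on A (U g)" for g A unfolding U_def by (intro continuous_intros) auto
  define P where "P = (\<lambda>\<xi> g t. exp (- (2 * L * c t)) *\<^sub>R (\<xi> + integral {0..c t} (\<lambda>r. v r (U g r))))"
  have U_int: "(\<lambda>r. v r (U g r)) integrable_on {0..T}" for g
    using int[OF U_cont] by (rule set_lebesgue_integral_eq_integral(1))
  have U_int': "(\<lambda>r. v r (U g r)) integrable_on {0..c t}" for g t
    using U_int by (rule integrable_on_subinterval) (use c[of t] in auto)
  have bc: "(\<lambda>t. E (c t)) \<in> bcontfun" if "continuous_on {0..T} E" for E :: "real \<Rightarrow> real^'d"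
    unfolding bcontfun_def
  proof (intro CollectI conjI)
    show "continuous_on UNIV (\<lambda>t. E (c t))"
      by (rule continuous_on_compose2[OF that c_cont]) (use c in auto)
    have "bounded (E ` {0..T})" by (intro compact_imp_bounded compact_continuous_image that) auto
    then show "bounded (range (\<lambda>t. E (c t)))"
      by (rule bounded_subset) (use c in auto)
  qed
  have P_bc: "P \<xi> g \<in> bcontfun" for \<xi> g
    unfolding P_def
    by (rule bc[of "\<lambda>s. exp (- (2 * L * s)) *\<^sub>R (\<xi> + integral {0..s} (\<lambda>r. v r (U g r)))"])
       (intro continuous_intros indefinite_integral_continuous_1 U_int)
  define \<Phi> where "\<Phi> = (\<lambda>\<xi> g. Bcontfun (P \<xi> g))"
  have \<Phi>: "apply_bcontfun (\<Phi> \<xi> g) t = P \<xi> g t" for \<xi> g t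
    unfolding \<Phi>_def by (simp add: Bcontfun_inverse P_bc)
  have contr: "dist (\<Phi> \<xi> g) (\<Phi> \<eta> h) \<le> norm (\<xi> - \<eta>) + 1 / 2 * dist g h" for \<xi> \<eta> g h
  proof (rule dist_bound)
    fix t
    let ?e = "exp (- (2 * L * c t))"
    have c0: "0 \<le> c t" using c[of t] by auto
    have "norm (integral {0..c t} (\<lambda>r. v r (U g r) - v r (U h r))) \<le> integral {0..c t} (\<lambda>r. (L * exp (2 * L * r)) * dist g h)"
    proof (rule integral_norm_bound_integral)
      show "(\<lambda>r. v r (U g r) - v r (U h r)) integrable_on {0..c t}"
        by (intro integrable_diff U_int')
      show "(\<lambda>r. (L * exp (2 * L * r)) * dist g h) integrable_on {0..c t}"
        by (intro integrable_continuous_real continuous_intros)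
      fix r assume r: "r \<in> {0..c t}"
      then have "norm (v r (U g r) - v r (U h r)) \<le> L * norm (U g r - U h r)"
        by (intro lip) (use c[of t] in auto)
      also have "norm (U g r - U h r) = exp (2 * L * r) * dist (apply_bcontfun g r) (apply_bcontfun h r)"
        unfolding U_def by (simp add: scaleR_diff_right[symmetric] dist_norm)
      also have "\<dots> \<le> exp (2 * L * r) * dist g h"
        by (intro mult_left_mono dist_bounded) auto
      finally show "norm (v r (U g r) - v r (U h r)) \<le> (L * exp (2 * L * r)) * dist g h"
        using L by (simp add: mult.assoc)
    qed
    also have "\<dots> = (exp (2 * L * c t) - 1) / 2 * dist g h"
      using has_integral_mult_left[OF exp_has_integral[OF L c0], of "dist g h"] by (rule integral_unique)
    finally have I: "norm (integral {0..c t} (\<lambda>r. v r (U g r) - v r (U h r))) \<le> (exp (2 * L * c t) - 1) / 2 * dist g h" .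
    have "P \<xi> g t - P \<eta> h t = ?e *\<^sub>R ((\<xi> - \<eta>) + integral {0..c t} (\<lambda>r. v r (U g r) - v r (U h r)))"
      unfolding P_def by (simp add: Henstock_Kurzweil_Integration.integral_diff[OF U_int' U_int'] algebra_simps)
    then have "dist (P \<xi> g t) (P \<eta> h t) \<le> ?e * (norm (\<xi> - \<eta>) + (exp (2 * L * c t) - 1) / 2 * dist g h)"
      using norm_triangle_le[OF add_left_mono[OF I, of "norm (\<xi> - \<eta>)"]] by (simp add: dist_norm)
    also have "\<dots> = ?e * norm (\<xi> - \<eta>) + (?e * exp (2 * L * c t) - ?e) / 2 * dist g h"
      by (simp add: algebra_simps)
    also have "?e * exp (2 * L * c t) = 1" by (simp flip: exp_add)
    also have "?e * norm (\<xi> - \<eta>) + (1 - ?e) / 2 * dist g h \<le> 1 * norm (\<xi> - \<eta>) + 1 / 2 * dist g h"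
      using L c0 by (intro add_mono mult_right_mono) auto
    finally show "dist (apply_bcontfun (\<Phi> \<xi> g) t) (apply_bcontfun (\<Phi> \<eta> h) t) \<le> norm (\<xi> - \<eta>) + 1 / 2 * dist g h"
      by (simp add: \<Phi>)
  qed
  have fp: "\<exists>!g. \<Phi> \<xi> g = g" for \<xi>
    by (rule banach_fix_type[of "1/2"]) (use contr[of \<xi> _ \<xi>] in auto)
  define G where "G = (\<lambda>\<xi>. THE g. \<Phi> \<xi> g = g)"
  have G: "\<Phi> \<xi> (G \<xi>) = G \<xi>" for \<xi> unfolding G_def by (rule theI'[OF fp])
  have Guniq: "\<Phi> \<xi> g = g \<Longrightarrow> g = G \<xi>" for \<xi> g using fp G by blast
  define Y where "Y = (\<lambda>t \<xi>. U (G \<xi>) t)"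
  have Y_eq: "Y t \<xi> = \<xi> + integral {0..t} (\<lambda>r. v r (Y r \<xi>))" if "t \<in> {0..T}" for t \<xi>
  proof -
    have "apply_bcontfun (G \<xi>) t = P \<xi> (G \<xi>) t" using \<Phi>[of \<xi> "G \<xi>" t] G by simp
    then show ?thesis unfolding Y_def U_def[of] by (simp add: P_def c_id[OF that] U_def flip: exp_add)
  qed
  have Ysol: "ode_solution T v \<xi> (\<lambda>t. Y t \<xi>)" for \<xi>
    unfolding ode_solution_def using int[OF U_cont, of "G \<xi>"] Y_eq by (simp add: Y_def)
  have Yuniq: "z t = Y t \<xi>" if z: "ode_solution T v \<xi> z" and t: "t \<in> {0..T}" for z \<xi> t
  proof -
    have zc: "continuous_on {0..T} z" by (rule ode_solution_continuous[OF z])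
    define g where "g = Bcontfun (\<lambda>t. exp (- (2 * L * c t)) *\<^sub>R z (c t))"
    have g: "apply_bcontfun g t = exp (- (2 * L * c t)) *\<^sub>R z (c t)" for t
      unfolding g_def by (subst Bcontfun_inverse) (auto intro!: bc[of "\<lambda>s. exp (- (2 * L * s)) *\<^sub>R z s"] continuous_intros zc)
    have Ug: "U g r = z r" if "r \<in> {0..T}" for r
      unfolding U_def g c_id[OF that] by (simp flip: exp_add)
    have "\<Phi> \<xi> g = g"
    proof (rule bcontfun_eqI)
      fix t
      have "integral {0..c t} (\<lambda>r. v r (U g r)) = integral {0..c t} (\<lambda>r. v r (z r))"
        by (rule Henstock_Kurzweil_Integration.integral_cong) (use Ug c[of t] in auto)
      moreover have "z (c t) = \<xi> + integral {0..c t} (\<lambda>r. v r (z r))"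
        using z c[of t] unfolding ode_solution_def by blast
      ultimately show "apply_bcontfun (\<Phi> \<xi> g) t = apply_bcontfun g t"
        by (simp add: \<Phi> P_def g)
    qed
    from Guniq[OF this] show ?thesis using Ug[OF t] by (simp add: Y_def)
  qed
  have Ycont: "continuous_on UNIV (Y t)" for t
  proof -
    have "dist (Y t \<xi>) (Y t \<eta>) \<le> (2 * exp (2 * L * t)) * dist \<xi> \<eta>" for \<xi> \<eta>
    proof -
      have "dist (G \<xi>) (G \<eta>) \<le> norm (\<xi> - \<eta>) + 1 / 2 * dist (G \<xi>) (G \<eta>)"
        using contr[of \<xi> "G \<xi>" \<eta> "G \<eta>"] by (simp add: G)
      then have "dist (G \<xi>) (G \<eta>) \<le> 2 * dist \<xi> \<eta>" by (simp add: dist_norm)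
      moreover have "dist (apply_bcontfun (G \<xi>) t) (apply_bcontfun (G \<eta>) t) \<le> dist (G \<xi>) (G \<eta>)" by (rule dist_bounded)
      ultimately have "exp (2 * L * t) * dist (apply_bcontfun (G \<xi>) t) (apply_bcontfun (G \<eta>) t) \<le> exp (2 * L * t) * (2 * dist \<xi> \<eta>)"
        by (intro mult_left_mono) auto
      then show ?thesis
        unfolding Y_def U_def by (simp add: dist_norm flip: scaleR_diff_right)
    qed
    then have "(2 * exp (2 * L * t))-lipschitz_on UNIV (Y t)"
      by (intro lipschitz_onI) auto
    then show ?thesis by (rule lipschitz_on_continuous_on)
  qed
  have "ode_flow_map T v Y"
    unfolding ode_flow_map_def using Ycont Ysol Yuniq by blast
  then show ?thesis by blast
qed

text \<open>\<open>time_one_map\<close> is a definite description; this is what makes it denote the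
  value of a solution.\<close>
lemma time_one_map_solution:
  fixes V :: "('d::finite) vfield"
  assumes lip: "\<And>a b. norm (V a - V b) \<le> L * norm (a - b)"
  shows "\<exists>z. z 0 = \<xi> \<and> z 1 = time_one_map V \<xi> \<and>
     (\<forall>r\<in>{0..1}. (z has_vector_derivative V (z r)) (at r within {0..1}))"
proof -
  have lip': "norm (V a - V b) \<le> (\<bar>L\<bar> + 1) * norm (a - b)" for a b
    using lip[of a b] by (rule order_trans) (intro mult_right_mono, auto)
  have "(\<bar>L\<bar> + 1)-lipschitz_on UNIV V"
    by (intro lipschitz_onI) (use lip' in \<open>auto simp: dist_norm\<close>)
  then have Vc: "continuous_on UNIV V" by (rule lipschitz_on_continuous_on)
  have Vz: "continuous_on {0..1} (\<lambda>r. V (z r))" if "continuous_on {0..1} z" for z :: "real \<Rightarrow> real^'d"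
    by (rule continuous_on_compose2[OF Vc that]) auto
  have "\<exists>Y. ode_flow_map 1 (\<lambda>_. V) Y"
    by (rule caratheodory_flow_exists[of 1 "\<bar>L\<bar> + 1"]) (auto intro!: absolutely_integrable_continuous_real Vz lip')
  then obtain Y where Y: "ode_flow_map 1 (\<lambda>_. V) Y" by blast
  let ?Q = "\<lambda>z \<eta>. z 0 = \<xi> \<and> z 1 = \<eta> \<and> (\<forall>r\<in>{0..1}. (z has_vector_derivative V (z r)) (at r within {0..1}))"
  let ?y = "\<lambda>t. Y t \<xi>"
  have sol: "ode_solution 1 (\<lambda>_. V) \<xi> ?y" using Y by (simp add: ode_flow_map_def)
  have yc: "continuous_on {0..1} ?y" by (rule ode_solution_continuous[OF sol])
  have yQ: "?Q ?y (Y 1 \<xi>)"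
  proof (intro conjI ballI)
    show "Y 0 \<xi> = \<xi>" using sol by (auto simp: ode_solution_def)
    fix r :: real assume r: "r \<in> {0..1}"
    have "((\<lambda>t. \<xi> + integral {0..t} (\<lambda>r. V (Y r \<xi>))) has_vector_derivative (0 + V (Y r \<xi>))) (at r within {0..1})"
      by (intro has_vector_derivative_add has_vector_derivative_const integral_has_vector_derivative Vz yc r)
    then have D: "((\<lambda>t. \<xi> + integral {0..t} (\<lambda>r. V (Y r \<xi>))) has_vector_derivative V (Y r \<xi>)) (at r within {0..1})"
      by simp
    show "(?y has_vector_derivative V (Y r \<xi>)) (at r within {0..1})"
      by (rule has_vector_derivative_transform[OF r _ D]) (use sol in \<open>auto simp: ode_solution_def\<close>)
  qed simp
  have uniq: "\<eta> = Y 1 \<xi>" if Q: "?Q z \<eta>" for z \<eta>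
  proof -
    have zc: "continuous_on {0..1} z"
      using Q by (intro continuous_on_vector_derivative) auto
    have "z t = \<xi> + integral {0..t} (\<lambda>r. V (z r))" if t: "t \<in> {0..1}" for t
    proof -
      have "((\<lambda>r. V (z r)) has_integral (z t - z 0)) {0..t}"
      proof (rule fundamental_theorem_of_calculus)
        fix r assume r: "r \<in> {0..t}"
        then have "(z has_vector_derivative V (z r)) (at r within {0..1})" using Q t by auto
        then show "(z has_vector_derivative V (z r)) (at r within {0..t})"
          by (rule has_vector_derivative_within_subset) (use t in auto)
      qed (use t in auto)
      then show ?thesis using Q by (simp add: integral_unique)
    qed
    then have "ode_solution 1 (\<lambda>_. V) \<xi> z"
      unfolding ode_solution_def using absolutely_integrable_continuous_real[OF Vz[OF zc]] by simp
    then have "z 1 = Y 1 \<xi>" using Y by (simp add: ode_flow_map_def)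
    then show ?thesis using Q by simp
  qed
  have "time_one_map V \<xi> = Y 1 \<xi>"
    unfolding time_one_map_def
  proof (rule the_equality)
    show "\<exists>z. ?Q z (Y 1 \<xi>)" by (rule exI[of _ ?y], rule yQ)
    fix \<eta> assume "\<exists>z. ?Q z \<eta>"
    then show "\<eta> = Y 1 \<xi>" by (elim exE) (rule uniq)
  qed
  then show ?thesis using yQ by (intro exI[of _ ?y]) simp
qed


lemma ode_solution_increment:
  assumes z: "ode_solution T v \<xi> z" and st: "0 \<le> s" "s \<le> t" "t \<le> T"
  shows "z t - z s = integral {s..t} (\<lambda>r. v r (z r))"
    and "(\<And>r a. r \<in> {0..T} \<Longrightarrow> norm (v r a) \<le> M) \<Longrightarrow> norm (z t - z s) \<le> M * (t - s)"
proof -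
  have zi: "(\<lambda>r. v r (z r)) integrable_on {0..T}"
    using z unfolding ode_solution_def by (auto intro: set_lebesgue_integral_eq_integral(1))
  then have it: "(\<lambda>r. v r (z r)) integrable_on {0..t}" "(\<lambda>r. v r (z r)) integrable_on {s..t}"
    using st by (auto intro: integrable_on_subinterval)
  have "integral {0..s} (\<lambda>r. v r (z r)) + integral {s..t} (\<lambda>r. v r (z r)) = integral {0..t} (\<lambda>r. v r (z r))"
    by (rule Henstock_Kurzweil_Integration.integral_combine) (use st it in auto)
  moreover have "z t = \<xi> + integral {0..t} (\<lambda>r. v r (z r))" "z s = \<xi> + integral {0..s} (\<lambda>r. v r (z r))"
    using z st unfolding ode_solution_def by auto
  ultimately show eq: "z t - z s = integral {s..t} (\<lambda>r. v r (z r))" by (simp add: algebra_simps)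
  assume M: "\<And>r a. r \<in> {0..T} \<Longrightarrow> norm (v r a) \<le> M"
  have "0 \<le> M" using order_trans[OF norm_ge_zero M[of s 0]] st by simp
  then have "norm (integral {s..t} (\<lambda>r. v r (z r))) \<le> M * measure lborel (cbox s t)"
    by (intro has_integral_bound[of _ "\<lambda>r. v r (z r)"]) (use it M st in \<open>auto intro: integrable_integral\<close>)
  then show "norm (z t - z s) \<le> M * (t - s)" using st by (simp add: eq)
qed

text \<open>The minimum assigns the end point \<open>n h\<close> to the last cell.\<close>
definition cell :: "real \<Rightarrow> nat \<Rightarrow> real \<Rightarrow> nat" where
  "cell h n r = min (n - 1) (nat \<lfloor>r / h\<rfloor>)"

lemma cell_less: "0 < n \<Longrightarrow> cell h n r < n"
  by (auto simp: cell_def)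

lemma cell_mono: "0 < h \<Longrightarrow> r \<le> s \<Longrightarrow> cell h n r \<le> cell h n s"
  unfolding cell_def by (intro min.mono nat_mono floor_mono divide_right_mono) auto

lemma cell_eq:
  assumes h: "0 < h" and i: "i < n" and r: "real i * h \<le> r" "r < real (Suc i) * h"
  shows "cell h n r = i"
proof -
  have "\<lfloor>r / h\<rfloor> = int i"
    by (rule floor_unique) (use h r in \<open>auto simp: field_simps\<close>)
  then show ?thesis using i by (auto simp: cell_def)
qed

text \<open>Along an increasing sequence of times the cell index increases, and the field changes,
  by at most \<open>2 M\<close>, only when the index does.\<close>
lemma step_field_bounded_variation:
  fixes G :: "nat \<Rightarrow> ('d::finite) vfield"
  assumes h: "0 < h" and n: "0 < n" and cont: "\<And>i. i < n \<Longrightarrow> continuous_on UNIV (G i)"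
    and M: "\<And>i \<xi>. i < n \<Longrightarrow> norm (G i \<xi>) \<le> M"
  shows "bounded_variation_path T (\<lambda>r. G (cell h n r))"
  unfolding bounded_variation_path_def
proof (intro conjI ballI exI allI impI)
  show "continuous_on UNIV (G (cell h n t))" for t by (intro cont cell_less n)
  have M0: "0 \<le> M" using M[OF n, of 0] norm_ge_zero order_trans by blast
  fix m \<tau> assume *: "(\<forall>i\<le>m. \<tau> i \<in> {0..T}) \<and> (\<forall>i<m. \<tau> i \<le> \<tau> (Suc i))"
  let ?k = "\<lambda>i. real (cell h n (\<tau> i))"
  have "(\<Sum>i<m. SUP \<xi>. ennreal (norm (G (cell h n (\<tau> (Suc i))) \<xi> - G (cell h n (\<tau> i)) \<xi>)))
      \<le> (\<Sum>i<m. ennreal (2 * M * (?k (Suc i) - ?k i)))"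
  proof (intro sum_mono SUP_least ennreal_leI)
    fix i \<xi> assume i: "i \<in> {..<m}"
    have mono: "cell h n (\<tau> i) \<le> cell h n (\<tau> (Suc i))" using * i by (intro cell_mono h) auto
    show "norm (G (cell h n (\<tau> (Suc i))) \<xi> - G (cell h n (\<tau> i)) \<xi>) \<le> 2 * M * (?k (Suc i) - ?k i)"
    proof (cases "cell h n (\<tau> i) = cell h n (\<tau> (Suc i))")
      case False
      have "norm (G (cell h n (\<tau> (Suc i))) \<xi> - G (cell h n (\<tau> i)) \<xi>) \<le> M + M"
        by (intro order_trans[OF norm_triangle_ineq4] add_mono M cell_less n)
      also have "\<dots> \<le> 2 * M * (?k (Suc i) - ?k i)"
        using mult_left_mono[of 1 "?k (Suc i) - ?k i" "2 * M"] False mono M0 by simp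
      finally show ?thesis .
    qed simp
  qed
  also have "\<dots> = ennreal (\<Sum>i<m. 2 * M * (?k (Suc i) - ?k i))"
  proof (rule sum_ennreal)
    fix i assume i: "i \<in> {..<m}"
    have "cell h n (\<tau> i) \<le> cell h n (\<tau> (Suc i))" using * i by (intro cell_mono h) auto
    then show "0 \<le> 2 * M * (?k (Suc i) - ?k i)" using M0 by (intro mult_nonneg_nonneg) auto
  qed
  also have "(\<Sum>i<m. 2 * M * (?k (Suc i) - ?k i)) = 2 * M * (?k m - ?k 0)"
    using sum_lessThan_telescope[of ?k m] by (simp add: sum_distrib_left[symmetric])
  also have "\<dots> \<le> 2 * M * real n"
    using M0 cell_less[OF n, of h "\<tau> m"] by (intro mult_left_mono) auto
  finally show "(\<Sum>i<m. SUP \<xi>. ennreal (norm (G (cell h n (\<tau> (Suc i))) \<xi> - G (cell h n (\<tau> i)) \<xi>))) \<le> ennreal (2 * M * real n)"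
    by (simp add: ennreal_leI)
qed

lemma step_field_integrable:
  fixes G :: "nat \<Rightarrow> ('d::finite) vfield"
  assumes n: "0 < n" and cont: "\<And>i. i < n \<Longrightarrow> continuous_on UNIV (G i)" and z: "continuous_on {0..T} z"
  shows "(\<lambda>r. G (cell h n r) (z r)) absolutely_integrable_on {0..T}"
proof -
  let ?A = "\<lambda>i. {r \<in> {0..T}. cell h n r = i}"
  have A: "?A i \<in> sets lebesgue" for i
  proof -
    have "?A i \<in> sets borel" unfolding cell_def by measurable
    then show ?thesis by (rule sets_completionI_sets[of _ lborel, simplified])
  qed
  have "set_integrable lebesgue (\<Union>i\<in>{..<n}. ?A i) (\<lambda>r. G (cell h n r) (z r))"
  proof (rule set_integrable_UN)
    fix i assume i: "i \<in> {..<n}"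
    have "(\<lambda>r. G i (z r)) absolutely_integrable_on {0..T}"
      by (intro absolutely_integrable_continuous_real continuous_on_compose2[OF cont z]) (use i in auto)
    then have "set_integrable lebesgue (?A i) (\<lambda>r. G i (z r))"
      by (rule set_integrable_subset[OF _ A]) auto
    then show "set_integrable lebesgue (?A i) (\<lambda>r. G (cell h n r) (z r))"
      by (rule set_integrable_cong[THEN iffD1, rotated -1]) auto
  qed (use A in auto)
  moreover have "(\<Union>i\<in>{..<n}. ?A i) = {0..T}" using cell_less[OF n] by auto
  ultimately show ?thesis by simp
qed

lemma step_field_flow_exists:
  fixes G :: "nat \<Rightarrow> ('d::finite) vfield"
  assumes T: "0 \<le> T" and n: "0 < n" and L: "\<And>i a b. i < n \<Longrightarrow> norm (G i a - G i b) \<le> L * norm (a - b)"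
  shows "\<exists>Y. ode_flow_map T (\<lambda>r. G (cell h n r)) Y"
proof (rule caratheodory_flow_exists[of T "\<bar>L\<bar> + 1"])
  have L': "norm (G i a - G i b) \<le> (\<bar>L\<bar> + 1) * norm (a - b)" if "i < n" for i a b
    using L[OF that, of a b] by (rule order_trans) (intro mult_right_mono, auto)
  have cont: "continuous_on UNIV (G i)" if "i < n" for i
  proof -
    have "(\<bar>L\<bar> + 1)-lipschitz_on UNIV (G i)"
      by (intro lipschitz_onI) (use L'[OF that] in \<open>auto simp: dist_norm\<close>)
    then show ?thesis by (rule lipschitz_on_continuous_on)
  qed
  show "(\<lambda>r. G (cell h n r) (z r)) absolutely_integrable_on {0..T}" if "continuous_on {0..T} z" for z
    by (rule step_field_integrable[OF n cont that])
  show "norm (G (cell h n r) a - G (cell h n r) b) \<le> (\<bar>L\<bar> + 1) * norm (a - b)" for r a b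
    by (intro L' cell_less n)
qed (use T in auto)

text \<open>On a cell, rescaled to unit length, the solution follows the autonomous field \<open>W
  i\<close>: the factor \<open>1 / h\<close> and the change of time cancel. The value of the field
  at the right end point belongs to the next cell, which does not affect the integral.\<close>
lemma step_field_cell_derivative:
  fixes W :: "nat \<Rightarrow> ('d::finite) vfield"
  assumes h: "0 < h" and i: "i < n" and T: "real n * h = T" and cont: "continuous_on UNIV (W i)"
    and z: "ode_solution T (\<lambda>r \<eta>. (1 / h) *\<^sub>R W (cell h n r) \<eta>) \<xi> z"
    and \<rho>: "\<rho> \<in> {0..1}"
  shows "((\<lambda>\<rho>. z (real i * h + \<rho> * h)) has_vector_derivative W i (z (real i * h + \<rho> * h))) (at \<rho> within {0..1})"
proof -
  let ?a = "real i * h" and ?b = "real (Suc i) * h"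
  have ab: "0 \<le> ?a" "?a \<le> ?b" "?b \<le> T"
    using h i T by (auto simp flip: T intro!: mult_right_mono)
  have zc: "continuous_on {?a..?b} z"
    by (rule continuous_on_subset[OF ode_solution_continuous[OF z]]) (use ab in auto)
  have Wz: "continuous_on {?a..?b} (\<lambda>r. (1 / h) *\<^sub>R W i (z r))"
    by (intro continuous_intros continuous_on_compose2[OF cont zc]) auto
  have eq: "z t = z ?a + integral {?a..t} (\<lambda>r. (1 / h) *\<^sub>R W i (z r))" if t: "t \<in> {?a..?b}" for t
  proof -
    have "z t - z ?a = integral {?a..t} (\<lambda>r. (1 / h) *\<^sub>R W (cell h n r) (z r))"
      by (rule ode_solution_increment(1)[OF z]) (use ab t in auto)
    also have "\<dots> = integral {?a..t} (\<lambda>r. (1 / h) *\<^sub>R W i (z r))"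
    proof (rule integral_spike[of "{?b}"])
      fix r assume "r \<in> {?a..t} - {?b}"
      then have "cell h n r = i" using t by (intro cell_eq h i) auto
      then show "(1 / h) *\<^sub>R W i (z r) = (1 / h) *\<^sub>R W (cell h n r) (z r)" by simp
    qed simp
    finally show ?thesis by (simp add: algebra_simps)
  qed
  let ?f = "\<lambda>\<rho>. ?a + \<rho> * h"
  have im: "?f ` {0..1} \<subseteq> {?a..?b}"
    using h by (auto simp: algebra_simps mult_left_le_one_le)
  have fr: "?f \<rho> \<in> {?a..?b}" using im \<rho> by blast
  have "((\<lambda>t. z ?a + integral {?a..t} (\<lambda>r. (1 / h) *\<^sub>R W i (z r))) has_vector_derivative (0 + (1 / h) *\<^sub>R W i (z (?f \<rho>)))) (at (?f \<rho>) within {?a..?b})"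
    by (intro has_vector_derivative_add has_vector_derivative_const integral_has_vector_derivative Wz fr)
  then have D: "((\<lambda>t. z ?a + integral {?a..t} (\<lambda>r. (1 / h) *\<^sub>R W i (z r))) has_vector_derivative (1 / h) *\<^sub>R W i (z (?f \<rho>))) (at (?f \<rho>) within {?a..?b})"
    by simp
  have "(z has_vector_derivative (1 / h) *\<^sub>R W i (z (?f \<rho>))) (at (?f \<rho>) within {?a..?b})"
    by (rule has_vector_derivative_transform[OF fr eq D])
  then have g: "(z has_vector_derivative (1 / h) *\<^sub>R W i (z (?f \<rho>))) (at (?f \<rho>) within ?f ` {0..1})"
    by (rule has_vector_derivative_within_subset[OF _ im])
  have f: "(?f has_vector_derivative h) (at \<rho> within {0..1})"
    by (auto intro!: derivative_eq_intros simp flip: has_real_derivative_iff_has_vector_derivative)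
  from vector_diff_chain_within[OF f g] show ?thesis using h by (simp add: o_def)
qed

section \<open>Discrete sewing\<close>

fun iterate :: "(nat \<Rightarrow> nat \<Rightarrow> 'a \<Rightarrow> 'a) \<Rightarrow> nat \<Rightarrow> nat \<Rightarrow> 'a \<Rightarrow> 'a" where
  "iterate e i 0 x = x"
| "iterate e i (Suc m) x = e (i + m) (Suc (i + m)) (iterate e i m x)"

lemma iterate_add: "iterate e i (m + m') x = iterate e (i + m) m' (iterate e i m x)"
  by (induction m') (auto simp: add.assoc)

lemma iterate_Suc_start: "iterate e i (Suc m) x = iterate e (Suc i) m (e i (Suc i) x)"
  using iterate_add[of e i 1 m x] by simp

text \<open>\<open>e i j\<close> approximates the evolution from grid time \<open>i h\<close> to
  grid time \<open>j h\<close>. The maps are close to the identity of order \<open>\<alpha>\<close>,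
  and the flow property holds up to order \<open>\<theta>\<close>, for values as well as for
  Lipschitz constants. Distances in time above \<open>1\<close> are excluded, so that higher powers
  of the distance are smaller.\<close>
definition almost_flow ::
  "real \<Rightarrow> real \<Rightarrow> real \<Rightarrow> (nat \<Rightarrow> nat \<Rightarrow> 'a::real_normed_vector \<Rightarrow> 'a) \<Rightarrow> real \<Rightarrow> nat \<Rightarrow> bool" where
  "almost_flow C \<alpha> \<theta> e h n \<longleftrightarrow>
    (\<forall>i j. i \<le> j \<and> j \<le> n \<and> real (j - i) * h \<le> 1 \<longrightarrow>
       (\<forall>a b. norm (e i j a - e i j b) \<le> (1 + C * (real (j - i) * h) powr \<alpha>) * norm (a - b)) \<and>
       (\<forall>a b c d. norm (e i j a - e i j b - e i j c + e i j d) \<le>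
          (1 + C * (real (j - i) * h) powr \<alpha>) * norm (a - b - c + d)
          + C * (real (j - i) * h) powr \<alpha> * (norm (a - b) * norm (b - d)))) \<and>
    (\<forall>i j l. i \<le> j \<and> j \<le> l \<and> l \<le> n \<and> real (l - i) * h \<le> 1 \<longrightarrow>
       (\<forall>a. norm (e j l (e i j a) - e i l a) \<le> C * (real (l - i) * h) powr \<theta>) \<and>
       (\<forall>a b. norm ((e j l (e i j a) - e i l a) - (e j l (e i j b) - e i l b))
          \<le> C * (real (l - i) * h) powr \<theta> * norm (a - b)))"

lemma almost_flowD:
  assumes "almost_flow C \<alpha> \<theta> e h n"
  shows almost_flow_lipschitz: "i \<le> j \<Longrightarrow> j \<le> n \<Longrightarrow> real (j - i) * h \<le> 1 \<Longrightarrow>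
      norm (e i j a - e i j b) \<le> (1 + C * (real (j - i) * h) powr \<alpha>) * norm (a - b)"
    and almost_flow_four_point: "i \<le> j \<Longrightarrow> j \<le> n \<Longrightarrow> real (j - i) * h \<le> 1 \<Longrightarrow>
      norm (e i j a - e i j b - e i j c + e i j d) \<le>
          (1 + C * (real (j - i) * h) powr \<alpha>) * norm (a - b - c + d)
          + C * (real (j - i) * h) powr \<alpha> * (norm (a - b) * norm (b - d))"
    and almost_flow_defect: "i \<le> j \<Longrightarrow> j \<le> l \<Longrightarrow> l \<le> n \<Longrightarrow> real (l - i) * h \<le> 1 \<Longrightarrow>
      norm (e j l (e i j a) - e i l a) \<le> C * (real (l - i) * h) powr \<theta>"
    and almost_flow_defect_lipschitz: "i \<le> j \<Longrightarrow> j \<le> l \<Longrightarrow> l \<le> n \<Longrightarrow> real (l - i) * h \<le> 1 \<Longrightarrow>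
      norm ((e j l (e i j a) - e i l a) - (e j l (e i j b) - e i l b)) \<le> C * (real (l - i) * h) powr \<theta> * norm (a - b)"
proof -
  note F1 = assms[unfolded almost_flow_def, THEN conjunct1, rule_format]
    and F2 = assms[unfolded almost_flow_def, THEN conjunct2, rule_format]
  show "i \<le> j \<Longrightarrow> j \<le> n \<Longrightarrow> real (j - i) * h \<le> 1 \<Longrightarrow>
      norm (e i j a - e i j b) \<le> (1 + C * (real (j - i) * h) powr \<alpha>) * norm (a - b)"
    by (rule F1[THEN conjunct1, rule_format]) simp
  show "i \<le> j \<Longrightarrow> j \<le> n \<Longrightarrow> real (j - i) * h \<le> 1 \<Longrightarrow>
      norm (e i j a - e i j b - e i j c + e i j d) \<le>
          (1 + C * (real (j - i) * h) powr \<alpha>) * norm (a - b - c + d)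
          + C * (real (j - i) * h) powr \<alpha> * (norm (a - b) * norm (b - d))"
    by (rule F1[THEN conjunct2, rule_format]) simp
  show "i \<le> j \<Longrightarrow> j \<le> l \<Longrightarrow> l \<le> n \<Longrightarrow> real (l - i) * h \<le> 1 \<Longrightarrow>
      norm (e j l (e i j a) - e i l a) \<le> C * (real (l - i) * h) powr \<theta>"
    by (rule F2[THEN conjunct1, rule_format]) simp
  show "i \<le> j \<Longrightarrow> j \<le> l \<Longrightarrow> l \<le> n \<Longrightarrow> real (l - i) * h \<le> 1 \<Longrightarrow>
      norm ((e j l (e i j a) - e i l a) - (e j l (e i j b) - e i l b)) \<le> C * (real (l - i) * h) powr \<theta> * norm (a - b)"
    by (rule F2[THEN conjunct2, rule_format]) simp
qed

text \<open>The gain of the sewing argument: for \<open>\<theta> > 1\<close> splitting an interval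
  into two parts, neither of them longer than two thirds, shrinks the sum of the
  \<open>\<theta>\<close>-th powers by a fixed factor below \<open>1\<close>.\<close>
lemma powr_split_le:
  fixes s1 s2 \<theta> :: real
  assumes "0 < s1" "0 < s2" "s1 \<le> 2 / 3 * (s1 + s2)" "s2 \<le> 2 / 3 * (s1 + s2)" "1 < \<theta>"
  shows "s1 powr \<theta> + s2 powr \<theta> \<le> (2 / 3) powr (\<theta> - 1) * (s1 + s2) powr \<theta>"
proof -
  have p: "u powr \<theta> \<le> u * ((2 / 3) powr (\<theta> - 1) * (s1 + s2) powr (\<theta> - 1))" if "0 < u" "u \<le> 2 / 3 * (s1 + s2)" for u
  proof -
    have "u powr \<theta> = u * u powr (\<theta> - 1)" using that powr_add[of u 1 "\<theta> - 1"] by simp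
    also have "u powr (\<theta> - 1) \<le> (2 / 3 * (s1 + s2)) powr (\<theta> - 1)"
      using that assms by (intro powr_mono2) auto
    also have "\<dots> = (2 / 3) powr (\<theta> - 1) * (s1 + s2) powr (\<theta> - 1)"
      using assms by (subst powr_mult) auto
    finally show ?thesis using that by simp
  qed
  have "s1 powr \<theta> + s2 powr \<theta> \<le> (s1 + s2) * ((2 / 3) powr (\<theta> - 1) * (s1 + s2) powr (\<theta> - 1))"
    using p[of s1] p[of s2] assms by (simp add: algebra_simps)
  also have "\<dots> = (2 / 3) powr (\<theta> - 1) * (s1 + s2) powr \<theta>"
    using assms powr_add[of "s1 + s2" 1 "\<theta> - 1"] by (simp add: mult_ac)
  finally show ?thesis .
qed

text \<open>Davie's argument: the interval is split in the middle, and the error of the composition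
  over the whole interval is the error of the second half, plus the error of the first half
  transported by \<open>e\<close>, plus one defect. The transport costs a factor
  \<open>\<Lambda>\<close> close to \<open>1\<close> on short intervals, which the factor
  \<open>\<kappa>\<close> gained by splitting compensates, so the constant \<open>K\<close>
  reproduces itself. Values and Lipschitz constants are treated together, since the Lipschitz
  estimate of the composition is needed to transport differences; this is also where the four point
  estimate enters.\<close>
lemma discrete_sewing_step:
  fixes e :: "nat \<Rightarrow> nat \<Rightarrow> 'a::real_normed_vector \<Rightarrow> 'a"
  assumes flow: "almost_flow C \<alpha> \<theta> e h n" and h: "h > 0" and C: "C \<ge> 0" and K: "K \<ge> 0" and \<theta>: "1 < \<theta>" and \<alpha>: "0 < \<alpha>"
    and \<delta>: "0 < \<delta>" "\<delta> \<le> 1"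
    and \<kappa>: "\<kappa> = (2 / 3) powr (\<theta> - 1)"
    and \<Lambda>: "(1 + C * \<delta> powr \<alpha>)\<^sup>2 \<le> \<Lambda>" "1 + C * \<delta> powr \<alpha> + K * \<delta> powr \<theta> \<le> \<Lambda>"
    and close: "K * (\<kappa> * \<Lambda>) + C \<le> K"
    and m: "1 \<le> m" "i + m \<le> n" "real m * h \<le> \<delta>"
  shows "(\<forall>a. norm (iterate e i m a - e i (i + m) a) \<le> K * (real m * h) powr \<theta>) \<and>
    (\<forall>a b. norm ((iterate e i m a - e i (i + m) a) - (iterate e i m b - e i (i + m) b)) \<le> K * (real m * h) powr \<theta> * norm (a - b))"
  using m
proof (induction m arbitrary: i rule: less_induct)
  case (less m)
  show ?case
  proof (cases "m = 1")
    case True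
    then show ?thesis using K by simp
  next
    case False
    \<comment> \<open>For \<open>m \<ge> 2\<close> neither half exceeds two thirds of \<open>m\<close>; the worst case is \<open>m = 3\<close>.\<close>
    define m1 where "m1 = m div 2"
    define m2 where "m2 = m - m1"
    have m2ge: "2 \<le> m" using False less.prems by simp
    have m12: "1 \<le> m1" "1 \<le> m2" "m1 < m" "m2 < m" "m1 + m2 = m"
      using m2ge by (auto simp: m1_def m2_def)
    have m23: "3 * m1 \<le> 2 * m" "3 * m2 \<le> 2 * m"
      using m2ge by (auto simp: m1_def m2_def)
    let ?j = "i + m1" and ?l = "i + m"
    let ?s = "real m * h" and ?s1 = "real m1 * h" and ?s2 = "real m2 * h"
    have s: "0 < ?s1" "0 < ?s2" "?s1 + ?s2 = ?s" "?s \<le> \<delta>" "?s1 \<le> ?s" "?s2 \<le> ?s"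
      using h m12 less.prems by (auto simp flip: distrib_right of_nat_add)
    have s23: "?s1 \<le> 2 / 3 * (?s1 + ?s2)" "?s2 \<le> 2 / 3 * (?s1 + ?s2)"
    proof -
      have "real (3 * m1) * h \<le> real (2 * m) * h" "real (3 * m2) * h \<le> real (2 * m) * h"
        using m23 h by (intro mult_right_mono; simp only: of_nat_le_iff; simp)+
      then show "?s1 \<le> 2 / 3 * (?s1 + ?s2)" "?s2 \<le> 2 / 3 * (?s1 + ?s2)" unfolding s(3) by auto
    qed
    define A where "A = C * \<delta> powr \<alpha>"
    have A0: "0 \<le> A" using C by (simp add: A_def)
    have sA: "C * u powr \<alpha> \<le> A" if "0 < u" "u \<le> \<delta>" for u
      unfolding A_def using that C \<alpha> by (intro mult_left_mono powr_mono2) auto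
    let ?p1 = "?s1 powr \<theta>" and ?p2 = "?s2 powr \<theta>" and ?p = "?s powr \<theta>"
    have p: "?p1 + ?p2 \<le> \<kappa> * ?p"
      using powr_split_le[OF s(1,2) s23 \<theta>] unfolding s(3) \<kappa> .
    have p\<delta>: "?p1 \<le> \<delta> powr \<theta>" using s \<theta> by (intro powr_mono2) auto
    have p0: "0 \<le> ?p1" "0 \<le> ?p2" "0 \<le> ?p" by auto
    have \<Lambda>1: "(1 + A) * (1 + A) \<le> \<Lambda>" using \<Lambda>(1) by (simp add: A_def power2_eq_square)
    have \<Lambda>2: "1 + A + K * ?p1 \<le> \<Lambda>"
      using \<Lambda>(2) mult_left_mono[OF p\<delta> K] by (simp add: A_def)
    have \<Lambda>3: "1 + A \<le> \<Lambda>" "1 \<le> \<Lambda>" using \<Lambda>2 A0 K p0(1) mult_nonneg_nonneg[OF K p0(1)] by linarith+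
    have ij: "i \<le> ?j" "?j \<le> n" "?j - i = m1" and jl: "?j \<le> ?l" "?l \<le> n" "?l - ?j = m2" "?l - i = m" "i \<le> ?l"
      using m12 less.prems by auto
    have le1: "real (?j - i) * h \<le> 1" "real (?l - ?j) * h \<le> 1" "real (?l - i) * h \<le> 1"
      using s \<delta> ij jl by auto
    have lip_ij: "norm (e i ?j a - e i ?j b) \<le> (1 + A) * norm (a - b)" for a b
    proof -
      have "norm (e i ?j a - e i ?j b) \<le> (1 + C * ?s1 powr \<alpha>) * norm (a - b)"
        using almost_flow_lipschitz[OF flow ij(1,2) le1(1), of a b] unfolding ij(3) .
      also have "\<dots> \<le> (1 + A) * norm (a - b)" using sA[of ?s1] s by (intro mult_right_mono) auto
      finally show ?thesis .
    qed
    have lip_jl: "norm (e ?j ?l a - e ?j ?l b) \<le> (1 + A) * norm (a - b)" for a b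
    proof -
      have "norm (e ?j ?l a - e ?j ?l b) \<le> (1 + C * ?s2 powr \<alpha>) * norm (a - b)"
        using almost_flow_lipschitz[OF flow jl(1,2) le1(2), of a b] unfolding jl(3) .
      also have "\<dots> \<le> (1 + A) * norm (a - b)" using sA[of ?s2] s by (intro mult_right_mono) auto
      finally show ?thesis .
    qed
    have fp_jl: "norm (e ?j ?l a - e ?j ?l b - e ?j ?l c + e ?j ?l d) \<le> (1 + A) * norm (a - b - c + d) + A * (norm (a - b) * norm (b - d))" for a b c d
    proof -
      have "norm (e ?j ?l a - e ?j ?l b - e ?j ?l c + e ?j ?l d) \<le> (1 + C * ?s2 powr \<alpha>) * norm (a - b - c + d) + C * ?s2 powr \<alpha> * (norm (a - b) * norm (b - d))"
        using almost_flow_four_point[OF flow jl(1,2) le1(2), of a b c d] unfolding jl(3) .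
      also have "\<dots> \<le> (1 + A) * norm (a - b - c + d) + A * (norm (a - b) * norm (b - d))"
        using sA[of ?s2] s by (intro add_mono mult_right_mono) auto
      finally show ?thesis .
    qed
    have R: "norm (e ?j ?l (e i ?j a) - e i ?l a) \<le> C * ?p" 
      and RL: "norm ((e ?j ?l (e i ?j a) - e i ?l a) - (e ?j ?l (e i ?j b) - e i ?l b)) \<le> C * ?p * norm (a - b)" for a b
      using almost_flow_defect[OF flow ij(1) jl(1,2) le1(3), of a]
        almost_flow_defect_lipschitz[OF flow ij(1) jl(1,2) le1(3), of a b] unfolding jl(4) .
    let ?E1 = "iterate e i m1" and ?E2 = "iterate e ?j m2"
    have IH1: "norm (?E1 a - e i ?j a) \<le> K * ?p1"
      and IH1': "norm ((?E1 a - e i ?j a) - (?E1 b - e i ?j b)) \<le> K * ?p1 * norm (a - b)" for a b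
      using less.IH[of m1 i] m12 less.prems s by auto
    have IH2: "norm (?E2 a - e ?j ?l a) \<le> K * ?p2"
      and IH2': "norm ((?E2 a - e ?j ?l a) - (?E2 b - e ?j ?l b)) \<le> K * ?p2 * norm (a - b)" for a b
      using less.IH[of m2 ?j] m12 less.prems s by (auto simp: add.assoc)
    have E: "iterate e i m a = ?E2 (?E1 a)" for a
      using iterate_add[of e i m1 m2 a] m12 by simp
    have final: "K * \<Lambda> * (?p1 + ?p2) + C * ?p \<le> K * ?p"
    proof -
      have "K * \<Lambda> * (?p1 + ?p2) + C * ?p \<le> K * \<Lambda> * (\<kappa> * ?p) + C * ?p"
        using p K \<Lambda>3 by (intro add_right_mono mult_left_mono) auto
      also have "\<dots> = (K * (\<kappa> * \<Lambda>) + C) * ?p" by (simp add: algebra_simps)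
      also have "\<dots> \<le> K * ?p" using close by (intro mult_right_mono) auto
      finally show ?thesis .
    qed
    have Kp: "0 \<le> K * ?p1" "0 \<le> K * ?p2" using K by auto
    have sup: "norm (iterate e i m a - e i ?l a) \<le> K * ?p" for a
    proof -
      have "iterate e i m a - e i ?l a = (?E2 (?E1 a) - e ?j ?l (?E1 a)) + (e ?j ?l (?E1 a) - e ?j ?l (e i ?j a)) + (e ?j ?l (e i ?j a) - e i ?l a)"
        by (simp add: E)
      also have "norm \<dots> \<le> K * ?p2 + (1 + A) * (K * ?p1) + C * ?p"
        using IH2[of "?E1 a"] R[of a] order_trans[OF lip_jl[of "?E1 a" "e i ?j a"] mult_left_mono[OF IH1[of a], of "1 + A"]] A0
        by (intro norm_triangle_le add_mono) auto
      also have "\<dots> \<le> \<Lambda> * (K * ?p2) + \<Lambda> * (K * ?p1) + C * ?p"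
        using mult_right_mono[OF \<Lambda>3(2) Kp(2)] mult_right_mono[OF \<Lambda>3(1) Kp(1)] by simp
      also have "\<dots> = K * \<Lambda> * (?p1 + ?p2) + C * ?p" by (simp add: algebra_simps)
      also note final
      finally show ?thesis .
    qed
    have alg: "k * q * (l * n) + l * (k * p * n) + c * r * n = (k * l * (p + q) + c * r) * n" for k l p q r c n :: real
      by (simp add: algebra_simps)
    have lip: "norm ((iterate e i m a - e i ?l a) - (iterate e i m b - e i ?l b)) \<le> K * ?p * norm (a - b)" for a b
    proof -
      let ?n = "norm (a - b)"
      have E1L: "norm (?E1 a - ?E1 b) \<le> \<Lambda> * ?n"
      proof -
        have "?E1 a - ?E1 b = ((?E1 a - e i ?j a) - (?E1 b - e i ?j b)) + (e i ?j a - e i ?j b)" by simp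
        also have "norm \<dots> \<le> K * ?p1 * ?n + (1 + A) * ?n"
          by (intro norm_triangle_le add_mono IH1' lip_ij)
        also have "\<dots> = (1 + A + K * ?p1) * ?n" by (simp add: algebra_simps)
        also have "\<dots> \<le> \<Lambda> * ?n" by (intro mult_right_mono \<Lambda>2) auto
        finally show ?thesis .
      qed
      have 1: "norm ((?E2 (?E1 a) - e ?j ?l (?E1 a)) - (?E2 (?E1 b) - e ?j ?l (?E1 b))) \<le> K * ?p2 * (\<Lambda> * ?n)"
        by (rule order_trans[OF IH2' mult_left_mono[OF E1L Kp(2)]])
      have 2: "norm (e ?j ?l (?E1 a) - e ?j ?l (e i ?j a) - e ?j ?l (?E1 b) + e ?j ?l (e i ?j b)) \<le> \<Lambda> * (K * ?p1 * ?n)"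
      proof -
        have "norm (e ?j ?l (?E1 a) - e ?j ?l (e i ?j a) - e ?j ?l (?E1 b) + e ?j ?l (e i ?j b))
          \<le> (1 + A) * norm (?E1 a - e i ?j a - ?E1 b + e i ?j b) + A * (norm (?E1 a - e i ?j a) * norm (e i ?j a - e i ?j b))"
          by (rule fp_jl)
        also have "\<dots> \<le> (1 + A) * (K * ?p1 * ?n) + A * (K * ?p1 * ((1 + A) * ?n))"
        proof (intro add_mono mult_left_mono mult_mono)
          show "norm (?E1 a - e i ?j a - ?E1 b + e i ?j b) \<le> K * ?p1 * ?n"
            using IH1'[of a b] by (simp add: algebra_simps)
        qed (use A0 Kp IH1 lip_ij in auto)
        also have "\<dots> = ((1 + A) * (1 + A)) * (K * ?p1 * ?n)" by (simp add: algebra_simps)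
        also have "\<dots> \<le> \<Lambda> * (K * ?p1 * ?n)" using Kp by (intro mult_right_mono \<Lambda>1) auto
        finally show ?thesis .
      qed
      have "(iterate e i m a - e i ?l a) - (iterate e i m b - e i ?l b)
        = ((?E2 (?E1 a) - e ?j ?l (?E1 a)) - (?E2 (?E1 b) - e ?j ?l (?E1 b)))
        + (e ?j ?l (?E1 a) - e ?j ?l (e i ?j a) - e ?j ?l (?E1 b) + e ?j ?l (e i ?j b))
        + ((e ?j ?l (e i ?j a) - e i ?l a) - (e ?j ?l (e i ?j b) - e i ?l b))"
        by (simp add: E)
      also have "norm \<dots> \<le> K * ?p2 * (\<Lambda> * ?n) + \<Lambda> * (K * ?p1 * ?n) + C * ?p * ?n"
        by (intro norm_triangle_le add_mono 1 2 RL)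
      also have "\<dots> = (K * \<Lambda> * (?p1 + ?p2) + C * ?p) * ?n" by (rule alg)
      also have "\<dots> \<le> K * ?p * ?n" by (intro mult_right_mono final) auto
      finally show ?thesis .
    qed
    show ?thesis using sup lip by blast
  qed
qed

text \<open>The constants depend on \<open>C\<close>, \<open>\<alpha>\<close> and
  \<open>\<theta>\<close> only, in particular neither on the maps nor on the mesh.\<close>
theorem discrete_sewing:
  fixes C \<alpha> \<theta> :: real
  assumes C: "C \<ge> 0" and \<alpha>: "0 < \<alpha>" and \<theta>: "1 < \<theta>"
  shows "\<exists>\<delta> K \<Lambda>. 0 < \<delta> \<and> \<delta> \<le> 1 \<and> 0 \<le> K \<and> 1 \<le> \<Lambda> \<and>
    (\<forall>(e :: nat \<Rightarrow> nat \<Rightarrow> 'a::real_normed_vector \<Rightarrow> 'a) h n. 0 < h \<and> almost_flow C \<alpha> \<theta> e h n \<longrightarrow>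
      (\<forall>i m. i + m \<le> n \<and> real m * h \<le> \<delta> \<longrightarrow>
        (1 \<le> m \<longrightarrow> (\<forall>a. norm (iterate e i m a - e i (i + m) a) \<le> K * (real m * h) powr \<theta>)) \<and>
        (\<forall>a b. norm (iterate e i m a - iterate e i m b) \<le> \<Lambda> * norm (a - b))))"
proof -
  define \<kappa> where "\<kappa> = (2 / 3 :: real) powr (\<theta> - 1)"
  have \<kappa>: "0 < \<kappa>" "\<kappa> < 1"
    unfolding \<kappa>_def using \<theta> by (auto simp: powr01_less_one)
  \<comment> \<open>Halfway between \<open>1\<close> and \<open>1 / \<kappa>\<close>, so that \<open>\<Lambda> > 1\<close> leaves room for small intervals while \<open>\<kappa> * \<Lambda> < 1\<close>; then \<open>K\<close> solves \<open>K * (\<kappa> * \<Lambda>) + C = K\<close>.\<close>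
  define \<Lambda> where "\<Lambda> = (1 + 1 / \<kappa>) / 2"
  have \<Lambda>: "1 < \<Lambda>" using \<kappa> by (simp add: \<Lambda>_def field_simps)
  have \<kappa>\<Lambda>: "\<kappa> * \<Lambda> = (1 + \<kappa>) / 2" using \<kappa> by (simp add: \<Lambda>_def field_simps)
  define K where "K = 2 * C / (1 - \<kappa>)"
  have K: "0 \<le> K" using C \<kappa> by (simp add: K_def)
  have close: "K * (\<kappa> * \<Lambda>) + C \<le> K" unfolding \<kappa>\<Lambda> K_def using \<kappa> by (simp add: field_simps)
  have pw: "((\<lambda>s::real. s powr a) \<longlongrightarrow> 0) (at_right 0)" if "0 < a" for a :: real
    by (rule tendsto_zero_powrI[OF _ tendsto_const _ that])
       (auto intro!: tendsto_ident_at simp: eventually_at_right_less eventually_at_topological)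
  have l1: "((\<lambda>s. (1 + C * s powr \<alpha>)\<^sup>2) \<longlongrightarrow> (1 + C * 0)\<^sup>2) (at_right 0)"
    by (intro tendsto_intros pw \<alpha>)
  have l2: "((\<lambda>s. 1 + C * s powr \<alpha> + K * s powr \<theta>) \<longlongrightarrow> 1 + C * 0 + K * 0) (at_right 0)"
    by (intro tendsto_intros pw) (use \<alpha> \<theta> in auto)
  have "\<forall>\<^sub>F s in at_right 0. (1 + C * s powr \<alpha>)\<^sup>2 < \<Lambda>"
    using order_tendstoD(2)[OF l1, of \<Lambda>] \<Lambda> by simp
  moreover have "\<forall>\<^sub>F s in at_right 0. 1 + C * s powr \<alpha> + K * s powr \<theta> < \<Lambda>"
    using order_tendstoD(2)[OF l2, of \<Lambda>] \<Lambda> by simp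
  moreover have "\<forall>\<^sub>F s in at_right (0::real). s < 1"
    by (rule eventually_at_rightI[of _ 1]) auto
  moreover have "\<forall>\<^sub>F s in at_right (0::real). 0 < s" by (rule eventually_at_right_less)
  ultimately have "\<forall>\<^sub>F s in at_right 0. 0 < s \<and> s < 1 \<and> (1 + C * s powr \<alpha>)\<^sup>2 < \<Lambda> \<and> 1 + C * s powr \<alpha> + K * s powr \<theta> < \<Lambda>"
    by eventually_elim auto
  from eventually_happens'[OF trivial_limit_at_right_real this] obtain \<delta> where \<delta>: "0 < \<delta>" "\<delta> < 1" "(1 + C * \<delta> powr \<alpha>)\<^sup>2 < \<Lambda>" "1 + C * \<delta> powr \<alpha> + K * \<delta> powr \<theta> < \<Lambda>"
    by blast
  show ?thesis
  proof (rule exI[of _ \<delta>], rule exI[of _ K], rule exI[of _ \<Lambda>], intro conjI allI impI)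
    fix e :: "nat \<Rightarrow> nat \<Rightarrow> 'a \<Rightarrow> 'a" and h n i m
    assume eh: "0 < h \<and> almost_flow C \<alpha> \<theta> e h n" and im: "i + m \<le> n \<and> real m * h \<le> \<delta>"
    note st = discrete_sewing_step[of C \<alpha> \<theta> e h n K \<delta> \<kappa> \<Lambda> m i]
    have S: "(\<forall>a. norm (iterate e i m a - e i (i + m) a) \<le> K * (real m * h) powr \<theta>) \<and>
      (\<forall>a b. norm ((iterate e i m a - e i (i + m) a) - (iterate e i m b - e i (i + m) b)) \<le> K * (real m * h) powr \<theta> * norm (a - b))"
      if "1 \<le> m"
      by (rule st) (use eh im C K \<theta> \<alpha> \<delta> close \<kappa>_def that in auto)
    show "norm (iterate e i m a - e i (i + m) a) \<le> K * (real m * h) powr \<theta>" if "1 \<le> m" for a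
      using S that by blast
    show "norm (iterate e i m a - iterate e i m b) \<le> \<Lambda> * norm (a - b)" for a b
    proof (cases "1 \<le> m")
      case False
      then have "m = 0" by simp
      then show ?thesis using mult_right_mono[of 1 \<Lambda> "norm (a - b)"] \<Lambda> by simp
    next
      case True
      let ?s = "real m * h"
      have s: "0 < ?s" "?s \<le> \<delta>" using True eh im by auto
      have "norm (e i (i + m) a - e i (i + m) b) \<le> (1 + C * ?s powr \<alpha>) * norm (a - b)"
        using almost_flow_lipschitz[of C \<alpha> \<theta> e h n i "i + m" a b] eh im s \<delta> by simp
      then have "norm (iterate e i m a - iterate e i m b) \<le> K * ?s powr \<theta> * norm (a - b) + (1 + C * ?s powr \<alpha>) * norm (a - b)"
        using S[OF True, THEN conjunct2, rule_format, of a b]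
          norm_triangle_ineq[of "(iterate e i m a - e i (i + m) a) - (iterate e i m b - e i (i + m) b)" "e i (i + m) a - e i (i + m) b"]
        by simp
      also have "\<dots> = (1 + C * ?s powr \<alpha> + K * ?s powr \<theta>) * norm (a - b)" by (simp add: algebra_simps)
      also have "\<dots> \<le> \<Lambda> * norm (a - b)"
      proof (rule mult_right_mono)
        have "C * ?s powr \<alpha> \<le> C * \<delta> powr \<alpha>" "K * ?s powr \<theta> \<le> K * \<delta> powr \<theta>"
          using s C K \<alpha> \<theta> by (auto intro!: mult_left_mono powr_mono2)
        then show "1 + C * ?s powr \<alpha> + K * ?s powr \<theta> \<le> \<Lambda>" using \<delta>(4) by linarith
      qed simp
      finally show ?thesis .
    qed
  qed (use \<delta> K \<Lambda> in auto)
qed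

text \<open>Every local error is transported to the end by a composition with Lipschitz constant
  \<open>\<Lambda>\<close>, so errors add up and do not multiply.\<close>
lemma perturbed_trajectory:
  fixes e :: "nat \<Rightarrow> nat \<Rightarrow> 'a::real_normed_vector \<Rightarrow> 'a"
  assumes lip: "\<And>i m a b. i + m \<le> n \<Longrightarrow> real m * h \<le> \<delta> \<Longrightarrow> norm (iterate e i m a - iterate e i m b) \<le> \<Lambda> * norm (a - b)"
    and z: "\<And>i. i < n \<Longrightarrow> norm (z (Suc i) - e i (Suc i) (z i)) \<le> \<eta>" and \<Lambda>: "0 \<le> \<Lambda>" and h: "0 \<le> h"
    and im: "i + m \<le> n" "real m * h \<le> \<delta>"
  shows "norm (z (i + m) - iterate e i m (z i)) \<le> \<Lambda> * (real m * \<eta>)"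
  using im
proof (induction m arbitrary: i)
  case (Suc m)
  have mh: "real m * h \<le> \<delta>" using Suc.prems(2) h by (simp add: algebra_simps)
  have "z (i + Suc m) - iterate e i (Suc m) (z i)
     = (z (Suc i + m) - iterate e (Suc i) m (z (Suc i))) + (iterate e (Suc i) m (z (Suc i)) - iterate e (Suc i) m (e i (Suc i) (z i)))"
    unfolding iterate_Suc_start by simp
  also have "norm \<dots> \<le> \<Lambda> * (real m * \<eta>) + \<Lambda> * \<eta>"
  proof (intro norm_triangle_le add_mono)
    show "norm (z (Suc i + m) - iterate e (Suc i) m (z (Suc i))) \<le> \<Lambda> * (real m * \<eta>)"
      using Suc.IH[of "Suc i"] Suc.prems mh by simp
    have "norm (iterate e (Suc i) m (z (Suc i)) - iterate e (Suc i) m (e i (Suc i) (z i))) \<le> \<Lambda> * norm (z (Suc i) - e i (Suc i) (z i))"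
      using Suc.prems mh by (intro lip) auto
    also have "\<dots> \<le> \<Lambda> * \<eta>" using Suc.prems \<Lambda> by (intro mult_left_mono z) auto
    finally show "norm (iterate e (Suc i) m (z (Suc i)) - iterate e (Suc i) m (e i (Suc i) (z i))) \<le> \<Lambda> * \<eta>" .
  qed
  also have "\<dots> = \<Lambda> * (real (Suc m) * \<eta>)" by (simp add: algebra_simps)
  finally show ?case .
qed simp

text \<open>The Lipschitz bound for compositions is only available on intervals of length
  \<open>\<delta>\<close>. A long interval is covered by \<open>b\<close> blocks of \<open>Q\<close>
  steps, with \<open>b\<close> independent of the mesh, at the price of the factor \<open>\<Lambda>
  ^ b\<close>.\<close>
lemma perturbed_trajectories_close:
  fixes e :: "nat \<Rightarrow> nat \<Rightarrow> 'a::real_normed_vector \<Rightarrow> 'a"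
  assumes lip: "\<And>i m a b. i + m \<le> n \<Longrightarrow> real m * h \<le> \<delta> \<Longrightarrow> norm (iterate e i m a - iterate e i m b) \<le> \<Lambda> * norm (a - b)"
    and z: "\<And>i. i < n \<Longrightarrow> norm (z (Suc i) - e i (Suc i) (z i)) \<le> \<eta>"
    and w: "\<And>i. i < n \<Longrightarrow> norm (w (Suc i) - e i (Suc i) (w i)) \<le> \<eta>"
    and zw: "z 0 = w 0" and \<Lambda>: "1 \<le> \<Lambda>" and h: "0 \<le> h" and \<eta>: "0 \<le> \<eta>"
    and Q: "real Q * h \<le> \<delta>" "0 < Q" and i: "i \<le> b * Q" "i \<le> n"
  shows "norm (z i - w i) \<le> 2 * real b * (real Q * \<eta>) * \<Lambda> ^ b"
  using i
proof (induction b arbitrary: i)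
  case 0
  then show ?case using zw by simp
next
  case (Suc b)
  define i0 where "i0 = i - Q"
  define m where "m = i - i0"
  have m: "m \<le> Q" "i0 + m = i" "i0 \<le> b * Q" "i0 \<le> n" using Suc.prems by (auto simp: m_def i0_def)
  have mh: "real m * h \<le> \<delta>"
    using Q m(1) h mult_right_mono[of "real m" "real Q" h] by simp
  have im: "i0 + m \<le> n" using m Suc.prems by simp
  have \<Lambda>0: "0 \<le> \<Lambda>" using \<Lambda> by simp
  have IH: "norm (z i0 - w i0) \<le> 2 * real b * (real Q * \<eta>) * \<Lambda> ^ b" using Suc.IH m by blast
  have 1: "norm (z i - iterate e i0 m (z i0)) \<le> \<Lambda> * (real m * \<eta>)"
    using perturbed_trajectory[OF lip z \<Lambda>0 h im mh] m(2) by simp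
  have 2: "norm (w i - iterate e i0 m (w i0)) \<le> \<Lambda> * (real m * \<eta>)"
    using perturbed_trajectory[OF lip w \<Lambda>0 h im mh] m(2) by simp
  have 3: "norm (iterate e i0 m (z i0) - iterate e i0 m (w i0)) \<le> \<Lambda> * (2 * real b * (real Q * \<eta>) * \<Lambda> ^ b)"
    by (rule order_trans[OF lip[OF im mh] mult_left_mono[OF IH \<Lambda>0]])
  have mQ: "\<Lambda> * (real m * \<eta>) \<le> \<Lambda> * (real Q * \<eta>)"
    using m(1) \<eta> \<Lambda>0 by (intro mult_left_mono mult_right_mono) auto
  have "z i - w i = (z i - iterate e i0 m (z i0)) - (w i - iterate e i0 m (w i0)) + (iterate e i0 m (z i0) - iterate e i0 m (w i0))"
    by simp
  also have "norm \<dots> \<le> \<Lambda> * (real Q * \<eta>) + \<Lambda> * (real Q * \<eta>) + \<Lambda> * (2 * real b * (real Q * \<eta>) * \<Lambda> ^ b)"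
    using 1 2 3 mQ norm_triangle_ineq[of "(z i - iterate e i0 m (z i0)) - (w i - iterate e i0 m (w i0))" "iterate e i0 m (z i0) - iterate e i0 m (w i0)"]
      norm_triangle_ineq4[of "z i - iterate e i0 m (z i0)" "w i - iterate e i0 m (w i0)"] by linarith
  also have "\<dots> \<le> 2 * (real Q * \<eta>) * \<Lambda> ^ Suc b + \<Lambda> * (2 * real b * (real Q * \<eta>) * \<Lambda> ^ b)"
  proof -
    have "\<Lambda> * 1 \<le> \<Lambda> * \<Lambda> ^ b" using \<Lambda> by (intro mult_left_mono one_le_power) auto
    then have "2 * (real Q * \<eta>) * \<Lambda> \<le> 2 * (real Q * \<eta>) * \<Lambda> ^ Suc b" using \<eta> by (intro mult_left_mono) auto
    then show ?thesis by (simp add: algebra_simps)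
  qed
  also have "\<dots> = 2 * real (Suc b) * (real Q * \<eta>) * \<Lambda> ^ Suc b" by (simp add: algebra_simps)
  finally show ?case .
qed

section \<open>Estimates for the driver\<close>

text \<open>What the construction needs from the rough path: regularity of \<open>X\<close> and
  \<open>B\<close> with the right powers of the time increment, and Chen's relation for
  both.\<close>
definition driver_estimates ::
  "real \<Rightarrow> real \<Rightarrow> real \<Rightarrow> (real \<Rightarrow> real \<Rightarrow> ('d::finite) vfield) \<Rightarrow> (real \<Rightarrow> real \<Rightarrow> real^'d \<Rightarrow> real^'d \<Rightarrow> real^'d)
     \<Rightarrow> (real \<Rightarrow> real \<Rightarrow> 'd vfield) \<Rightarrow> bool" where
  "driver_estimates C \<alpha> T X D B \<longleftrightarrow>
     (\<forall>s t. 0 \<le> s \<and> s \<le> t \<and> t \<le> T \<longrightarrow>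
        regular_field (C * (t - s) powr \<alpha>) (X s t) (D s t) \<and> tame (C * (t - s) powr (2 * \<alpha>)) (B s t)) \<and>
     (\<forall>s u t \<xi>. 0 \<le> s \<and> s \<le> u \<and> u \<le> t \<and> t \<le> T \<longrightarrow>
        X s t \<xi> = X s u \<xi> + X u t \<xi> \<and> B s t \<xi> = B s u \<xi> + B u t \<xi> + D u t \<xi> (X s u \<xi>))"

lemma regular_field_mono: "regular_field M f D \<Longrightarrow> M \<le> N \<Longrightarrow> regular_field N f D"
proof -
  assume *: "regular_field M f D" and MN: "M \<le> N"
  have m: "x \<le> M * y \<Longrightarrow> 0 \<le> y \<Longrightarrow> x \<le> N * y" for x y
    using MN by (meson mult_right_mono order_trans)
  show ?thesis
    unfolding regular_field_def
  proof (intro conjI allI)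
    show "tame N f" using * MN by (auto simp: regular_field_def intro: tame_mono)
    show "linear (D \<xi>)" for \<xi> using * by (auto simp: regular_field_def)
    show "norm (D \<xi> v) \<le> N * norm v" for \<xi> v using * by (intro m) (auto simp: regular_field_def)
    show "norm (D a v - D b v) \<le> N * norm (a - b) * norm v" for a b v
      using * unfolding mult.assoc by (intro m) (auto simp: regular_field_def mult.assoc)
    show "norm (f (\<xi> + \<delta>) - f \<xi> - D \<xi> \<delta>) \<le> N * (norm \<delta>)\<^sup>2" for \<xi> \<delta>
      using * by (intro m) (auto simp: regular_field_def)
    show "norm ((f (\<xi> + \<delta>) - f \<xi> - D \<xi> \<delta>) - (f (\<eta> + \<epsilon>) - f \<eta> - D \<eta> \<epsilon>))
        \<le> N * ((norm \<delta>)\<^sup>2 * norm (\<xi> - \<eta>) + 2 * (norm \<delta> + norm \<epsilon>) * norm (\<delta> - \<epsilon>))" for \<xi> \<eta> \<delta> \<epsilon>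
      using * by (intro m) (auto simp: regular_field_def)
  qed
qed

lemma regular_fieldD:
  assumes "regular_field M f D"
  shows "tame M f" "linear (D \<xi>)" "norm (D \<xi> v) \<le> M * norm v"
    "norm (D a v - D b v) \<le> M * norm (a - b) * norm v"
    "norm (f (\<xi> + \<delta>) - f \<xi> - D \<xi> \<delta>) \<le> M * (norm \<delta>)\<^sup>2"
    "norm ((f (\<xi> + \<delta>) - f \<xi> - D \<xi> \<delta>) - (f (\<eta> + \<epsilon>) - f \<eta> - D \<eta> \<epsilon>))
        \<le> M * ((norm \<delta>)\<^sup>2 * norm (\<xi> - \<eta>) + 2 * (norm \<delta> + norm \<epsilon>) * norm (\<delta> - \<epsilon>))"
  using assms unfolding regular_field_def by auto

lemma tameD:
  assumes "tame M g"
  shows "norm (g a) \<le> M" "norm (g a - g b) \<le> M * norm (a - b)"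
    "norm (g a - g b - g c + g d) \<le> M * (norm (a - b - c + d) + norm (a - b) * norm (b - d))"
  using assms unfolding tame_def by auto

lemma tame_nonneg: "tame M g \<Longrightarrow> 0 \<le> M"
  using order_trans[OF norm_ge_zero tameD(1)] by blast

lemma linear_axis_sum:
  fixes L :: "real^'d::finite \<Rightarrow> real^'d"
  assumes "linear L"
  shows "(\<Sum>\<mu>\<in>UNIV. v $ \<mu> * L (axis \<mu> 1) $ \<nu>) = L v $ \<nu>"
proof -
  have e: "v = (\<Sum>\<mu>\<in>UNIV. v $ \<mu> *\<^sub>R axis \<mu> 1)"
    by (simp add: vec_eq_iff axis_def if_distrib cong: if_cong)
  have "L v = L (\<Sum>\<mu>\<in>UNIV. v $ \<mu> *\<^sub>R axis \<mu> 1)" by (rule arg_cong[where f=L, OF e])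
  also have "\<dots> = (\<Sum>\<mu>\<in>UNIV. v $ \<mu> *\<^sub>R L (axis \<mu> 1))"
    by (simp add: linear_sum[OF assms] linear_scale[OF assms])
  finally show ?thesis by simp
qed

lemma partial_eq:
  "(f has_derivative f') (at \<xi>) \<Longrightarrow> partial \<mu> f \<xi> = f' (axis \<mu> 1)"
  unfolding partial_def by (metis frechet_derivative_at)

lemma regular_tensor_has_derivative:
  fixes a :: "('d::finite) mfield"
  assumes "regular_tensor M a G"
  shows "((\<lambda>\<zeta>. a \<xi> \<zeta> $ \<mu> $ \<nu>) has_derivative (\<lambda>\<delta>. G \<mu> \<nu> \<xi> \<zeta> \<bullet> \<delta>)) (at \<zeta>)"
proof (rule quadratic_has_derivative)
  show "linear (\<lambda>\<delta>. G \<mu> \<nu> \<xi> \<zeta> \<bullet> \<delta>)" by (intro linearI) (auto simp: inner_add_right)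
  show "norm (a \<xi> (\<zeta> + \<delta>) $ \<mu> $ \<nu> - a \<xi> \<zeta> $ \<mu> $ \<nu> - G \<mu> \<nu> \<xi> \<zeta> \<bullet> \<delta>) \<le> M * (norm \<delta>)\<^sup>2" for \<delta>
    using assms by (simp add: regular_tensor_def)
qed

text \<open>The driver field is read off on coordinate functions, whose first derivatives are
  constant and whose second derivatives vanish.\<close>
lemma driver_field_eq:
  fixes x :: "real \<Rightarrow> ('d::finite) vfield"
  assumes X: "regular_field M (increment x s t) D" and x2: "regular_tensor N (x2 s t) G"
  shows "driver_field x x2 s t \<xi> = increment x s t \<xi> + ((\<chi> \<nu>. \<Sum>\<mu>\<in>UNIV. G \<mu> \<nu> \<xi> \<xi> $ \<mu>) - (1/2) *\<^sub>R D \<xi> (increment x s t \<xi>))"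
proof -
  let ?X = "increment x s t"
  have p1: "partial \<mu> (\<lambda>\<eta>::real^'d. \<eta> $ \<kappa>) \<xi> = (if \<kappa> = \<mu> then 1 else 0)" for \<mu> \<kappa> \<xi>
  proof -
    have "((\<lambda>\<eta>::real^'d. \<eta> $ \<kappa>) has_derivative (\<lambda>\<eta>. \<eta> $ \<kappa>)) (at \<xi>)"
      by (intro bounded_linear_imp_has_derivative bounded_linear_vec_nth)
    from partial_eq[OF this] show ?thesis by (simp add: axis_def)
  qed
  have p2: "partial \<mu> (partial \<nu> (\<lambda>\<eta>::real^'d. \<eta> $ \<kappa>)) \<xi> = 0" for \<mu> \<nu> \<kappa> \<xi>
  proof -
    have e: "partial \<nu> (\<lambda>\<eta>::real^'d. \<eta> $ \<kappa>) = (\<lambda>_. if \<kappa> = \<nu> then 1 else 0)"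
      by (rule ext) (rule p1)
    show ?thesis unfolding e by (rule partial_eq[OF has_derivative_const])
  qed
  have d1: "driver1 x s t (\<lambda>\<eta>. \<eta> $ \<kappa>) = (\<lambda>\<xi>. ?X \<xi> $ \<kappa>)" for \<kappa>
    unfolding driver1_def p1 by (simp add: if_distrib cong: if_cong)
  have pX: "partial \<mu> (\<lambda>\<xi>. ?X \<xi> $ \<kappa>) \<xi> = D \<xi> (axis \<mu> 1) $ \<kappa>" for \<mu> \<kappa> \<xi>
    by (rule partial_eq) (rule bounded_linear.has_derivative[OF bounded_linear_vec_nth regular_field_has_derivative[OF X]])
  have d11: "driver1 x s t (driver1 x s t (\<lambda>\<eta>. \<eta> $ \<kappa>)) \<xi> = D \<xi> (?X \<xi>) $ \<kappa>" for \<kappa>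
    unfolding d1 unfolding driver1_def pX by (rule linear_axis_sum[OF regular_fieldD(2)[OF X]])
  have pG: "partial \<mu> (\<lambda>\<zeta>. x2 s t \<xi> \<zeta> $ \<mu> $ \<nu>) \<xi> = G \<mu> \<nu> \<xi> \<xi> $ \<mu>" for \<mu> \<nu>
    using partial_eq[OF regular_tensor_has_derivative[OF x2]] by (simp add: inner_axis)
  have d2: "driver2 x2 s t (\<lambda>\<eta>. \<eta> $ \<kappa>) \<xi> = (\<Sum>\<mu>\<in>UNIV. G \<mu> \<kappa> \<xi> \<xi> $ \<mu>)" for \<kappa>
    unfolding driver2_def p2 pG p1 by (simp add: if_distrib cong: if_cong)
  show ?thesis
    by (simp add: driver_field_def driver_operator_def vec_eq_iff d11[unfolded d1] d2 d1)
qed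

text \<open>Chen's relation for \<open>B\<close> is the derivative of that for \<open>x2\<close> in
  the second variable: the tensor \<open>X\<^sub>s\<^sub>u \<otimes> X\<^sub>u\<^sub>t\<close>
  contributes the derivative of \<open>X\<^sub>u\<^sub>t\<close> in the direction
  \<open>X\<^sub>s\<^sub>u\<close>. Limits of tensors are compared through uniqueness of
  derivatives.\<close>
theorem rough_path_driver_estimates:
  fixes x :: "real \<Rightarrow> ('d::finite) vfield"
  assumes k: "k > real CARD('d) / 2 + 4" and q: "1 \<le> q" and rp: "rough_path q k \<alpha> T x x2"
  shows "\<exists>C D B. 1 \<le> C \<and> driver_estimates C \<alpha> T (increment x) D B \<and>
    (\<forall>s t \<xi>. 0 \<le> s \<and> s \<le> t \<and> t \<le> T \<longrightarrow>
       driver_field x x2 s t \<xi> = increment x s t \<xi> + (B s t \<xi> - (1/2) *\<^sub>R D s t \<xi> (increment x s t \<xi>)))"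
proof -
  let ?S = "symbol_const TYPE('d) k" and ?d = "real CARD('d)"
  have S0: "0 \<le> ?S" by (rule symbol_const_nonneg)
  obtain C1 where C1: "\<And>s t. s \<in> {0..T} \<Longrightarrow> t \<in> {0..T} \<Longrightarrow> sobolev_norm k (increment x s t) \<le> C1 * \<bar>t - s\<bar> powr \<alpha>"
    using rp unfolding rough_path_def by blast
  obtain C2 where C2: "\<And>s t. s \<in> {0..T} \<Longrightarrow> t \<in> {0..T} \<Longrightarrow> \<exists>r. has_tensor_norm q k (x2 s t) r \<and> r \<le> C2 * \<bar>t - s\<bar> powr (2 * \<alpha>)"
    using rp unfolding rough_path_def by blast
  have chen: "x2 s t \<xi> \<zeta> - x2 s u \<xi> \<zeta> - x2 u t \<xi> \<zeta> = tensor (increment x s u) (increment x u t) \<xi> \<zeta>"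
    if "s \<in> {0..T}" "u \<in> {0..T}" "t \<in> {0..T}" for s u t \<xi> \<zeta>
    using rp that unfolding rough_path_def by blast
  have xs: "x t \<in> sobolev_space k" if "t \<in> {0..T}" for t using rp that unfolding rough_path_def by blast
  define C where "C = max 1 (max (?d * (?S * C1)) (?d * (?d * (6 * ?S\<^sup>2 * C2))))"
  have C: "1 \<le> C" "?d * (?S * C1) \<le> C" "?d * (?d * (6 * ?S\<^sup>2 * C2)) \<le> C" by (auto simp: C_def)
  have "\<exists>D. regular_field (C * (t - s) powr \<alpha>) (increment x s t) D" if st: "0 \<le> s" "s \<le> t" "t \<le> T" for s t
  proof -
    have mem: "s \<in> {0..T}" "t \<in> {0..T}" using st by auto
    have "increment x s t \<in> sobolev_space k"
      unfolding increment_def by (intro sobolev_space_diff xs mem)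
    then obtain D where D: "regular_field (?d * (?S * sobolev_norm k (increment x s t))) (increment x s t) D"
      using sobolev_regular_field[OF k] by blast
    have "?d * (?S * sobolev_norm k (increment x s t)) \<le> ?d * (?S * (C1 * (t - s) powr \<alpha>))"
      using C1[OF mem] st S0 by (intro mult_left_mono) auto
    also have "\<dots> = (?d * (?S * C1)) * (t - s) powr \<alpha>" by simp
    also have "\<dots> \<le> C * (t - s) powr \<alpha>" using C by (intro mult_right_mono) auto
    finally show ?thesis using regular_field_mono[OF D] by blast
  qed
  then obtain D where D: "\<And>s t. 0 \<le> s \<Longrightarrow> s \<le> t \<Longrightarrow> t \<le> T \<Longrightarrow> regular_field (C * (t - s) powr \<alpha>) (increment x s t) (D s t)"
    by metis
  have "\<exists>G M. regular_tensor M (x2 s t) G \<and> ?d * (?d * M) \<le> C * (t - s) powr (2 * \<alpha>)" if st: "0 \<le> s" "s \<le> t" "t \<le> T" for s t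
  proof -
    have mem: "s \<in> {0..T}" "t \<in> {0..T}" using st by auto
    obtain r where r: "has_tensor_norm q k (x2 s t) r" "r \<le> C2 * (t - s) powr (2 * \<alpha>)"
      using C2[OF mem] st by auto
    obtain G where G: "regular_tensor (6 * ?S\<^sup>2 * r) (x2 s t) G"
      using tensor_norm_regular_tensor(1)[OF k q r(1)] by blast
    have "?d * (?d * (6 * ?S\<^sup>2 * r)) \<le> ?d * (?d * (6 * ?S\<^sup>2 * (C2 * (t - s) powr (2 * \<alpha>))))"
      using r(2) by (intro mult_left_mono) auto
    also have "\<dots> = (?d * (?d * (6 * ?S\<^sup>2 * C2))) * (t - s) powr (2 * \<alpha>)" by simp
    also have "\<dots> \<le> C * (t - s) powr (2 * \<alpha>)" using C by (intro mult_right_mono) auto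
    finally show ?thesis using G by blast
  qed
  then obtain G M where G: "\<And>s t. 0 \<le> s \<Longrightarrow> s \<le> t \<Longrightarrow> t \<le> T \<Longrightarrow> regular_tensor (M s t) (x2 s t) (G s t)"
    and M: "\<And>s t. 0 \<le> s \<Longrightarrow> s \<le> t \<Longrightarrow> t \<le> T \<Longrightarrow> ?d * (?d * M s t) \<le> C * (t - s) powr (2 * \<alpha>)"
    by metis
  define B where "B = (\<lambda>s t \<xi>. \<chi> \<nu>. \<Sum>\<mu>\<in>UNIV. G s t \<mu> \<nu> \<xi> \<xi> $ \<mu>)"
  have Btame: "tame (C * (t - s) powr (2 * \<alpha>)) (B s t)" if st: "0 \<le> s" "s \<le> t" "t \<le> T" for s t
  proof (rule tame_mono[OF tame_componentwise M[OF st]])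
    fix \<nu>
    have "tame (\<Sum>\<mu>\<in>(UNIV::'d set). M s t) (\<lambda>\<xi>. \<Sum>\<mu>\<in>UNIV. G s t \<mu> \<nu> \<xi> \<xi> $ \<mu>)"
      by (rule tame_sum) (use G[OF st] in \<open>auto simp: regular_tensor_def\<close>)
    then show "tame (?d * M s t) (\<lambda>\<xi>. B s t \<xi> $ \<nu>)" by (simp add: B_def)
  qed
  have Xchen: "increment x s t \<xi> = increment x s u \<xi> + increment x u t \<xi>" for s u t \<xi>
    by (simp add: increment_def)
  have Bchen: "B s t \<xi> = B s u \<xi> + B u t \<xi> + D u t \<xi> (increment x s u \<xi>)"
    if sut: "0 \<le> s" "s \<le> u" "u \<le> t" "t \<le> T" for s u t \<xi>
  proof -
    have le: "u \<le> T" "0 \<le> u" "s \<le> t" "0 \<le> t" using sut by auto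
    have mem: "s \<in> {0..T}" "u \<in> {0..T}" "t \<in> {0..T}" using sut by auto
    have "G s t \<mu> \<nu> \<xi> \<xi> $ \<kappa> = G s u \<mu> \<nu> \<xi> \<xi> $ \<kappa> + G u t \<mu> \<nu> \<xi> \<xi> $ \<kappa> + increment x s u \<xi> $ \<mu> * D u t \<xi> (axis \<kappa> 1) $ \<nu>" for \<mu> \<nu> \<kappa>
    proof -
      have eq: "(\<lambda>\<zeta>. x2 s t \<xi> \<zeta> $ \<mu> $ \<nu>) = (\<lambda>\<zeta>. x2 s u \<xi> \<zeta> $ \<mu> $ \<nu> + x2 u t \<xi> \<zeta> $ \<mu> $ \<nu> + increment x s u \<xi> $ \<mu> * increment x u t \<zeta> $ \<nu>)"
      proof
        fix \<zeta>
        have "(x2 s t \<xi> \<zeta> - x2 s u \<xi> \<zeta> - x2 u t \<xi> \<zeta>) $ \<mu> $ \<nu> = tensor (increment x s u) (increment x u t) \<xi> \<zeta> $ \<mu> $ \<nu>"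
          by (simp only: chen[OF mem])
        then show "x2 s t \<xi> \<zeta> $ \<mu> $ \<nu> = x2 s u \<xi> \<zeta> $ \<mu> $ \<nu> + x2 u t \<xi> \<zeta> $ \<mu> $ \<nu> + increment x s u \<xi> $ \<mu> * increment x u t \<zeta> $ \<nu>"
          by (simp add: tensor_def)
      qed
      have "((\<lambda>\<zeta>. x2 s u \<xi> \<zeta> $ \<mu> $ \<nu> + x2 u t \<xi> \<zeta> $ \<mu> $ \<nu> + increment x s u \<xi> $ \<mu> * increment x u t \<zeta> $ \<nu>) has_derivative
         (\<lambda>\<delta>. G s u \<mu> \<nu> \<xi> \<xi> \<bullet> \<delta> + G u t \<mu> \<nu> \<xi> \<xi> \<bullet> \<delta> + increment x s u \<xi> $ \<mu> * D u t \<xi> \<delta> $ \<nu>)) (at \<xi>)"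
        using sut le
        by (intro has_derivative_add has_derivative_mult_right regular_tensor_has_derivative[OF G]
            bounded_linear.has_derivative[OF bounded_linear_vec_nth regular_field_has_derivative[OF D]]) auto
      from has_derivative_unique[OF regular_tensor_has_derivative[OF G[OF sut(1) le(3) sut(4)]] this[folded eq]]
      have "G s t \<mu> \<nu> \<xi> \<xi> \<bullet> axis \<kappa> 1 = G s u \<mu> \<nu> \<xi> \<xi> \<bullet> axis \<kappa> 1 + G u t \<mu> \<nu> \<xi> \<xi> \<bullet> axis \<kappa> 1 + increment x s u \<xi> $ \<mu> * D u t \<xi> (axis \<kappa> 1) $ \<nu>"
        by (rule fun_cong)
      then show ?thesis by (simp add: inner_axis)
    qed
    then show ?thesis
      using linear_axis_sum[OF regular_fieldD(2)[OF D[OF le(2) sut(3,4)]], of "increment x s u \<xi>" \<xi>]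
      by (simp add: B_def vec_eq_iff sum.distrib)
  qed
  have "driver_estimates C \<alpha> T (increment x) D B"
    unfolding driver_estimates_def using D Btame Xchen Bchen by blast
  moreover have "driver_field x x2 s t \<xi> = increment x s t \<xi> + (B s t \<xi> - (1/2) *\<^sub>R D s t \<xi> (increment x s t \<xi>))"
    if "0 \<le> s" "s \<le> t" "t \<le> T" for s t \<xi>
    using driver_field_eq[where x=x and ?x2.0=x2 and s=s and t=t, OF D[OF that] G[OF that]] by (simp add: B_def)
  ultimately show ?thesis using C(1) by blast
qed

text \<open>\<open>R\<close> is the defect of two Euler steps \<open>id + f1 + B1\<close> and
  \<open>id + f2 + B2\<close> against the Euler step that Chen's relation prescribes. With
  \<open>\<delta> = f1 + B1\<close> it is the sum of the Taylor remainder of \<open>f2\<close> with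
  increment \<open>\<delta>\<close>, of \<open>D2[B1]\<close>, and of the difference of
  \<open>B2\<close> at distance \<open>\<delta>\<close>. For \<open>M\<close> of order
  \<open>\<alpha>\<close> and \<open>N\<close> of order \<open>2 \<alpha>\<close> each of them has
  order \<open>3 \<alpha>\<close>.\<close>
lemma defect_bounds:
  fixes f1 f2 B1 B2 :: "real^'d::finite \<Rightarrow> real^'d"
  assumes f1: "tame M f1" and f2: "regular_field M f2 D2" and B1: "tame N B1" and B2: "tame N B2"
  defines "R \<equiv> \<lambda>\<xi>. ((\<xi> + f1 \<xi> + B1 \<xi>) + f2 (\<xi> + f1 \<xi> + B1 \<xi>) + B2 (\<xi> + f1 \<xi> + B1 \<xi>))
     - (\<xi> + (f1 \<xi> + f2 \<xi>) + (B1 \<xi> + B2 \<xi> + D2 \<xi> (f1 \<xi>)))"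
  shows "norm (R \<xi>) \<le> 5 * (M * (M + N)\<^sup>2 + M * N + N * (M + N))"
    and "norm (R \<xi> - R \<eta>) \<le> 5 * (M * (M + N)\<^sup>2 + M * N + N * (M + N)) * norm (\<xi> - \<eta>)"
proof -
  let ?P = "M + N"
  have M0: "0 \<le> M" and N0: "0 \<le> N" using f1 B1 tame_nonneg by auto
  define \<delta> where "\<delta> = (\<lambda>\<xi>. f1 \<xi> + B1 \<xi>)"
  have d1: "norm (\<delta> a) \<le> ?P" for a
    unfolding \<delta>_def by (intro norm_triangle_le add_mono tameD(1)[OF f1] tameD(1)[OF B1])
  have d2: "norm (\<delta> a - \<delta> b) \<le> ?P * norm (a - b)" for a b
  proof -
    have "\<delta> a - \<delta> b = (f1 a - f1 b) + (B1 a - B1 b)" by (simp add: \<delta>_def)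
    also have "norm \<dots> \<le> M * norm (a - b) + N * norm (a - b)"
      by (intro norm_triangle_le add_mono tameD(2)[OF f1] tameD(2)[OF B1])
    finally show ?thesis by (simp add: distrib_right)
  qed
  define r where "r = (\<lambda>\<xi>. f2 (\<xi> + \<delta> \<xi>) - f2 \<xi> - D2 \<xi> (\<delta> \<xi>))"
  note lin = regular_fieldD(2)[OF f2]
  have R: "R \<xi> = r \<xi> + D2 \<xi> (B1 \<xi>) + (B2 (\<xi> + \<delta> \<xi>) - B2 \<xi>)" for \<xi>
    unfolding R_def r_def \<delta>_def by (simp add: linear_add[OF lin] algebra_simps)
  have "norm (r \<xi>) \<le> M * ?P\<^sup>2"
    unfolding r_def using d1[of \<xi>] M0
    by (intro order_trans[OF regular_fieldD(5)[OF f2] mult_left_mono] power_mono) auto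
  moreover have "norm (D2 \<xi> (B1 \<xi>)) \<le> M * N"
    by (rule order_trans[OF regular_fieldD(3)[OF f2] mult_left_mono[OF tameD(1)[OF B1] M0]])
  moreover have "norm (B2 (\<xi> + \<delta> \<xi>) - B2 \<xi>) \<le> N * ?P"
    using order_trans[OF tameD(2)[OF B2, of "\<xi> + \<delta> \<xi>" \<xi>]] mult_left_mono[OF d1[of \<xi>] N0] by simp
  ultimately have "norm (R \<xi>) \<le> M * ?P\<^sup>2 + M * N + N * ?P"
    unfolding R by (intro norm_triangle_le add_mono)
  also have "\<dots> \<le> 5 * (M * ?P\<^sup>2 + M * N + N * ?P)"
    using M0 N0 by simp
  finally show "norm (R \<xi>) \<le> 5 * (M * ?P\<^sup>2 + M * N + N * ?P)" .
  let ?n = "norm (\<xi> - \<eta>)"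
  have 1: "norm (r \<xi> - r \<eta>) \<le> 5 * (M * ?P\<^sup>2) * ?n"
  proof -
    have "norm (r \<xi> - r \<eta>) \<le> M * ((norm (\<delta> \<xi>))\<^sup>2 * ?n + 2 * (norm (\<delta> \<xi>) + norm (\<delta> \<eta>)) * norm (\<delta> \<xi> - \<delta> \<eta>))"
      unfolding r_def by (rule regular_fieldD(6)[OF f2])
    also have "\<dots> \<le> M * (?P\<^sup>2 * ?n + 2 * (?P + ?P) * (?P * ?n))"
      using M0 N0 by (intro mult_left_mono add_mono mult_mono power_mono d1 d2) auto
    also have "\<dots> = 5 * (M * ?P\<^sup>2) * ?n" by (simp add: power2_eq_square algebra_simps)
    finally show ?thesis .
  qed
  have 2: "norm (D2 \<xi> (B1 \<xi>) - D2 \<eta> (B1 \<eta>)) \<le> 2 * (M * N) * ?n"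
  proof -
    have "D2 \<xi> (B1 \<xi>) - D2 \<eta> (B1 \<eta>) = (D2 \<xi> (B1 \<xi>) - D2 \<eta> (B1 \<xi>)) + D2 \<eta> (B1 \<xi> - B1 \<eta>)"
      by (simp add: linear_diff[OF lin])
    also have "norm \<dots> \<le> M * ?n * N + M * (N * ?n)"
      using M0
      by (intro norm_triangle_le add_mono order_trans[OF regular_fieldD(4)[OF f2] mult_left_mono]
          order_trans[OF regular_fieldD(3)[OF f2] mult_left_mono] tameD(1)[OF B1] tameD(2)[OF B1]) auto
    finally show ?thesis by (simp add: algebra_simps)
  qed
  have 3: "norm ((B2 (\<xi> + \<delta> \<xi>) - B2 \<xi>) - (B2 (\<eta> + \<delta> \<eta>) - B2 \<eta>)) \<le> 2 * (N * ?P) * ?n"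
  proof -
    have "norm (B2 (\<xi> + \<delta> \<xi>) - B2 \<xi> - B2 (\<eta> + \<delta> \<eta>) + B2 \<eta>)
      \<le> N * (norm ((\<xi> + \<delta> \<xi>) - \<xi> - (\<eta> + \<delta> \<eta>) + \<eta>) + norm ((\<xi> + \<delta> \<xi>) - \<xi>) * norm (\<xi> - \<eta>))"
      by (rule tameD(3)[OF B2])
    also have "\<dots> = N * (norm (\<delta> \<xi> - \<delta> \<eta>) + norm (\<delta> \<xi>) * ?n)" by (simp add: algebra_simps)
    also have "\<dots> \<le> N * (?P * ?n + ?P * ?n)"
      using N0 by (intro mult_left_mono add_mono mult_right_mono d1 d2) auto
    finally show ?thesis by (simp add: algebra_simps)
  qed
  have "R \<xi> - R \<eta> = (r \<xi> - r \<eta>) + (D2 \<xi> (B1 \<xi>) - D2 \<eta> (B1 \<eta>)) + ((B2 (\<xi> + \<delta> \<xi>) - B2 \<xi>) - (B2 (\<eta> + \<delta> \<eta>) - B2 \<eta>))"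
    unfolding R by simp
  also have "norm \<dots> \<le> 5 * (M * ?P\<^sup>2) * ?n + 2 * (M * N) * ?n + 2 * (N * ?P) * ?n"
    by (intro norm_triangle_le add_mono 1 2 3)
  also have "\<dots> \<le> 5 * (M * ?P\<^sup>2) * ?n + 5 * (M * N) * ?n + 5 * (N * ?P) * ?n"
    using M0 N0 by (intro add_mono mult_right_mono) auto
  also have "\<dots> = 5 * (M * ?P\<^sup>2 + M * N + N * ?P) * ?n" by (simp add: algebra_simps)
  finally show "norm (R \<xi> - R \<eta>) \<le> 5 * (M * ?P\<^sup>2 + M * N + N * ?P) * ?n" .
qed

text \<open>Second order Taylor expansion of the solution, where \<open>b\<close> counts as a term
  of second order. The expansion is subtracted from the solution, and the derivative of the
  difference is estimated.\<close>
lemma one_step_estimate: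
  fixes z :: "real \<Rightarrow> real^'d::finite"
  assumes f: "regular_field M f D" and b: "\<And>a. norm (b a) \<le> N" "\<And>a c. norm (b a - b c) \<le> N * norm (a - c)"
    and z: "\<And>r. r \<in> {0..1} \<Longrightarrow> (z has_vector_derivative f (z r) + b (z r)) (at r within {0..1})"
  shows "norm (z 1 - (z 0 + f (z 0) + b (z 0) + (1/2) *\<^sub>R D (z 0) (f (z 0))))
      \<le> M * (M + N)\<^sup>2 + N * (M + N) + M * (M * (M + N) + N)"
    and "norm (z 1 - z 0) \<le> M + N"
proof -
  let ?P = "M + N" and ?\<xi> = "z 0"
  have M0: "0 \<le> M" using tame_nonneg[OF regular_fieldD(1)[OF f]] .
  have N0: "0 \<le> N" using order_trans[OF norm_ge_zero b(1)] .
  note ft = tameD[OF regular_fieldD(1)[OF f]]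
  have sub: "(z has_vector_derivative f (z r) + b (z r)) (at r within {0..t})" if "r \<in> {0..t}" "t \<in> {0..1}" for r t
    by (rule has_vector_derivative_within_subset[OF z]) (use that in auto)
  have zb: "norm (z t - ?\<xi>) \<le> ?P" if t: "t \<in> {0..1}" for t
  proof -
    have "norm (z t - z 0) \<le> ?P * t"
      by (rule increment_bound[OF _ sub]) (use t in \<open>auto intro!: norm_triangle_le add_mono ft b\<close>)
    also have "\<dots> \<le> ?P" using t M0 N0 by (intro mult_left_le) auto
    finally show ?thesis .
  qed
  show "norm (z 1 - z 0) \<le> M + N" by (rule zb) simp
  have zb2: "norm (z t - ?\<xi> - t *\<^sub>R f ?\<xi>) \<le> M * ?P + N" if t: "t \<in> {0..1}" for t
  proof -
    have "norm ((z t - t *\<^sub>R f ?\<xi>) - (z 0 - 0 *\<^sub>R f ?\<xi>)) \<le> (M * ?P + N) * t"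
    proof (rule increment_bound)
      fix r assume r: "r \<in> {0..t}"
      have "((\<lambda>r. z r - r *\<^sub>R f ?\<xi>) has_vector_derivative (f (z r) + b (z r) - 1 *\<^sub>R f ?\<xi>)) (at r within {0..t})"
        by (intro has_vector_derivative_diff sub r t) (auto intro!: derivative_eq_intros)
      then show "((\<lambda>r. z r - r *\<^sub>R f ?\<xi>) has_vector_derivative (f (z r) - f ?\<xi> + b (z r))) (at r within {0..t})"
        by (simp add: algebra_simps)
      have "r \<in> {0..1}" using r t by auto
      then have "norm (f (z r) - f ?\<xi>) \<le> M * ?P"
        by (rule order_trans[OF ft(2) mult_left_mono[OF zb M0]])
      then show "norm (f (z r) - f ?\<xi> + b (z r)) \<le> M * ?P + N"
        by (intro norm_triangle_le add_mono b)
    qed (use t in auto)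
    also have "\<dots> \<le> M * ?P + N" using t M0 N0 by (intro mult_left_le) auto
    finally show ?thesis by (simp add: algebra_simps)
  qed
  let ?E = "M * ?P\<^sup>2 + N * ?P + M * (M * ?P + N)"
  let ?w = "\<lambda>r. z r - r *\<^sub>R (f ?\<xi> + b ?\<xi>) - (r\<^sup>2 / 2) *\<^sub>R D ?\<xi> (f ?\<xi>)"
  note lin = regular_fieldD(2)[OF f]
  have "norm (?w 1 - ?w 0) \<le> ?E * 1"
  proof (rule increment_bound)
    fix r :: real assume r: "r \<in> {0..1}"
    \<comment> \<open>The derivative of the difference, written as a Taylor remainder of \<open>f\<close>, an increment of \<open>b\<close>, and the derivative of \<open>f\<close> applied to a second order error of the solution.\<close>
    let ?w' = "(f (z r) - f ?\<xi> - D ?\<xi> (z r - ?\<xi>)) + (b (z r) - b ?\<xi>) + D ?\<xi> (z r - ?\<xi> - r *\<^sub>R f ?\<xi>)"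
    have A: "(?w has_vector_derivative (f (z r) + b (z r) - 1 *\<^sub>R (f ?\<xi> + b ?\<xi>) - r *\<^sub>R D ?\<xi> (f ?\<xi>))) (at r within {0..1})"
      by (intro has_vector_derivative_diff z r) (auto intro!: derivative_eq_intros)
    have eq: "f (z r) + b (z r) - 1 *\<^sub>R (f ?\<xi> + b ?\<xi>) - r *\<^sub>R D ?\<xi> (f ?\<xi>) = ?w'"
      by (simp add: linear_diff[OF lin] linear_scale[OF lin])
    from A show "(?w has_vector_derivative ?w') (at r within {0..1})" by (simp only: eq)
    have "norm (f (z r) - f ?\<xi> - D ?\<xi> (z r - ?\<xi>)) \<le> M * ?P\<^sup>2"
      using order_trans[OF regular_fieldD(5)[OF f, of ?\<xi> "z r - ?\<xi>"] mult_left_mono[OF power_mono[OF zb[OF r]] M0]] by simp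
    moreover have "norm (b (z r) - b ?\<xi>) \<le> N * ?P"
      by (rule order_trans[OF b(2) mult_left_mono[OF zb[OF r] N0]])
    moreover have "norm (D ?\<xi> (z r - ?\<xi> - r *\<^sub>R f ?\<xi>)) \<le> M * (M * ?P + N)"
      by (rule order_trans[OF regular_fieldD(3)[OF f] mult_left_mono[OF zb2[OF r] M0]])
    ultimately show "norm ?w' \<le> ?E" by (intro norm_triangle_le add_mono)
  qed simp
  then show "norm (z 1 - (z 0 + f (z 0) + b (z 0) + (1/2) *\<^sub>R D (z 0) (f (z 0)))) \<le> ?E"
    by (simp add: algebra_simps)
qed

section \<open>Euler maps\<close>

definition euler_map :: "(real \<Rightarrow> real \<Rightarrow> 'a::real_normed_vector \<Rightarrow> 'a) \<Rightarrow> (real \<Rightarrow> real \<Rightarrow> 'a \<Rightarrow> 'a) \<Rightarrow> real \<Rightarrow> real \<Rightarrow> 'a \<Rightarrow> 'a" where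
  "euler_map X B s t \<xi> = \<xi> + X s t \<xi> + B s t \<xi>"

lemma powr_double: "(u::real) powr (2 * \<alpha>) = (u powr \<alpha>)\<^sup>2"
  by (simp add: power2_eq_square flip: powr_add)

lemma powr_triple: "(u::real) powr (3 * \<alpha>) = (u powr \<alpha>) ^ 3"
  by (simp add: power3_eq_cube flip: powr_add)

lemma driver_estimatesD:
  assumes "driver_estimates C \<alpha> T X D B" "0 \<le> s" "s \<le> t" "t \<le> T"
  shows "regular_field (C * (t - s) powr \<alpha>) (X s t) (D s t)" "tame (C * ((t - s) powr \<alpha>)\<^sup>2) (B s t)"
  using assms by (auto simp: driver_estimates_def powr_double)

lemma tame_euler_map:
  assumes X: "tame M (X s t)" and B: "tame N (B s t)" and P: "M + N \<le> P"
  shows "norm (euler_map X B s t a - euler_map X B s t b) \<le> (1 + P) * norm (a - b)"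
    and "norm (euler_map X B s t a - euler_map X B s t b - euler_map X B s t c + euler_map X B s t d)
      \<le> (1 + P) * norm (a - b - c + d) + P * (norm (a - b) * norm (b - d))"
    and "norm (euler_map X B s t a - a) \<le> P"
proof -
  have "euler_map X B s t a - euler_map X B s t b = (a - b) + (X s t a - X s t b) + (B s t a - B s t b)"
    by (simp add: euler_map_def)
  also have "norm \<dots> \<le> norm (a - b) + M * norm (a - b) + N * norm (a - b)"
    by (intro norm_triangle_le add_mono tameD(2)[OF X] tameD(2)[OF B] order_refl)
  also have "\<dots> = (1 + (M + N)) * norm (a - b)" by (simp add: algebra_simps)
  also have "\<dots> \<le> (1 + P) * norm (a - b)" using P by (intro mult_right_mono) auto
  finally show "norm (euler_map X B s t a - euler_map X B s t b) \<le> (1 + P) * norm (a - b)" .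
  let ?E = "norm (a - b - c + d) + norm (a - b) * norm (b - d)"
  have "euler_map X B s t a - euler_map X B s t b - euler_map X B s t c + euler_map X B s t d
     = (a - b - c + d) + (X s t a - X s t b - X s t c + X s t d) + (B s t a - B s t b - B s t c + B s t d)"
    by (simp add: euler_map_def)
  also have "norm \<dots> \<le> norm (a - b - c + d) + M * ?E + N * ?E"
    by (intro norm_triangle_le add_mono tameD(3)[OF X] tameD(3)[OF B] order_refl)
  also have "\<dots> = norm (a - b - c + d) + (M + N) * ?E" by (simp add: algebra_simps)
  also have "\<dots> \<le> norm (a - b - c + d) + P * ?E" using P by (intro add_left_mono mult_right_mono) auto
  also have "\<dots> = (1 + P) * norm (a - b - c + d) + P * (norm (a - b) * norm (b - d))" by (simp add: algebra_simps)
  finally show "norm (euler_map X B s t a - euler_map X B s t b - euler_map X B s t c + euler_map X B s t d)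
      \<le> (1 + P) * norm (a - b - c + d) + P * (norm (a - b) * norm (b - d))" .
  have "norm (X s t a + B s t a) \<le> M + N" by (intro norm_triangle_le add_mono tameD(1)[OF X] tameD(1)[OF B])
  then show "norm (euler_map X B s t a - a) \<le> P" using P by (simp add: euler_map_def)
qed

lemma driver_tame_sum:
  assumes "driver_estimates C \<alpha> T X D B" "0 \<le> s" "s \<le> t" "t \<le> T" "t - s \<le> 1" "1 \<le> C" "0 < \<alpha>"
  shows "C * (t - s) powr \<alpha> + C * ((t - s) powr \<alpha>)\<^sup>2 \<le> 2 * C * (t - s) powr \<alpha>"
proof -
  have "(t - s) powr \<alpha> \<le> 1" using assms powr_mono2[of \<alpha> "t - s" 1] by simp
  then have "((t - s) powr \<alpha>)\<^sup>2 \<le> (t - s) powr \<alpha>" by (simp add: power2_eq_square mult_left_le)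
  then show ?thesis using assms(6) by simp
qed

text \<open>The constant \<open>35 C\<^sup>3\<close> comes from \<open>defect_bounds\<close> with
  \<open>M = C p\<close> and \<open>N = C p\<^sup>2\<close>, where \<open>p \<le> 1\<close> is the
  \<open>\<alpha>\<close>-th power of the length of the whole interval, and \<open>M + N \<le> 2 C
  p\<close>.\<close>
lemma driver_almost_flow:
  assumes est: "driver_estimates C \<alpha> T X D B" and C: "1 \<le> C" and \<alpha>: "0 < \<alpha>" and h: "0 < h" and n: "real n * h \<le> T"
  shows "almost_flow (35 * C ^ 3) \<alpha> (3 * \<alpha>) (\<lambda>i j. euler_map X B (real i * h) (real j * h)) h n"
  unfolding almost_flow_def
proof (intro conjI allI impI)
  have grid: "0 \<le> real i * h" "real i * h \<le> real j * h" "real j * h \<le> T" "real j * h - real i * h = real (j - i) * h"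
    if "i \<le> j" "j \<le> n" for i j
  proof -
    have "real j * h \<le> real n * h" using that h by (intro mult_right_mono) auto
    then show "real j * h \<le> T" using n by linarith
  qed (use that h in \<open>auto simp: of_nat_diff left_diff_distrib intro!: mult_right_mono\<close>)
  have C3: "2 * C \<le> 35 * C ^ 3"
  proof -
    have "C ^ 1 \<le> C ^ 3" using C by (intro power_increasing) auto
    then show ?thesis using C by simp
  qed
  { fix i j a b c d assume *: "i \<le> j \<and> j \<le> n \<and> real (j - i) * h \<le> 1"
    let ?s = "real i * h" and ?t = "real j * h"
    have ij: "i \<le> j" "j \<le> n" using * by auto
    note g = grid[OF ij]
    have \<tau>: "?t - ?s \<le> 1" using * by (simp only: g(4))
    have P: "C * (?t - ?s) powr \<alpha> + C * ((?t - ?s) powr \<alpha>)\<^sup>2 \<le> 35 * C ^ 3 * (real (j - i) * h) powr \<alpha>"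
      using driver_tame_sum[OF est g(1-3) \<tau> C \<alpha>] mult_right_mono[OF C3, of "(?t - ?s) powr \<alpha>"] unfolding g(4) by simp
    note d = driver_estimatesD[OF est g(1-3)]
    note te = tame_euler_map[where X=X and B=B, OF regular_fieldD(1)[OF d(1)] d(2) P]
    show "norm (euler_map X B ?s ?t a - euler_map X B ?s ?t b) \<le> (1 + 35 * C ^ 3 * (real (j - i) * h) powr \<alpha>) * norm (a - b)"
      by (rule te(1))
    show "norm (euler_map X B ?s ?t a - euler_map X B ?s ?t b - euler_map X B ?s ?t c + euler_map X B ?s ?t d)
       \<le> (1 + 35 * C ^ 3 * (real (j - i) * h) powr \<alpha>) * norm (a - b - c + d) + 35 * C ^ 3 * (real (j - i) * h) powr \<alpha> * (norm (a - b) * norm (b - d))"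
      by (rule te(2)) }
  { fix i j l a b assume *: "i \<le> j \<and> j \<le> l \<and> l \<le> n \<and> real (l - i) * h \<le> 1"
    let ?s = "real i * h" and ?u = "real j * h" and ?t = "real l * h"
    have ord: "i \<le> j" "j \<le> n" "j \<le> l" "l \<le> n" "i \<le> l" using * by auto
    have g1: "0 \<le> ?s" "?s \<le> ?u" "?u \<le> T" and g2: "0 \<le> ?u" "?u \<le> ?t" "?t \<le> T" and g3: "?s \<le> ?t" "?t - ?s = real (l - i) * h"
      by (rule grid[OF ord(1,2)] grid[OF ord(3,4)] grid[OF ord(5,4)])+
    define p where "p = (?t - ?s) powr \<alpha>"
    have p: "0 \<le> p" "p \<le> 1" using g3 * \<alpha> powr_mono2[of \<alpha> "?t - ?s" 1] by (auto simp: p_def)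
    have su: "(?u - ?s) powr \<alpha> \<le> p" and ut: "(?t - ?u) powr \<alpha> \<le> p"
      unfolding p_def using g1 g2 \<alpha> by (auto intro!: powr_mono2)
    have su2: "((?u - ?s) powr \<alpha>)\<^sup>2 \<le> p\<^sup>2" and ut2: "((?t - ?u) powr \<alpha>)\<^sup>2 \<le> p\<^sup>2"
      using su ut by (auto intro!: power_mono)
    have C0: "0 \<le> C" using C by simp
    note d1 = driver_estimatesD[OF est g1] and d2 = driver_estimatesD[OF est g2]
    have f1: "tame (C * p) (X ?s ?u)" using regular_fieldD(1)[OF d1(1)] mult_left_mono[OF su C0] by (rule tame_mono)
    have f2: "regular_field (C * p) (X ?u ?t) (D ?u ?t)" using d2(1) mult_left_mono[OF ut C0] by (rule regular_field_mono)
    have B1: "tame (C * p\<^sup>2) (B ?s ?u)" using d1(2) mult_left_mono[OF su2 C0] by (rule tame_mono)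
    have B2: "tame (C * p\<^sup>2) (B ?u ?t)" using d2(2) mult_left_mono[OF ut2 C0] by (rule tame_mono)
    have ch: "X ?s ?t \<xi> = X ?s ?u \<xi> + X ?u ?t \<xi>" "B ?s ?t \<xi> = B ?s ?u \<xi> + B ?u ?t \<xi> + D ?u ?t \<xi> (X ?s ?u \<xi>)" for \<xi>
      using est g1 g2 unfolding driver_estimates_def by blast+
    note db = defect_bounds[OF f1 f2 B1 B2]
    have R: "euler_map X B ?u ?t (euler_map X B ?s ?u \<xi>) - euler_map X B ?s ?t \<xi>
       = ((\<xi> + X ?s ?u \<xi> + B ?s ?u \<xi>) + X ?u ?t (\<xi> + X ?s ?u \<xi> + B ?s ?u \<xi>) + B ?u ?t (\<xi> + X ?s ?u \<xi> + B ?s ?u \<xi>))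
     - (\<xi> + (X ?s ?u \<xi> + X ?u ?t \<xi>) + (B ?s ?u \<xi> + B ?u ?t \<xi> + D ?u ?t \<xi> (X ?s ?u \<xi>)))" for \<xi>
      unfolding euler_map_def ch ..
    have bound: "5 * (C * p * (C * p + C * p\<^sup>2)\<^sup>2 + C * p * (C * p\<^sup>2) + C * p\<^sup>2 * (C * p + C * p\<^sup>2)) \<le> 35 * C ^ 3 * (real (l - i) * h) powr (3 * \<alpha>)"
    proof -
      have p2: "p\<^sup>2 \<le> p" using p by (simp add: power2_eq_square mult_left_le)
      have P: "C * p + C * p\<^sup>2 \<le> 2 * C * p" using mult_left_mono[OF p2 C0] by simp
      have P0: "0 \<le> C * p + C * p\<^sup>2" using C0 p by simp
      have C23: "C ^ 2 \<le> C ^ 3" using C by (intro power_increasing) auto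
      have "C * p * (C * p + C * p\<^sup>2)\<^sup>2 + C * p * (C * p\<^sup>2) + C * p\<^sup>2 * (C * p + C * p\<^sup>2)
         \<le> C * p * (2 * C * p)\<^sup>2 + C * p * (C * p\<^sup>2) + C * p\<^sup>2 * (2 * C * p)"
        using C0 p P P0 by (intro add_mono mult_left_mono power_mono) auto
      also have "\<dots> = 4 * (C ^ 3 * p ^ 3) + 3 * (C ^ 2 * p ^ 3)"
        by (simp add: power2_eq_square power3_eq_cube algebra_simps)
      also have "\<dots> \<le> 4 * (C ^ 3 * p ^ 3) + 3 * (C ^ 3 * p ^ 3)"
        using C23 p by (intro add_left_mono mult_left_mono mult_right_mono) auto
      finally show ?thesis unfolding powr_triple g3(2)[symmetric] p_def[symmetric] by simp
    qed
    show "norm (euler_map X B ?u ?t (euler_map X B ?s ?u a) - euler_map X B ?s ?t a) \<le> 35 * C ^ 3 * (real (l - i) * h) powr (3 * \<alpha>)"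
      unfolding R by (rule order_trans[OF db(1) bound])
    show "norm ((euler_map X B ?u ?t (euler_map X B ?s ?u a) - euler_map X B ?s ?t a) - (euler_map X B ?u ?t (euler_map X B ?s ?u b) - euler_map X B ?s ?t b))
      \<le> 35 * C ^ 3 * (real (l - i) * h) powr (3 * \<alpha>) * norm (a - b)"
      unfolding R by (rule order_trans[OF db(2) mult_right_mono[OF bound]]) simp }
qed

text \<open>The correction \<open>- DX[X]/2\<close> in the driver field cancels the second order
  term of the Taylor expansion of the solution; \<open>X + B\<close> is what remains, and this is
  why the time-one map agrees with the Euler map to order \<open>3 \<alpha>\<close>.\<close>
lemma driver_field_step:
  fixes X :: "real \<Rightarrow> real \<Rightarrow> ('d::finite) vfield"
  assumes est: "driver_estimates C \<alpha> T X D B" and st: "0 \<le> s" "s \<le> t" "t \<le> T" "t - s \<le> 1" and C: "1 \<le> C" and \<alpha>: "0 < \<alpha>"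
    and V: "\<And>\<xi>. V \<xi> = X s t \<xi> + (B s t \<xi> - (1/2) *\<^sub>R D s t \<xi> (X s t \<xi>))"
  shows "norm (V a) \<le> 3 * C\<^sup>2 * (t - s) powr \<alpha>"
    and "norm (V a - V a') \<le> 3 * C\<^sup>2 * (t - s) powr \<alpha> * norm (a - a')"
    and "(\<And>r. r \<in> {0..1} \<Longrightarrow> (z has_vector_derivative V (z r)) (at r within {0..1})) \<Longrightarrow>
       norm (z 1 - euler_map X B s t (z 0)) \<le> 20 * C ^ 5 * (t - s) powr (3 * \<alpha>)"
    and "(\<And>r. r \<in> {0..1} \<Longrightarrow> (z has_vector_derivative V (z r)) (at r within {0..1})) \<Longrightarrow>
       norm (z 1 - z 0) \<le> 3 * C\<^sup>2 * (t - s) powr \<alpha>"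
proof -
  define p where "p = (t - s) powr \<alpha>"
  have p: "0 \<le> p" "p \<le> 1" using st \<alpha> powr_mono2[of \<alpha> "t - s" 1] by (auto simp: p_def)
  have C0: "0 \<le> C" using C by simp
  note d = driver_estimatesD[OF est st(1-3), folded p_def]
  note f = d(1)
  let ?M = "C * p" and ?N = "2 * C\<^sup>2 * p\<^sup>2"
  have M0: "0 \<le> ?M" using C0 p by simp
  have N: "C * p\<^sup>2 + ?M * ?M \<le> ?N"
  proof -
    have "C ^ 1 \<le> C ^ 2" using C by (intro power_increasing) auto
    then have "C * p\<^sup>2 \<le> C\<^sup>2 * p\<^sup>2" by (intro mult_right_mono) auto
    then show ?thesis by (simp add: power2_eq_square algebra_simps)
  qed
  define b where "b = (\<lambda>\<xi>. B s t \<xi> - (1/2) *\<^sub>R D s t \<xi> (X s t \<xi>))"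
  have ft: "norm (X s t a) \<le> ?M" "norm (X s t a - X s t b) \<le> ?M * norm (a - b)" for a b
    using tameD[OF regular_fieldD(1)[OF f]] by auto
  have DX: "norm (D s t a (X s t a)) \<le> ?M * ?M" for a
    by (rule order_trans[OF regular_fieldD(3)[OF f] mult_left_mono[OF ft(1) M0]])
  have b1: "norm (b a) \<le> ?N" for a
  proof -
    have "norm (b a) \<le> C * p\<^sup>2 + (1/2) * (?M * ?M)"
      unfolding b_def
      by (rule order_trans[OF norm_triangle_ineq4 add_mono]) (use tameD(1)[OF d(2), of a] DX[of a] in auto)
    also have "\<dots> \<le> C * p\<^sup>2 + ?M * ?M" using mult_nonneg_nonneg[OF M0 M0] by linarith
    finally show ?thesis using N by linarith
  qed
  have b2: "norm (b a - b c) \<le> ?N * norm (a - c)" for a c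
  proof -
    have "D s t a (X s t a) - D s t c (X s t c) = (D s t a (X s t a) - D s t c (X s t a)) + D s t c (X s t a - X s t c)"
      by (simp add: linear_diff[OF regular_fieldD(2)[OF f]])
    also have "norm \<dots> \<le> ?M * norm (a - c) * ?M + ?M * (?M * norm (a - c))"
      using M0 by (intro norm_triangle_le add_mono order_trans[OF regular_fieldD(4)[OF f] mult_left_mono]
          order_trans[OF regular_fieldD(3)[OF f] mult_left_mono] ft) auto
    finally have DD: "norm (D s t a (X s t a) - D s t c (X s t c)) \<le> 2 * (?M * ?M * norm (a - c))" by (simp add: algebra_simps)
    have "b a - b c = (B s t a - B s t c) - (1/2) *\<^sub>R (D s t a (X s t a) - D s t c (X s t c))"
      by (simp add: b_def algebra_simps)
    also have "norm \<dots> \<le> C * p\<^sup>2 * norm (a - c) + (1/2) * (2 * (?M * ?M * norm (a - c)))"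
      by (rule order_trans[OF norm_triangle_ineq4 add_mono]) (use tameD(2)[OF d(2), of a c] DD in auto)
    also have "\<dots> = (C * p\<^sup>2 + ?M * ?M) * norm (a - c)" by (simp add: algebra_simps)
    also have "\<dots> \<le> ?N * norm (a - c)" by (intro mult_right_mono N) auto
    finally show ?thesis .
  qed
  have V': "V \<xi> = X s t \<xi> + b \<xi>" for \<xi> by (simp add: V b_def)
  have P: "?M + ?N \<le> 3 * C\<^sup>2 * p"
  proof -
    have "C ^ 1 \<le> C ^ 2" using C by (intro power_increasing) auto
    then have "C * p \<le> C\<^sup>2 * p" using p by (intro mult_right_mono) auto
    moreover have "C\<^sup>2 * p\<^sup>2 \<le> C\<^sup>2 * p" using p by (intro mult_left_mono) (auto simp: power2_eq_square mult_left_le)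
    ultimately show ?thesis by simp
  qed
  have "norm (V a) \<le> ?M + ?N" unfolding V' by (intro norm_triangle_le add_mono ft b1)
  then show "norm (V a) \<le> 3 * C\<^sup>2 * (t - s) powr \<alpha>" using P by (simp add: p_def)
  have "norm (V a - V c) \<le> ?M * norm (a - c) + ?N * norm (a - c)" for c
  proof -
    have "V a - V c = (X s t a - X s t c) + (b a - b c)" by (simp add: V')
    also have "norm \<dots> \<le> ?M * norm (a - c) + ?N * norm (a - c)" by (intro norm_triangle_le add_mono ft b2)
    finally show ?thesis .
  qed
  from this[of a'] have "norm (V a - V a') \<le> (?M + ?N) * norm (a - a')" by (simp only: distrib_right)
  also have "\<dots> \<le> 3 * C\<^sup>2 * p * norm (a - a')" by (intro mult_right_mono P) auto
  finally show "norm (V a - V a') \<le> 3 * C\<^sup>2 * (t - s) powr \<alpha> * norm (a - a')"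
    by (simp only: p_def)
  assume z: "\<And>r. r \<in> {0..1} \<Longrightarrow> (z has_vector_derivative V (z r)) (at r within {0..1})"
  note os = one_step_estimate[OF f b1 b2 z[unfolded V']]
  have "norm (z 1 - z 0) \<le> ?M + ?N" by (rule os(2))
  then show "norm (z 1 - z 0) \<le> 3 * C\<^sup>2 * (t - s) powr \<alpha>" using P by (simp add: p_def)
  have "norm (z 1 - (z 0 + X s t (z 0) + b (z 0) + (1/2) *\<^sub>R D s t (z 0) (X s t (z 0)))) \<le> ?M * (?M + ?N)\<^sup>2 + ?N * (?M + ?N) + ?M * (?M * (?M + ?N) + ?N)"
    by (rule os(1))
  also have "\<dots> \<le> ?M * (3 * C\<^sup>2 * p)\<^sup>2 + ?N * (3 * C\<^sup>2 * p) + ?M * (?M * (3 * C\<^sup>2 * p) + ?N)"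
    using M0 P C0 p by (intro add_mono mult_left_mono power_mono order_refl) auto
  also have "\<dots> = 9 * (C ^ 5 * p ^ 3) + 6 * (C ^ 4 * p ^ 3) + 3 * (C ^ 4 * p ^ 3) + 2 * (C ^ 3 * p ^ 3)"
    by (simp add: power2_eq_square power3_eq_cube numeral_eq_Suc algebra_simps)
  also have "\<dots> \<le> 9 * (C ^ 5 * p ^ 3) + 6 * (C ^ 5 * p ^ 3) + 3 * (C ^ 5 * p ^ 3) + 2 * (C ^ 5 * p ^ 3)"
    using p C by (intro add_mono mult_left_mono mult_right_mono power_increasing order_refl) auto
  also have "\<dots> = 20 * C ^ 5 * (t - s) powr (3 * \<alpha>)" unfolding powr_triple p_def by simp
  finally show "norm (z 1 - euler_map X B s t (z 0)) \<le> 20 * C ^ 5 * (t - s) powr (3 * \<alpha>)"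
    by (simp add: euler_map_def b_def algebra_simps)
qed

section \<open>Convergence of the step scheme\<close>

lemma ennreal_tendsto_0I:
  fixes u :: "nat \<Rightarrow> ennreal"
  assumes "\<And>e. 0 < e \<Longrightarrow> \<forall>\<^sub>F n in sequentially. u n \<le> ennreal e"
  shows "u \<longlonglongrightarrow> 0"
proof (rule order_tendstoI)
  fix a :: ennreal assume a: "0 < a"
  then obtain b where b: "0 < b" "b < a" using dense by blast
  then obtain e where e: "b = ennreal e" "0 \<le> e" by (cases b) (auto simp: top_unique)
  then have "0 < e" using b by simp
  from assms[OF this] show "\<forall>\<^sub>F n in sequentially. u n < a"
    by eventually_elim (use b e in \<open>simp add: le_less_trans\<close>)
qed simp

text \<open>Interpolation: increments over times up to \<open>\<rho>\<close> are small because
  \<open>\<beta> < \<alpha>\<close>, those over longer times because the supremum tends to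
  \<open>0\<close>. First \<open>\<rho>\<close> is fixed, then \<open>n\<close> is taken
  large.\<close>
lemma holder_norm_tendsto_0:
  fixes f :: "nat \<Rightarrow> real \<Rightarrow> ('d::finite) vfield"
  assumes \<delta>: "0 < \<delta>" and H: "0 \<le> H" and \<beta>: "0 < \<beta>" "\<beta> < \<alpha>"
    and hoelder: "\<And>n s t \<xi>. 0 \<le> s \<Longrightarrow> s \<le> t \<Longrightarrow> t \<le> T \<Longrightarrow> t - s \<le> \<delta> \<Longrightarrow> norm (f n t \<xi> - f n s \<xi>) \<le> H * (t - s) powr \<alpha>"
    and sup: "\<And>n t \<xi>. t \<in> {0..T} \<Longrightarrow> norm (f n t \<xi>) \<le> \<epsilon> n" and lim: "\<epsilon> \<longlonglongrightarrow> 0" and \<epsilon>0: "\<And>n. 0 \<le> \<epsilon> n"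
  shows "(\<lambda>n. holder_norm \<beta> T (f n)) \<longlonglongrightarrow> 0"
proof (rule ennreal_tendsto_0I)
  fix e :: real assume e: "0 < e"
  have "((\<lambda>r::real. H * r powr (\<alpha> - \<beta>)) \<longlongrightarrow> H * 0) (at_right 0)"
  proof (intro tendsto_intros)
    show "((\<lambda>r::real. r powr (\<alpha> - \<beta>)) \<longlongrightarrow> 0) (at_right 0)"
      by (rule tendsto_zero_powrI[OF _ tendsto_const])
         (use \<beta> in \<open>auto intro!: tendsto_ident_at simp: eventually_at_right_less eventually_at_topological\<close>)
  qed
  then have "\<forall>\<^sub>F r in at_right 0. H * r powr (\<alpha> - \<beta>) < e / 2"
    using e by (intro order_tendstoD(2)) auto
  moreover have "\<forall>\<^sub>F r in at_right (0::real). r < \<delta>" by (rule eventually_at_rightI[of _ \<delta>]) (use \<delta> in auto)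
  moreover have "\<forall>\<^sub>F r in at_right (0::real). 0 < r" by (rule eventually_at_right_less)
  ultimately have "\<forall>\<^sub>F r in at_right 0. 0 < r \<and> r < \<delta> \<and> H * r powr (\<alpha> - \<beta>) < e / 2"
    by eventually_elim auto
  from eventually_happens'[OF trivial_limit_at_right_real this]
  obtain \<rho> where \<rho>: "0 < \<rho>" "\<rho> < \<delta>" "H * \<rho> powr (\<alpha> - \<beta>) < e / 2" by blast
  have "(\<lambda>n. \<epsilon> n + 2 * \<epsilon> n / \<rho> powr \<beta>) \<longlonglongrightarrow> 0 + 2 * 0 / \<rho> powr \<beta>"
    by (intro tendsto_intros lim) (use \<rho> in auto)
  then have "\<forall>\<^sub>F n in sequentially. \<epsilon> n + 2 * \<epsilon> n / \<rho> powr \<beta> < e / 2"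
    using e by (intro order_tendstoD(2)) auto
  then show "\<forall>\<^sub>F n in sequentially. holder_norm \<beta> T (f n) \<le> ennreal e"
  proof eventually_elim
    case (elim n)
    let ?h = "H * \<rho> powr (\<alpha> - \<beta>) + 2 * \<epsilon> n / \<rho> powr \<beta>"
    have h0: "0 \<le> ?h" using H \<epsilon>0[of n] by simp
    have "(SUP t\<in>{0..T}. SUP \<xi>. ennreal (norm (f n t \<xi>))) \<le> ennreal (\<epsilon> n)"
      by (intro SUP_least ennreal_leI sup) auto
    moreover have "(SUP (s, t)\<in>{(s, t). 0 \<le> s \<and> s < t \<and> t \<le> T}. SUP \<xi>. ennreal (norm (f n t \<xi> - f n s \<xi>) / (t - s) powr \<beta>)) \<le> ennreal ?h"
    proof (rule SUP_least, clarsimp, intro SUP_least ennreal_leI)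
      fix s t \<xi> assume st: "0 \<le> s" "s < t" "t \<le> T"
      have pos: "0 < (t - s) powr \<beta>" using st by simp
      show "norm (f n t \<xi> - f n s \<xi>) / (t - s) powr \<beta> \<le> ?h"
      proof (cases "t - s \<le> \<rho>")
        case True
        have "norm (f n t \<xi> - f n s \<xi>) \<le> H * (t - s) powr \<alpha>"
          using st True \<rho> by (intro hoelder) auto
        also have "(t - s) powr \<alpha> = (t - s) powr (\<alpha> - \<beta>) * (t - s) powr \<beta>" by (simp flip: powr_add)
        also have "H * ((t - s) powr (\<alpha> - \<beta>) * (t - s) powr \<beta>) \<le> H * (\<rho> powr (\<alpha> - \<beta>) * (t - s) powr \<beta>)"
          using H True st \<beta> by (intro mult_left_mono mult_right_mono powr_mono2) auto
        finally have "norm (f n t \<xi> - f n s \<xi>) / (t - s) powr \<beta> \<le> H * \<rho> powr (\<alpha> - \<beta>)"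
          using pos by (simp add: divide_le_eq mult.assoc)
        also have "\<dots> \<le> ?h" using \<epsilon>0[of n] by simp
        finally show ?thesis .
      next
        case False
        have "norm (f n t \<xi> - f n s \<xi>) \<le> norm (f n t \<xi>) + norm (f n s \<xi>)" by (rule norm_triangle_ineq4)
        also have "\<dots> \<le> \<epsilon> n + \<epsilon> n" using st by (intro add_mono sup) auto
        finally have "norm (f n t \<xi> - f n s \<xi>) / (t - s) powr \<beta> \<le> 2 * \<epsilon> n / (t - s) powr \<beta>"
          using pos by (intro divide_right_mono) auto
        also have "\<dots> \<le> 2 * \<epsilon> n / \<rho> powr \<beta>"
          using False \<rho> \<beta> \<epsilon>0[of n] by (intro divide_left_mono powr_mono2 mult_pos_pos) auto
        also have "\<dots> \<le> ?h" using H by simp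
        finally show ?thesis .
      qed
    qed
    ultimately have "holder_norm \<beta> T (f n) \<le> ennreal (\<epsilon> n) + ennreal ?h"
      unfolding holder_norm_def by (rule add_mono)
    also have "\<dots> = ennreal (\<epsilon> n + ?h)" using \<epsilon>0 h0 by (simp add: ennreal_plus)
    also have "\<dots> \<le> ennreal e" using elim \<rho>(3) by (intro ennreal_leI) linarith
    finally show ?case .
  qed
qed

lemma grid_point_below:
  assumes h: "0 < h" and t: "0 \<le> t" "t \<le> real N * h"
  obtains j where "j \<le> N" "real j * h \<le> t" "t < real (Suc j) * h"
proof
  let ?j = "nat \<lfloor>t / h\<rfloor>"
  have q: "0 \<le> t / h" "t / h \<le> real N" using h t by (auto simp: divide_le_eq)
  have r: "real ?j = of_int \<lfloor>t / h\<rfloor>" using q by simp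
  show "?j \<le> N" using q by linarith
  have "real ?j \<le> t / h" unfolding r by simp
  then show "real ?j * h \<le> t" using h by (simp add: le_divide_eq)
  have "t / h < real ?j + 1" unfolding r by linarith
  then show "t < real (Suc ?j) * h" using h by (simp add: divide_less_eq algebra_simps)
qed

text \<open>Within a cell, linear motion with speed \<open>h\<close> to the power \<open>\<alpha> -
  1\<close> is \<open>\<alpha>\<close>-Hoelder with a constant independent of
  \<open>h\<close>.\<close>
lemma small_increment_powr:
  fixes u h :: real
  assumes "0 < h" "0 \<le> u" "u \<le> h" "\<alpha> \<le> 1"
  shows "h powr \<alpha> / h * u \<le> u powr \<alpha>"
proof (cases "u = 0")
  case False
  then have u: "0 < u" using assms by simp
  have "h powr \<alpha> / h = h powr (\<alpha> - 1)" using assms by (simp add: powr_diff)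
  also have "\<dots> \<le> u powr (\<alpha> - 1)" using assms u by (intro powr_mono2') auto
  finally have "h powr \<alpha> / h * u \<le> u powr (\<alpha> - 1) * u" using u by (intro mult_right_mono) auto
  then show ?thesis using u by (simp add: powr_diff)
qed simp

text \<open>The increment is cut at the first grid point after \<open>s\<close> and the last one
  before \<open>t\<close>; both ends lie within one cell.\<close>
lemma grid_hoelder:
  fixes z :: "real \<Rightarrow> 'a::real_normed_vector"
  assumes h: "0 < h" and \<alpha>: "0 < \<alpha>" "\<alpha> \<le> 1" and A: "0 \<le> A"
    and fine: "\<And>s t. 0 \<le> s \<Longrightarrow> s \<le> t \<Longrightarrow> t \<le> real N * h \<Longrightarrow> norm (z t - z s) \<le> A * (h powr \<alpha> / h) * (t - s)"
    and coarse: "\<And>i m. i + m \<le> N \<Longrightarrow> 1 \<le> m \<Longrightarrow> real m * h \<le> \<delta> \<Longrightarrow> norm (z (real (i + m) * h) - z (real i * h)) \<le> A * (real m * h) powr \<alpha>"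
    and st: "0 \<le> s" "s \<le> t" "t \<le> real N * h" "t - s \<le> \<delta>"
  shows "norm (z t - z s) \<le> 3 * A * (t - s) powr \<alpha>"
proof -
  have small: "norm (z b - z a) \<le> A * (b - a) powr \<alpha>" if "0 \<le> a" "a \<le> b" "b \<le> real N * h" "b - a \<le> h" for a b
    using order_trans[OF fine[OF that(1-3)], of "A * (b - a) powr \<alpha>"] mult_left_mono[OF small_increment_powr[of h "b - a" \<alpha>] A] that h \<alpha>
    by (simp add: mult.assoc)
  let ?p = "(t - s) powr \<alpha>"
  have pm: "A * u powr \<alpha> \<le> A * ?p" if "0 \<le> u" "u \<le> t - s" for u
    using that A \<alpha> by (intro mult_left_mono powr_mono2) auto
  have Ap: "0 \<le> A * ?p" using A by simp
  obtain i where i: "i \<le> N" "real i * h \<le> s" "s < real (Suc i) * h"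
    using grid_point_below[OF h st(1), of N] st by auto
  obtain j where j: "j \<le> N" "real j * h \<le> t" "t < real (Suc j) * h"
    using grid_point_below[OF h, of t N] st by auto
  show ?thesis
  proof (cases "Suc i \<le> j")
    case False
    then have "j \<le> i" by simp
    then have "real (Suc j) * h \<le> real (Suc i) * h" using h by (intro mult_right_mono) auto
    moreover have "real (Suc i) * h = real i * h + h" by (simp add: algebra_simps)
    ultimately have "t - s \<le> h" using i(2) j(3) by linarith
    then have "norm (z t - z s) \<le> A * ?p" using st by (intro small) auto
    then show ?thesis using Ap by linarith
  next
    case True
    let ?a = "real (Suc i) * h" and ?b = "real j * h"
    have ab: "s \<le> ?a" "?a \<le> ?b" "?b \<le> t" "0 \<le> ?a" "?b \<le> real N * h"
      using i j True h by (auto intro!: mult_right_mono)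
    have 1: "norm (z ?a - z s) \<le> A * ?p"
      by (rule order_trans[OF small pm]) (use ab i st in \<open>auto simp: algebra_simps\<close>)
    have 3: "norm (z t - z ?b) \<le> A * ?p"
      by (rule order_trans[OF small pm]) (use ab j st in \<open>auto simp: algebra_simps\<close>)
    have 2: "norm (z ?b - z ?a) \<le> A * ?p"
    proof (cases "Suc i = j")
      case False
      define m where "m = j - Suc i"
      have m: "j = Suc i + m" "1 \<le> m" using False True by (auto simp: m_def)
      have mh: "real m * h = ?b - ?a" unfolding m(1) by (simp add: algebra_simps)
      have "norm (z (real (Suc i + m) * h) - z ?a) \<le> A * (real m * h) powr \<alpha>"
        by (rule coarse) (use m j mh ab st in auto)
      also have "\<dots> \<le> A * ?p" by (rule pm) (use mh ab h in auto)
      finally show ?thesis unfolding m(1) .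
    qed (use Ap in simp)
    have "z t - z s = (z t - z ?b) + (z ?b - z ?a) + (z ?a - z s)" by simp
    also have "norm \<dots> \<le> A * ?p + A * ?p + A * ?p" by (intro norm_triangle_le add_mono 1 2 3)
    finally show ?thesis by simp
  qed
qed


text \<open>The convergence for an abstract driver that satisfies the estimates; \<open>V\<close>
  plays the role of the driver field. Along the grid, \<open>y\<close> and \<open>y\<^sup>n\<close>
  are both perturbed trajectories of the Euler maps, \<open>y\<close> by the defining property of a
  solution and by \<open>driver_field_step\<close>, \<open>y\<^sup>n\<close> by
  \<open>driver_field_step\<close> on each cell.\<close>
theorem step_scheme_converges:
  fixes X :: "real \<Rightarrow> real \<Rightarrow> ('d::finite) vfield"
  assumes T: "0 < T" and \<alpha>: "1/3 < \<alpha>" "\<alpha> < 1/2" and C: "1 \<le> C"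
    and est: "driver_estimates C \<alpha> T X D B"
    and V: "\<And>s t \<xi>. 0 \<le> s \<Longrightarrow> s \<le> t \<Longrightarrow> t \<le> T \<Longrightarrow> V s t \<xi> = X s t \<xi> + (B s t \<xi> - (1/2) *\<^sub>R D s t \<xi> (X s t \<xi>))"
    and flow: "homeo_flow T \<phi>" and c: "0 < c" and a: "1 < a" and \<delta>0: "0 < \<delta>0"
    and close: "\<And>s t \<xi>. 0 \<le> s \<Longrightarrow> s \<le> t \<Longrightarrow> t \<le> T \<Longrightarrow> t - s \<le> \<delta>0 \<Longrightarrow>
        norm (\<phi> t s \<xi> - time_one_map (V s t) \<xi>) \<le> c * (t - s) powr a"
    and y: "\<And>t. t \<in> {0..T} \<Longrightarrow> y t = \<phi> t 0"
  shows "\<exists>(xn :: nat \<Rightarrow> real \<Rightarrow> 'd vfield) yn.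
    (\<forall>n. bounded_variation_path T (xn n)) \<and> (\<forall>n. ode_flow_map T (xn n) (yn n)) \<and>
    (\<forall>\<beta>. 0 < \<beta> \<and> \<beta> < \<alpha> \<longrightarrow> (\<lambda>n. holder_norm \<beta> T (\<lambda>t \<xi>. yn n t \<xi> - y t \<xi>)) \<longlonglongrightarrow> 0)"
proof -
  have \<alpha>0: "0 < \<alpha>" "\<alpha> \<le> 1" "1 < 3 * \<alpha>" using \<alpha> by auto
  have C0: "0 \<le> C" using C by simp
  obtain \<delta> K \<Lambda> where \<delta>: "0 < \<delta>" "\<delta> \<le> 1" and K: "0 \<le> K" and \<Lambda>: "1 \<le> \<Lambda>"
    and sewing: "\<And>(e :: nat \<Rightarrow> nat \<Rightarrow> real^'d \<Rightarrow> real^'d) h n i m a b. 0 < h \<Longrightarrow> almost_flow (35 * C ^ 3) \<alpha> (3 * \<alpha>) e h n \<Longrightarrow>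
       i + m \<le> n \<Longrightarrow> real m * h \<le> \<delta> \<Longrightarrow>
        (1 \<le> m \<longrightarrow> norm (iterate e i m a - e i (i + m) a) \<le> K * (real m * h) powr (3 * \<alpha>)) \<and>
        norm (iterate e i m a - iterate e i m b) \<le> \<Lambda> * norm (a - b)"
    using discrete_sewing[of "35 * C ^ 3" \<alpha> "3 * \<alpha>", where 'a="real^'d"] C0 \<alpha>0 by fastforce
  \<comment> \<open>The order of the error per step is the smaller one of the two available orders; both exceed \<open>1\<close>.\<close>
  define a' where "a' = min a (3 * \<alpha>)"
  have a': "1 < a'" "a' \<le> a" "a' \<le> 3 * \<alpha>" using a \<alpha>0 by (auto simp: a'_def)
  define c' where "c' = c + 20 * C ^ 5"
  have c': "0 \<le> c'" using c C0 by (simp add: c'_def)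
  have step: "norm (V s t b) \<le> 3 * C\<^sup>2 * (t - s) powr \<alpha>"
      "norm (V s t b - V s t b') \<le> 3 * C\<^sup>2 * (t - s) powr \<alpha> * norm (b - b')"
      "(\<And>r. r \<in> {0..1} \<Longrightarrow> (z has_vector_derivative V s t (z r)) (at r within {0..1})) \<Longrightarrow>
       norm (z 1 - euler_map X B s t (z 0)) \<le> 20 * C ^ 5 * (t - s) powr (3 * \<alpha>)"
      "(\<And>r. r \<in> {0..1} \<Longrightarrow> (z has_vector_derivative V s t (z r)) (at r within {0..1})) \<Longrightarrow>
       norm (z 1 - z 0) \<le> 3 * C\<^sup>2 * (t - s) powr \<alpha>"
    if "0 \<le> s" "s \<le> t" "t \<le> T" "t - s \<le> 1" for s t b b' z
    using driver_field_step[OF est that C \<alpha>0(1) V[OF that(1-3)]] by blast+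
  have tom: "norm (time_one_map (V s t) b - euler_map X B s t b) \<le> 20 * C ^ 5 * (t - s) powr (3 * \<alpha>)"
      "norm (time_one_map (V s t) b - b) \<le> 3 * C\<^sup>2 * (t - s) powr \<alpha>"
    if st: "0 \<le> s" "s \<le> t" "t \<le> T" "t - s \<le> 1" for s t b
  proof -
    obtain z where z: "z 0 = b" "z 1 = time_one_map (V s t) b"
      "\<And>r. r \<in> {0..1} \<Longrightarrow> (z has_vector_derivative V s t (z r)) (at r within {0..1})"
      using time_one_map_solution[of "V s t", OF step(2)[OF st], of b] by blast
    show "norm (time_one_map (V s t) b - euler_map X B s t b) \<le> 20 * C ^ 5 * (t - s) powr (3 * \<alpha>)"
      using step(3)[OF st, of z] z by simp
    show "norm (time_one_map (V s t) b - b) \<le> 3 * C\<^sup>2 * (t - s) powr \<alpha>"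
      using step(4)[OF st, of z] z by simp
  qed
  have y_flow: "y t \<xi> = \<phi> t s (y s \<xi>)" if "0 \<le> s" "s \<le> t" "t \<le> T" for s t \<xi>
  proof -
    have "\<phi> t s \<circ> \<phi> s 0 = \<phi> t 0" using flow that unfolding homeo_flow_def by blast
    then show ?thesis using y[of s] y[of t] that by (metis atLeastAtMost_iff comp_apply order_trans)
  qed
  have y0: "y 0 \<xi> = \<xi>" for \<xi>
    using flow y[of 0] T unfolding homeo_flow_def by auto
  have powr_le: "u powr p \<le> u powr q" if "0 \<le> u" "u \<le> 1" "q \<le> p" "0 < q" for u p q :: real
    using that by (cases "u = 0") (auto intro: powr_mono')
  have y_hoelder: "norm (y t \<xi> - y s \<xi>) \<le> (c + 3 * C\<^sup>2) * (t - s) powr \<alpha>"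
    if st: "0 \<le> s" "s \<le> t" "t \<le> T" "t - s \<le> \<delta>0" "t - s \<le> 1" for s t \<xi>
  proof -
    have "y t \<xi> - y s \<xi> = (\<phi> t s (y s \<xi>) - time_one_map (V s t) (y s \<xi>)) + (time_one_map (V s t) (y s \<xi>) - y s \<xi>)"
      using y_flow[OF st(1-3)] by simp
    also have "norm \<dots> \<le> c * (t - s) powr a + 3 * C\<^sup>2 * (t - s) powr \<alpha>"
      using st by (intro norm_triangle_le add_mono close tom) auto
    also have "\<dots> \<le> c * (t - s) powr \<alpha> + 3 * C\<^sup>2 * (t - s) powr \<alpha>"
      using st a \<alpha>0 c by (intro add_right_mono mult_left_mono powr_le) auto
    finally show ?thesis by (simp add: algebra_simps)
  qed
  \<comment> \<open>The mesh stays below \<open>m0\<close>: half of \<open>\<delta>\<close> guarantees blocks of at least two steps, \<open>\<delta>0\<close> makes the estimate for \<open>\<phi>\<close> available on cells.\<close>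
  define m0 where "m0 = min (\<delta> / 2) \<delta>0"
  have m0: "0 < m0" "m0 \<le> \<delta> / 2" "m0 \<le> \<delta>0" "m0 \<le> 1" using \<delta> \<delta>0 by (auto simp: m0_def)
  define N where "N = (\<lambda>n. n + Suc (nat \<lceil>T / m0\<rceil>))"
  define h where "h = (\<lambda>n. T / real (N n))"
  have N: "0 < N n" for n by (simp add: N_def)
  have h: "0 < h n" "h n \<le> m0" "real (N n) * h n = T" for n
  proof -
    show "0 < h n" "real (N n) * h n = T" using T N[of n] by (auto simp: h_def)
    have "T / m0 \<le> real (N n)" unfolding N_def by linarith
    then show "h n \<le> m0" using m0(1) N[of n] by (simp add: h_def field_simps)
  qed
  have h1: "h n \<le> 1" "h n \<le> \<delta>0" "h n \<le> \<delta> / 2" for n using h(2)[of n] m0 by auto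
  have h_lim: "h \<longlonglongrightarrow> 0"
    unfolding h_def N_def by (rule LIMSEQ_ignore_initial_segment[OF lim_const_over_n])
  define G where "G = (\<lambda>n i \<eta>. (1 / h n) *\<^sub>R V (real i * h n) (real (Suc i) * h n) \<eta>)"
  define xn where "xn = (\<lambda>n r. G n (cell (h n) (N n) r))"
  have grid: "0 \<le> real i * h n" "real i * h n \<le> real (Suc i) * h n" "real (Suc i) * h n \<le> T"
    "real (Suc i) * h n - real i * h n \<le> 1" and grid_diff: "real (Suc i) * h n - real i * h n = h n" if "i < N n" for i n
  proof -
    show "0 \<le> real i * h n" "real i * h n \<le> real (Suc i) * h n" using h(1)[of n] by (auto intro!: mult_right_mono)
    have "real (Suc i) * h n \<le> real (N n) * h n" using that h(1)[of n] by (intro mult_right_mono) auto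
    then show "real (Suc i) * h n \<le> T" by (simp only: h(3))
    show e: "real (Suc i) * h n - real i * h n = h n" by (simp add: algebra_simps)
    show "real (Suc i) * h n - real i * h n \<le> 1" unfolding e by (rule h1)
  qed
  define M where "M = (\<lambda>n. (1 / h n) * (3 * C\<^sup>2 * h n powr \<alpha>))"
  have G_bound: "norm (G n i \<eta>) \<le> M n" and G_lip: "norm (G n i \<eta> - G n i \<zeta>) \<le> M n * norm (\<eta> - \<zeta>)" if i: "i < N n" for n i \<eta> \<zeta>
  proof -
    show "norm (G n i \<eta>) \<le> M n"
      using step(1)[OF grid[OF i], of \<eta>] h(1)[of n] unfolding grid_diff[OF i] G_def M_def
      by (simp add: divide_right_mono)
    have "G n i \<eta> - G n i \<zeta> = (1 / h n) *\<^sub>R (V (real i * h n) (real (Suc i) * h n) \<eta> - V (real i * h n) (real (Suc i) * h n) \<zeta>)"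
      by (simp add: G_def algebra_simps)
    then show "norm (G n i \<eta> - G n i \<zeta>) \<le> M n * norm (\<eta> - \<zeta>)"
      using step(2)[OF grid[OF i], of \<eta> \<zeta>] h(1)[of n] unfolding grid_diff[OF i] M_def
      by (simp add: divide_right_mono)
  qed
  have lip_cont: "continuous_on UNIV g" if "\<And>\<eta> \<zeta>. norm (g \<eta> - g \<zeta>) \<le> L * norm (\<eta> - \<zeta>)" for g :: "'d vfield" and L
  proof -
    have "norm (g \<eta> - g \<zeta>) \<le> \<bar>L\<bar> * norm (\<eta> - \<zeta>)" for \<eta> \<zeta>
      by (rule order_trans[OF that]) (intro mult_right_mono, auto)
    then have "\<bar>L\<bar>-lipschitz_on UNIV g" by (intro lipschitz_onI) (auto simp: dist_norm)
    then show ?thesis by (rule lipschitz_on_continuous_on)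
  qed
  have bv: "bounded_variation_path T (xn n)" for n
    unfolding xn_def by (rule step_field_bounded_variation[OF h(1) N lip_cont[OF G_lip] G_bound])
  have "\<exists>Y. ode_flow_map T (xn n) Y" for n
    unfolding xn_def using T by (intro step_field_flow_exists[OF _ N G_lip]) auto
  then obtain yn where yn: "\<And>n. ode_flow_map T (xn n) (yn n)" by metis
  have sol: "ode_solution T (xn n) \<xi> (\<lambda>t. yn n t \<xi>)" for n \<xi> using yn by (simp add: ode_flow_map_def)
  have yn0: "yn n 0 \<xi> = \<xi>" for n \<xi> using sol[of n \<xi>] T by (auto simp: ode_solution_def)
  define e where "e = (\<lambda>n i j. euler_map X B (real i * h n) (real j * h n))"
  have af: "almost_flow (35 * C ^ 3) \<alpha> (3 * \<alpha>) (e n) (h n) (N n)" for n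
    unfolding e_def by (rule driver_almost_flow[OF est C \<alpha>0(1) h(1)]) (simp add: h(3))
  define \<eta> where "\<eta> = (\<lambda>n. c' * h n powr a')"
  have \<eta>0: "0 \<le> \<eta> n" for n using c' by (simp add: \<eta>_def)
  have h_powr: "h n powr (3 * \<alpha>) \<le> h n powr a'" "h n powr a \<le> h n powr a'" for n
    using h(1)[of n] h1(1)[of n] a' by (auto intro!: powr_le)
  have w_err: "norm (yn n (real (Suc i) * h n) \<xi> - e n i (Suc i) (yn n (real i * h n) \<xi>)) \<le> \<eta> n" if i: "i < N n" for n i \<xi>
  proof -
    let ?z = "\<lambda>\<rho>. yn n (real i * h n + \<rho> * h n) \<xi>"
    have Vc: "continuous_on UNIV (V (real i * h n) (real (Suc i) * h n))"
      by (rule lip_cont[OF step(2)[OF grid[OF i]]])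
    have s: "ode_solution T (\<lambda>r \<eta>. (1 / h n) *\<^sub>R V (real (cell (h n) (N n) r) * h n) (real (Suc (cell (h n) (N n) r)) * h n) \<eta>) \<xi> (\<lambda>t. yn n t \<xi>)"
      using sol[of n \<xi>] unfolding xn_def G_def .
    have "(?z has_vector_derivative V (real i * h n) (real (Suc i) * h n) (?z \<rho>)) (at \<rho> within {0..1})" if "\<rho> \<in> {0..1}" for \<rho>
      by (rule step_field_cell_derivative[OF h(1) i h(3) _ _ that, where W = "\<lambda>i. V (real i * h n) (real (Suc i) * h n)"]) (fact Vc s)+
    from step(3)[OF grid[OF i] this]
    have "norm (?z 1 - euler_map X B (real i * h n) (real (Suc i) * h n) (?z 0)) \<le> 20 * C ^ 5 * h n powr (3 * \<alpha>)"
      unfolding grid_diff[OF i] by blast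
    also have "\<dots> \<le> c' * h n powr a'"
      using C0 c h_powr by (intro mult_mono) (auto simp: c'_def)
    also have "real i * h n + 1 * h n = real (Suc i) * h n" by (simp add: algebra_simps)
    finally show ?thesis by (simp add: e_def \<eta>_def)
  qed
  have z_err: "norm (y (real (Suc i) * h n) \<xi> - e n i (Suc i) (y (real i * h n) \<xi>)) \<le> \<eta> n" if i: "i < N n" for n i \<xi>
  proof -
    let ?s = "real i * h n" and ?t = "real (Suc i) * h n"
    note g = grid[OF i]
    have "y ?t \<xi> - e n i (Suc i) (y ?s \<xi>) = (\<phi> ?t ?s (y ?s \<xi>) - time_one_map (V ?s ?t) (y ?s \<xi>)) + (time_one_map (V ?s ?t) (y ?s \<xi>) - euler_map X B ?s ?t (y ?s \<xi>))"
      using y_flow[OF g(1-3)] by (simp add: e_def)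
    also have "norm \<dots> \<le> c * h n powr a + 20 * C ^ 5 * h n powr (3 * \<alpha>)"
      using close[OF g(1-3), of "y ?s \<xi>"] tom(1)[OF g, of "y ?s \<xi>"] h1(2)[of n] unfolding grid_diff[OF i]
      by (intro norm_triangle_le add_mono) auto
    also have "\<dots> \<le> c * h n powr a' + 20 * C ^ 5 * h n powr a'"
      using c C0 h_powr by (intro add_mono mult_left_mono) auto
    finally show ?thesis by (simp add: \<eta>_def c'_def algebra_simps)
  qed
  have lip: "norm (iterate (e n) i m p - iterate (e n) i m p') \<le> \<Lambda> * norm (p - p')" if "i + m \<le> N n" "real m * h n \<le> \<delta>" for n i m p p'
    using sewing[OF h(1) af that] by blast
  have \<eta>_le: "\<eta> n = c' * h n powr (a' - 1) * h n" for n
    using h(1)[of n] by (simp add: \<eta>_def powr_diff)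
  have h_powr1: "h n powr (a' - 1) \<le> 1" for n
    using h(1)[of n] h1(1)[of n] a' powr_mono2[of "a' - 1" "h n" 1] by simp
  \<comment> \<open>A block consists of as many steps as fit into \<open>\<delta>\<close>. Rounding loses at most a factor \<open>2\<close>, so \<open>b\<close> blocks cover the whole interval for every \<open>n\<close>.\<close>
  define b where "b = nat \<lceil>2 * T / \<delta>\<rceil>"
  define Q where "Q = (\<lambda>n. nat \<lfloor>\<delta> / h n\<rfloor>)"
  have Q: "real (Q n) * h n \<le> \<delta>" "0 < Q n" "N n \<le> b * Q n" for n
  proof -
    have q: "2 \<le> \<delta> / h n" using h1(3)[of n] h(1)[of n] by (simp add: field_simps)
    have r: "real (Q n) = of_int \<lfloor>\<delta> / h n\<rfloor>" unfolding Q_def using q by simp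
    have "real (Q n) \<le> \<delta> / h n" unfolding r by simp
    then show "real (Q n) * h n \<le> \<delta>" using h(1)[of n] by (simp add: field_simps)
    have half: "u / 2 \<le> of_int \<lfloor>u\<rfloor>" if "2 \<le> u" for u :: real using that by linarith
    have lower: "\<delta> / h n / 2 \<le> real (Q n)" unfolding r by (rule half[OF q])
    show "0 < Q n" using lower q by (intro gr0I) simp
    have "real (N n) = (2 * T / \<delta>) * (\<delta> / h n / 2)" using \<delta> h(1)[of n] h(3)[of n] by (simp add: field_simps)
    also have "\<dots> \<le> real b * real (Q n)"
    proof (intro mult_mono lower)
      show "2 * T / \<delta> \<le> real b" unfolding b_def by (rule real_nat_ceiling_ge)
    qed (use \<delta> h(1)[of n] in auto)
    finally have "real (N n) \<le> real (b * Q n)" by (simp only: of_nat_mult)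
    then show "N n \<le> b * Q n" by (simp only: of_nat_le_iff)
  qed
  define E1 where "E1 = 2 * real b * (\<delta> * c') * \<Lambda> ^ b"
  have E1: "0 \<le> E1" using \<delta> c' \<Lambda> by (simp add: E1_def)
  have grid_close: "norm (yn n (real i * h n) \<xi> - y (real i * h n) \<xi>) \<le> E1 * h n powr (a' - 1)" if i: "i \<le> N n" for n i \<xi>
  proof -
    have "norm (yn n (real i * h n) \<xi> - y (real i * h n) \<xi>) \<le> 2 * real b * (real (Q n) * \<eta> n) * \<Lambda> ^ b"
    proof (rule perturbed_trajectories_close[where e = "e n" and h = "h n" and \<delta> = \<delta> and n = "N n"
            and z = "\<lambda>i. yn n (real i * h n) \<xi>" and w = "\<lambda>i. y (real i * h n) \<xi>"])
      show "yn n (real 0 * h n) \<xi> = y (real 0 * h n) \<xi>" by (simp add: yn0 y0)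
      show "0 \<le> h n" using h(1) by (rule less_imp_le)
      show "i \<le> b * Q n" using i Q(3) by (rule order_trans)
    qed (fact \<Lambda> \<eta>0 Q i | rule lip w_err z_err; assumption)+
    also have "\<dots> \<le> 2 * real b * (\<delta> * (c' * h n powr (a' - 1))) * \<Lambda> ^ b"
    proof -
      have "real (Q n) * \<eta> n = (real (Q n) * h n) * (c' * h n powr (a' - 1))" by (simp add: \<eta>_le)
      also have "\<dots> \<le> \<delta> * (c' * h n powr (a' - 1))" using c' by (intro mult_right_mono Q) auto
      finally show ?thesis using \<Lambda> by (intro mult_right_mono mult_left_mono) auto
    qed
    finally show ?thesis by (simp add: E1_def mult_ac)
  qed
  define A where "A = 3 * C\<^sup>2 + (\<Lambda> * c' + K + 2 * C)"
  have A0: "0 \<le> A" using C0 \<Lambda> c' K by (simp add: A_def)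
  have w_coarse: "norm (yn n (real (i + m) * h n) \<xi> - yn n (real i * h n) \<xi>) \<le> A * (real m * h n) powr \<alpha>"
    if im: "i + m \<le> N n" "1 \<le> m" "real m * h n \<le> \<delta>" for n i m \<xi>
  proof -
    let ?w = "\<lambda>i. yn n (real i * h n) \<xi>" and ?u = "real m * h n"
    have u: "0 < ?u" "?u \<le> 1" using im h(1)[of n] \<delta> by auto
    let ?s = "real i * h n" and ?t = "real (i + m) * h n"
    have st: "0 \<le> ?s" "?s \<le> ?t" "?t \<le> T" "?t - ?s = ?u"
    proof -
      have "?t \<le> real (N n) * h n" using im h(1)[of n] by (intro mult_right_mono) auto
      then show "?t \<le> T" by (simp only: h(3))
    qed (use h(1)[of n] in \<open>auto simp: algebra_simps\<close>)
    have 1: "norm (?w (i + m) - iterate (e n) i m (?w i)) \<le> \<Lambda> * c' * ?u powr \<alpha>"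
    proof -
      have "norm (?w (i + m) - iterate (e n) i m (?w i)) \<le> \<Lambda> * (real m * \<eta> n)"
      proof (rule perturbed_trajectory[where n = "N n" and h = "h n" and \<delta> = \<delta> and z = ?w])
        show "0 \<le> \<Lambda>" "0 \<le> h n" using \<Lambda> h(1)[of n] by auto
      qed (fact im | rule lip w_err; assumption)+
      also have "real m * \<eta> n = c' * h n powr (a' - 1) * ?u" by (simp add: \<eta>_le)
      also have "\<dots> \<le> c' * 1 * ?u" using c' u h_powr1 by (intro mult_right_mono mult_left_mono) auto
      also have "\<dots> \<le> c' * 1 * ?u powr \<alpha>" using c' u \<alpha>0 powr_le[of ?u \<alpha> 1] by (intro mult_left_mono) auto
      finally show ?thesis using \<Lambda> by (simp add: mult_left_mono mult.assoc)
    qed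
    have 2: "norm (iterate (e n) i m (?w i) - e n i (i + m) (?w i)) \<le> K * ?u powr \<alpha>"
    proof -
      have "norm (iterate (e n) i m (?w i) - e n i (i + m) (?w i)) \<le> K * ?u powr (3 * \<alpha>)"
        using sewing[OF h(1) af im(1,3)] im(2) by blast
      also have "\<dots> \<le> K * ?u powr \<alpha>" using K u \<alpha>0 by (intro mult_left_mono powr_le) auto
      finally show ?thesis .
    qed
    have 3: "norm (e n i (i + m) (?w i) - ?w i) \<le> 2 * C * ?u powr \<alpha>"
    proof -
      note d = driver_estimatesD[OF est st(1-3)]
      have le1: "?t - ?s \<le> 1" using st(4) u by linarith
      show ?thesis
        using tame_euler_map(3)[where X = X and B = B and s = ?s and t = ?t, OF regular_fieldD(1)[OF d(1)] d(2) driver_tame_sum[OF est st(1-3) le1 C \<alpha>0(1)]]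
        unfolding st(4) e_def .
    qed
    have "?w (i + m) - ?w i = (?w (i + m) - iterate (e n) i m (?w i)) + (iterate (e n) i m (?w i) - e n i (i + m) (?w i)) + (e n i (i + m) (?w i) - ?w i)"
      by simp
    also have "norm \<dots> \<le> \<Lambda> * c' * ?u powr \<alpha> + K * ?u powr \<alpha> + 2 * C * ?u powr \<alpha>"
      by (intro norm_triangle_le add_mono 1 2 3)
    also have "\<dots> = (\<Lambda> * c' + K + 2 * C) * ?u powr \<alpha>" by (simp add: distrib_right)
    also have "\<dots> \<le> A * ?u powr \<alpha>" unfolding A_def using C0 by (intro mult_right_mono) auto
    finally show ?thesis .
  qed
  have w_fine: "norm (yn n t \<xi> - yn n s \<xi>) \<le> A * (h n powr \<alpha> / h n) * (t - s)"
    if st: "0 \<le> s" "s \<le> t" "t \<le> real (N n) * h n" for n s t \<xi>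
  proof -
    have "norm (yn n t \<xi> - yn n s \<xi>) \<le> M n * (t - s)"
    proof (rule ode_solution_increment(2)[OF sol st(1,2)])
      show "t \<le> T" using st(3) h(3) by simp
      show "norm (xn n r p) \<le> M n" for r p unfolding xn_def by (intro G_bound cell_less N)
    qed
    also have "M n * (t - s) \<le> A * (h n powr \<alpha> / h n) * (t - s)"
    proof (rule mult_right_mono)
      have "M n = 3 * C\<^sup>2 * (h n powr \<alpha> / h n)" by (simp add: M_def)
      also have "\<dots> \<le> A * (h n powr \<alpha> / h n)"
        using \<Lambda> c' K C0 h(1)[of n] by (intro mult_right_mono) (auto simp: A_def)
      finally show "M n \<le> A * (h n powr \<alpha> / h n)" .
    qed (use st in simp)
    finally show ?thesis .
  qed
  have w_hoelder: "norm (yn n t \<xi> - yn n s \<xi>) \<le> 3 * A * (t - s) powr \<alpha>"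
    if st: "0 \<le> s" "s \<le> t" "t \<le> T" "t - s \<le> \<delta>" for n s t \<xi>
  proof (rule grid_hoelder[where z = "\<lambda>t. yn n t \<xi>" and N = "N n" and h = "h n" and \<delta> = \<delta>])
    show "t \<le> real (N n) * h n" using st(3) by (simp only: h(3))
  qed (fact h(1) \<alpha>0 A0 st | rule w_fine w_coarse; assumption)+
  \<comment> \<open>Hoelder constants of the approximations and of \<open>y\<close>, added because only differences matter.\<close>
  define H where "H = 3 * A + (c + 3 * C\<^sup>2)"
  have H0: "0 \<le> H" using A0 c by (simp add: H_def)
  have d_hoelder: "norm ((yn n t \<xi> - y t \<xi>) - (yn n s \<xi> - y s \<xi>)) \<le> H * (t - s) powr \<alpha>"
    if st: "0 \<le> s" "s \<le> t" "t \<le> T" "t - s \<le> min \<delta> \<delta>0" for n s t \<xi>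
  proof -
    have "(yn n t \<xi> - y t \<xi>) - (yn n s \<xi> - y s \<xi>) = (yn n t \<xi> - yn n s \<xi>) - (y t \<xi> - y s \<xi>)" by simp
    also have "norm \<dots> \<le> norm (yn n t \<xi> - yn n s \<xi>) + norm (y t \<xi> - y s \<xi>)" by (rule norm_triangle_ineq4)
    also have "\<dots> \<le> 3 * A * (t - s) powr \<alpha> + (c + 3 * C\<^sup>2) * (t - s) powr \<alpha>"
      using st \<delta> by (intro add_mono w_hoelder y_hoelder) auto
    finally show ?thesis by (simp add: H_def algebra_simps)
  qed
  define \<epsilon> where "\<epsilon> = (\<lambda>n. H * h n powr \<alpha> + E1 * h n powr (a' - 1))"
  have \<epsilon>0: "0 \<le> \<epsilon> n" for n using H0 E1 by (simp add: \<epsilon>_def)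
  have d_sup: "norm (yn n t \<xi> - y t \<xi>) \<le> \<epsilon> n" if t: "t \<in> {0..T}" for n t \<xi>
  proof -
    have t': "0 \<le> t" "t \<le> real (N n) * h n" using t h(3)[of n] by auto
    obtain j where j: "j \<le> N n" "real j * h n \<le> t" "t < real (Suc j) * h n"
      using grid_point_below[OF h(1) t'] by blast
    let ?s = "real j * h n"
    have th: "t - ?s \<le> h n" using j(3) by (simp add: algebra_simps)
    have s0: "0 \<le> ?s" using h(1)[of n] by simp
    have "norm ((yn n t \<xi> - y t \<xi>) - (yn n ?s \<xi> - y ?s \<xi>)) \<le> H * (t - ?s) powr \<alpha>"
      by (rule d_hoelder) (use t j(2) s0 th h1[of n] \<delta> in auto)
    also have "\<dots> \<le> H * h n powr \<alpha>"
      using H0 th j(2) \<alpha>0 by (intro mult_left_mono powr_mono2) auto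
    finally have 1: "norm ((yn n t \<xi> - y t \<xi>) - (yn n ?s \<xi> - y ?s \<xi>)) \<le> H * h n powr \<alpha>" .
    have "yn n t \<xi> - y t \<xi> = ((yn n t \<xi> - y t \<xi>) - (yn n ?s \<xi> - y ?s \<xi>)) + (yn n ?s \<xi> - y ?s \<xi>)" by simp
    also have "norm \<dots> \<le> \<epsilon> n"
      unfolding \<epsilon>_def by (intro norm_triangle_le add_mono 1 grid_close j(1))
    finally show ?thesis .
  qed
  have h_powr_lim: "(\<lambda>n. h n powr p) \<longlonglongrightarrow> 0" if "0 < p" for p
    by (rule tendsto_zero_powrI[OF h_lim tendsto_const _ that]) (use h(1) in \<open>auto intro!: always_eventually less_imp_le\<close>)
  have "\<epsilon> \<longlonglongrightarrow> H * 0 + E1 * 0"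
    unfolding \<epsilon>_def by (intro tendsto_intros h_powr_lim) (use \<alpha>0 a' in auto)
  then have \<epsilon>_lim: "\<epsilon> \<longlonglongrightarrow> 0" by simp
  have "(\<lambda>n. holder_norm \<beta> T (\<lambda>t \<xi>. yn n t \<xi> - y t \<xi>)) \<longlonglongrightarrow> 0" if \<beta>: "0 < \<beta>" "\<beta> < \<alpha>" for \<beta>
    by (rule holder_norm_tendsto_0[where \<delta> = "min \<delta> \<delta>0" and H = H and \<alpha> = \<alpha> and \<epsilon> = \<epsilon>])
       (use \<delta> \<delta>0 in simp, (fact H0 \<beta> \<epsilon>_lim \<epsilon>0 | rule d_hoelder d_sup; assumption)+)
  then show ?thesis using bv yn by blast
qed

theorem theorem3p4:
  fixes x :: "real \<Rightarrow> real^'d \<Rightarrow> real^'d"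
    and x2 :: "real \<Rightarrow> real \<Rightarrow> real^'d \<Rightarrow> real^'d \<Rightarrow> real^'d^'d"
    and y :: "real \<Rightarrow> real^'d \<Rightarrow> real^'d"
    and \<alpha> k T :: real and p :: nat and q :: ereal
  assumes "0 < T"
    and "1/3 < \<alpha>" and "\<alpha> < 1/2"
    and "3 \<le> p"
    and "k > real CARD('d) / 2 + real p + 1"
    and "1 \<le> q"
    and "weakly_geometric_rough_path q k \<alpha> T x x2"
    and "solves_rough_equation T x x2 y"
  shows "\<exists>(xn :: nat \<Rightarrow> real \<Rightarrow> real^'d \<Rightarrow> real^'d) (yn :: nat \<Rightarrow> real \<Rightarrow> real^'d \<Rightarrow> real^'d).
    (\<forall>n. bounded_variation_path T (xn n)) \<and>
    (\<forall>n. ode_flow_map T (xn n) (yn n)) \<and>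
    (\<forall>\<beta>. 1/3 < \<beta> \<and> \<beta> < \<alpha> \<longrightarrow>
       (\<lambda>n. holder_norm \<beta> T (\<lambda>t \<xi>. yn n t \<xi> - y t \<xi>)) \<longlonglongrightarrow> 0)"
proof -
  have k: "k > real CARD('d) / 2 + 4" using assms(4,5) by linarith
  have rp: "rough_path q k \<alpha> T x x2" using assms(7) by (simp add: weakly_geometric_rough_path_def)
  obtain C D B where C: "1 \<le> C" and est: "driver_estimates C \<alpha> T (increment x) D B"
    and V: "\<And>s t \<xi>. 0 \<le> s \<Longrightarrow> s \<le> t \<Longrightarrow> t \<le> T \<Longrightarrow>
       driver_field x x2 s t \<xi> = increment x s t \<xi> + (B s t \<xi> - (1/2) *\<^sub>R D s t \<xi> (increment x s t \<xi>))"
    using rough_path_driver_estimates[OF k assms(6) rp] by blast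
  obtain \<phi> \<delta> c a where \<phi>: "homeo_flow T \<phi>" and y: "\<forall>t\<in>{0..T}. y t = \<phi> t 0"
    and pos: "0 < \<delta>" "0 < c" "1 < a"
    and close: "\<forall>s t. 0 \<le> s \<and> s \<le> t \<and> t \<le> T \<and> t - s \<le> \<delta> \<longrightarrow>
           (\<forall>\<xi>. norm (\<phi> t s \<xi> - time_one_map (driver_field x x2 s t) \<xi>) \<le> c * (t - s) powr a)"
    using assms(8) unfolding solves_rough_equation_def by (elim exE conjE) (rule that)
  have close': "norm (\<phi> t s \<xi> - time_one_map (driver_field x x2 s t) \<xi>) \<le> c * (t - s) powr a"
    if "0 \<le> s" "s \<le> t" "t \<le> T" "t - s \<le> \<delta>" for s t \<xi>
    using close[rule_format, of s t \<xi>] that by simp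
  have "\<exists>(xn :: nat \<Rightarrow> real \<Rightarrow> real^'d \<Rightarrow> real^'d) yn.
    (\<forall>n. bounded_variation_path T (xn n)) \<and> (\<forall>n. ode_flow_map T (xn n) (yn n)) \<and>
    (\<forall>\<beta>. 0 < \<beta> \<and> \<beta> < \<alpha> \<longrightarrow> (\<lambda>n. holder_norm \<beta> T (\<lambda>t \<xi>. yn n t \<xi> - y t \<xi>)) \<longlonglongrightarrow> 0)"
    by (rule step_scheme_converges[OF assms(1-3) C est V \<phi> pos(2,3,1) close' y[rule_format]])
  then obtain xn :: "nat \<Rightarrow> real \<Rightarrow> real^'d \<Rightarrow> real^'d" and yn where
    bv: "\<forall>n. bounded_variation_path T (xn n)" and ode: "\<forall>n. ode_flow_map T (xn n) (yn n)"
    and lim: "\<forall>\<beta>. 0 < \<beta> \<and> \<beta> < \<alpha> \<longrightarrow> (\<lambda>n. holder_norm \<beta> T (\<lambda>t \<xi>. yn n t \<xi> - y t \<xi>)) \<longlonglongrightarrow> 0"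
    by (elim exE conjE) (rule that)
  have "(\<lambda>n. holder_norm \<beta> T (\<lambda>t \<xi>. yn n t \<xi> - y t \<xi>)) \<longlonglongrightarrow> 0" if "1/3 < \<beta> \<and> \<beta> < \<alpha>" for \<beta>
    using lim[rule_format, of \<beta>] that by simp
  with bv ode show ?thesis by (intro exI[of _ xn] exI[of _ yn] conjI) simp_all
qed

end
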